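(* Let $M$ be a differentiable manifold and let $r:TM\to M$ be a retraction. For $(p,v)\in TM$ write $\gamma_{p,v}(t)=r_p(tv)$. Then $r$ is the exponential map associated to an affine connection on $M$ if and only if $r$ induces a flow, that is, for every $(p,v)\in TM$, $$\dot\gamma_{p,v}(t+s)=\dot\gamma_{\gamma_{p,v}(t),\,\dot\gamma_{p,v}(t)}(s)\qquad\text{for all }t,s>0.$$
   Context: All objects are smooth. A retraction on $M$ is a map $r:TM\to M$ such that for every $p\in M$ the restriction $r_p=r|_{T_pM}:T_pM\to M$ satisfies $r_p(0)=p$ and $(\mathrm{d}r_p)_0=\mathrm{Id}_{T_pM}$ (identifying $T_0(T_pM)\cong T_pM$). The affine connection need not be the Levi-Civita connection of a metric. *)

theory Defs
  imports "HOL-Analysis.Analysis"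
begin

section \<open>Smooth functions and smooth manifolds\<close>

fun higher_differentiable_on ::
    "nat \<Rightarrow> ('a::real_normed_vector \<Rightarrow> 'b::real_normed_vector) \<Rightarrow> 'a set \<Rightarrow> bool" where
  "higher_differentiable_on 0 f S \<longleftrightarrow> continuous_on S f"
| "higher_differentiable_on (Suc k) f S \<longleftrightarrow>
     (\<forall>x\<in>S. f differentiable at x) \<and>
     (\<forall>v. higher_differentiable_on k (\<lambda>x. frechet_derivative f (at x) v) S)"

text \<open>Only used for open \<open>S\<close> in a finite-dimensional space.\<close>

definition smooth_on ::
    "('a::real_normed_vector \<Rightarrow> 'b::real_normed_vector) \<Rightarrow> 'a set \<Rightarrow> bool" where
  "smooth_on f S \<longleftrightarrow> (\<forall>k. higher_differentiable_on k f S)"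

text \<open>
  A chart is a pair of its domain and its coordinate map. The model space of a manifold is a
  type of class \<open>{real_inner, heine_borel}\<close>; by the theorem of Riesz these are exactly
  the finite-dimensional inner product spaces. In contrast to \<open>euclidean_space\<close>, dimension
  0 is not excluded.
\<close>

type_synonym ('m, 'e) chart = "'m set \<times> ('m \<Rightarrow> 'e)"

definition chart_inv :: "('m, 'e) chart \<Rightarrow> 'e \<Rightarrow> 'm" where
  "chart_inv c = inv_into (fst c) (snd c)"

definition transition :: "('m, 'e) chart \<Rightarrow> ('m, 'e) chart \<Rightarrow> 'e \<Rightarrow> 'e" where
  "transition c d = snd d \<circ> chart_inv c"

text \<open>
  The manifold is the whole type \<open>'m\<close>; Hausdorff and second countable are type class
  constraints. The atlas need not be maximal.
\<close>

definition smooth_manifold ::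
    "('m::{t2_space,second_countable_topology}, 'e::{real_inner,heine_borel}) chart set \<Rightarrow> bool" where
  "smooth_manifold A \<longleftrightarrow>
     (\<Union>c\<in>A. fst c) = UNIV \<and>
     (\<forall>c\<in>A. open (fst c) \<and> open (snd c ` fst c) \<and>
        homeomorphism (fst c) (snd c ` fst c) (snd c) (chart_inv c)) \<and>
     (\<forall>c\<in>A. \<forall>d\<in>A. smooth_on (transition c d) (snd c ` (fst c \<inter> fst d)))"

text \<open>
  Smoothness of a map between the manifolds with atlases \<open>A\<close> and \<open>B\<close>. The source need
  not be a whole type: its points are those covered by \<open>A\<close>, its topology is that of the charts.
\<close>

definition smooth_map ::
    "('a, 'e::real_normed_vector) chart set \<Rightarrow> ('b, 'f::real_normed_vector) chart set \<Rightarrow>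
     ('a \<Rightarrow> 'b) \<Rightarrow> bool" where
  "smooth_map A B f \<longleftrightarrow>
     (\<forall>x \<in> (\<Union>c\<in>A. fst c). \<exists>c\<in>A. \<exists>d\<in>B. \<exists>W.
        x \<in> fst c \<and> open W \<and> W \<subseteq> snd c ` fst c \<and> snd c x \<in> W \<and>
        f ` chart_inv c ` W \<subseteq> fst d \<and>
        smooth_on (snd d \<circ> f \<circ> chart_inv c) W)"

definition open_atlas :: "'e set \<Rightarrow> ('e, 'e) chart set" where
  "open_atlas S = {(S, \<lambda>x. x)}"

definition smooth_functions ::
    "('m, 'e::real_normed_vector) chart set \<Rightarrow> ('m \<Rightarrow> real) set" where
  "smooth_functions A = {f. smooth_map A (open_atlas UNIV) f}"

section \<open>Tangent bundle\<close>

text \<open>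
  A tangent vector at \<open>p\<close> is given by its components in all charts around \<open>p\<close>, related
  by the derivatives of the transition maps. Components in other charts are set to 0 so that
  equality of tangent vectors is equality of functions. In particular the zero vector is the
  zero function, and the vector space operations are pointwise.
\<close>

type_synonym ('m, 'e) tvec = "('m, 'e) chart \<Rightarrow> 'e"

definition tangent_space ::
    "('m, 'e::real_normed_vector) chart set \<Rightarrow> 'm \<Rightarrow> ('m, 'e) tvec set" where
  "tangent_space A p =
     {v. (\<forall>c. c \<notin> A \<or> p \<notin> fst c \<longrightarrow> v c = 0) \<and>
         (\<forall>c\<in>A. \<forall>d\<in>A. p \<in> fst c \<inter> fst d \<longrightarrow>
            v d = frechet_derivative (transition c d) (at (snd c p)) (v c))}"

definition tzero :: "('m, 'e::real_normed_vector) tvec" where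
  "tzero = (\<lambda>c. 0)"

definition tadd ::
    "('m, 'e::real_normed_vector) tvec \<Rightarrow> ('m, 'e) tvec \<Rightarrow> ('m, 'e) tvec" where
  "tadd v w = (\<lambda>c. v c + w c)"

definition tscale ::
    "real \<Rightarrow> ('m, 'e::real_normed_vector) tvec \<Rightarrow> ('m, 'e) tvec" where
  "tscale a v = (\<lambda>c. a *\<^sub>R v c)"

definition tangent_bundle ::
    "('m, 'e::real_normed_vector) chart set \<Rightarrow> ('m \<times> ('m, 'e) tvec) set" where
  "tangent_bundle A = (SIGMA p:UNIV. tangent_space A p)"

definition tangent_chart ::
    "('m, 'e::real_normed_vector) chart set \<Rightarrow> ('m, 'e) chart \<Rightarrow>
     ('m \<times> ('m, 'e) tvec, 'e \<times> 'e) chart" where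
  "tangent_chart A c = (SIGMA p:fst c. tangent_space A p, \<lambda>(p, v). (snd c p, v c))"

definition tangent_atlas ::
    "('m, 'e::real_normed_vector) chart set \<Rightarrow> ('m \<times> ('m, 'e) tvec, 'e \<times> 'e) chart set" where
  "tangent_atlas A = tangent_chart A ` A"

definition vector_fields ::
    "('m, 'e::real_normed_vector) chart set \<Rightarrow> ('m \<Rightarrow> ('m, 'e) tvec) set" where
  "vector_fields A =
     {X. (\<forall>p. X p \<in> tangent_space A p) \<and> smooth_map A (tangent_atlas A) (\<lambda>p. (p, X p))}"

definition vf_apply ::
    "('m, 'e::real_normed_vector) chart set \<Rightarrow> ('m \<Rightarrow> ('m, 'e) tvec) \<Rightarrow> ('m \<Rightarrow> real) \<Rightarrow> 'm \<Rightarrow> real" where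
  "vf_apply A X f p =
     (let c = SOME c. c \<in> A \<and> p \<in> fst c
      in frechet_derivative (f \<circ> chart_inv c) (at (snd c p)) (X p c))"

definition velocity ::
    "('m, 'e::real_normed_vector) chart set \<Rightarrow> (real \<Rightarrow> 'm) \<Rightarrow> real \<Rightarrow> ('m, 'e) tvec" where
  "velocity A \<gamma> t =
     (\<lambda>c. if c \<in> A \<and> \<gamma> t \<in> fst c then vector_derivative (snd c \<circ> \<gamma>) (at t) else 0)"

definition lifted_velocity ::
    "('m, 'e::real_normed_vector) chart set \<Rightarrow> (real \<Rightarrow> 'm) \<Rightarrow> real \<Rightarrow> 'm \<times> ('m, 'e) tvec" where
  "lifted_velocity A \<gamma> t = (\<gamma> t, velocity A \<gamma> t)"

section \<open>Affine connections, geodesics and the exponential map\<close>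

definition affine_connection ::
    "('m, 'e::real_normed_vector) chart set \<Rightarrow>
     (('m \<Rightarrow> ('m, 'e) tvec) \<Rightarrow> ('m \<Rightarrow> ('m, 'e) tvec) \<Rightarrow> ('m \<Rightarrow> ('m, 'e) tvec)) \<Rightarrow> bool" where
  "affine_connection A nabla \<longleftrightarrow>
     (\<forall>X\<in>vector_fields A. \<forall>Y\<in>vector_fields A. nabla X Y \<in> vector_fields A) \<and>
     (\<forall>X\<in>vector_fields A. \<forall>Y\<in>vector_fields A. \<forall>Z\<in>vector_fields A.
        \<forall>f\<in>smooth_functions A. \<forall>g\<in>smooth_functions A.
          nabla (\<lambda>p. tadd (tscale (f p) (X p)) (tscale (g p) (Y p))) Z =
            (\<lambda>p. tadd (tscale (f p) (nabla X Z p)) (tscale (g p) (nabla Y Z p)))) \<and>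
     (\<forall>X\<in>vector_fields A. \<forall>Y\<in>vector_fields A. \<forall>Z\<in>vector_fields A.
        nabla X (\<lambda>p. tadd (Y p) (Z p)) = (\<lambda>p. tadd (nabla X Y p) (nabla X Z p))) \<and>
     (\<forall>X\<in>vector_fields A. \<forall>Y\<in>vector_fields A. \<forall>f\<in>smooth_functions A.
        nabla X (\<lambda>p. tscale (f p) (Y p)) =
          (\<lambda>p. tadd (tscale (f p) (nabla X Y p)) (tscale (vf_apply A X f p) (Y p))))"

text \<open>
  \<open>christoffel A nabla c p u w\<close> is the coordinate vector with components
  \<open>\<Gamma>\<^sup>k\<^sub>i\<^sub>j(p) u\<^sup>i w\<^sup>j\<close> in the chart \<open>c\<close>. It is the value at
  \<open>p\<close> of \<open>\<nabla>\<^bsub>U\<^esub> W\<close> for the coordinate fields \<open>U\<close>, \<open>W\<close> with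
  constant components \<open>u\<close>, \<open>w\<close>. These fields exist only on the domain of \<open>c\<close>,
  so \<open>U\<close> and \<open>W\<close> range over the global fields that coincide with them near \<open>p\<close>;
  the value does not depend on the choice.
\<close>

definition coordinate_constant_near ::
    "('m::topological_space, 'e) chart \<Rightarrow> 'm \<Rightarrow> 'e \<Rightarrow> ('m \<Rightarrow> ('m, 'e) tvec) \<Rightarrow> bool" where
  "coordinate_constant_near c p u X \<longleftrightarrow>
     (\<exists>N. open N \<and> p \<in> N \<and> N \<subseteq> fst c \<and> (\<forall>q\<in>N. X q c = u))"

definition christoffel ::
    "('m::topological_space, 'e::real_normed_vector) chart set \<Rightarrow>
     (('m \<Rightarrow> ('m, 'e) tvec) \<Rightarrow> ('m \<Rightarrow> ('m, 'e) tvec) \<Rightarrow> ('m \<Rightarrow> ('m, 'e) tvec)) \<Rightarrow>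
     ('m, 'e) chart \<Rightarrow> 'm \<Rightarrow> 'e \<Rightarrow> 'e \<Rightarrow> 'e" where
  "christoffel A nabla c p u w =
     (THE z. \<exists>U\<in>vector_fields A. \<exists>W\<in>vector_fields A.
        coordinate_constant_near c p u U \<and> coordinate_constant_near c p w W \<and>
        z = nabla U W p c)"

definition covariant_derivative_along ::
    "('m::topological_space, 'e::real_normed_vector) chart set \<Rightarrow>
     (('m \<Rightarrow> ('m, 'e) tvec) \<Rightarrow> ('m \<Rightarrow> ('m, 'e) tvec) \<Rightarrow> ('m \<Rightarrow> ('m, 'e) tvec)) \<Rightarrow>
     (real \<Rightarrow> 'm) \<Rightarrow> (real \<Rightarrow> ('m, 'e) tvec) \<Rightarrow> real \<Rightarrow> ('m, 'e) tvec" where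
  "covariant_derivative_along A nabla \<gamma> V t =
     (\<lambda>c. if c \<in> A \<and> \<gamma> t \<in> fst c
          then vector_derivative (\<lambda>\<tau>. V \<tau> c) (at t) +
               christoffel A nabla c (\<gamma> t) (velocity A \<gamma> t c) (V t c)
          else 0)"

definition geodesic_on ::
    "('m::topological_space, 'e::real_normed_vector) chart set \<Rightarrow>
     (('m \<Rightarrow> ('m, 'e) tvec) \<Rightarrow> ('m \<Rightarrow> ('m, 'e) tvec) \<Rightarrow> ('m \<Rightarrow> ('m, 'e) tvec)) \<Rightarrow>
     real set \<Rightarrow> (real \<Rightarrow> 'm) \<Rightarrow> bool" where
  "geodesic_on A nabla I \<gamma> \<longleftrightarrow>
     open I \<and> is_interval I \<and> smooth_map (open_atlas I) A \<gamma> \<and>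
     (\<forall>t\<in>I. covariant_derivative_along A nabla \<gamma> (velocity A \<gamma>) t = tzero)"

definition exp_geodesic ::
    "('m::topological_space, 'e::real_normed_vector) chart set \<Rightarrow>
     (('m \<Rightarrow> ('m, 'e) tvec) \<Rightarrow> ('m \<Rightarrow> ('m, 'e) tvec) \<Rightarrow> ('m \<Rightarrow> ('m, 'e) tvec)) \<Rightarrow>
     'm \<times> ('m, 'e) tvec \<Rightarrow> (real \<Rightarrow> 'm) \<Rightarrow> bool" where
  "exp_geodesic A nabla x \<gamma> \<longleftrightarrow>
     (\<exists>I. {0, 1} \<subseteq> I \<and> geodesic_on A nabla I \<gamma> \<and> lifted_velocity A \<gamma> 0 = x)"

definition exp_domain ::
    "('m::topological_space, 'e::real_normed_vector) chart set \<Rightarrow>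
     (('m \<Rightarrow> ('m, 'e) tvec) \<Rightarrow> ('m \<Rightarrow> ('m, 'e) tvec) \<Rightarrow> ('m \<Rightarrow> ('m, 'e) tvec)) \<Rightarrow>
     ('m \<times> ('m, 'e) tvec) set" where
  "exp_domain A nabla = {x \<in> tangent_bundle A. \<exists>\<gamma>. exp_geodesic A nabla x \<gamma>}"

definition exp_map ::
    "('m::topological_space, 'e::real_normed_vector) chart set \<Rightarrow>
     (('m \<Rightarrow> ('m, 'e) tvec) \<Rightarrow> ('m \<Rightarrow> ('m, 'e) tvec) \<Rightarrow> ('m \<Rightarrow> ('m, 'e) tvec)) \<Rightarrow>
     'm \<times> ('m, 'e) tvec \<Rightarrow> 'm" where
  "exp_map A nabla x = (THE q. \<exists>\<gamma>. exp_geodesic A nabla x \<gamma> \<and> q = \<gamma> 1)"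

section \<open>Retractions\<close>

text \<open>
  The derivative of \<open>r\<^sub>p\<close> at 0 is expressed in a chart \<open>c\<close> around \<open>p\<close>. The
  coordinates on the vector space \<open>T\<^sub>p M\<close> are given by the linear isomorphism
  \<open>v \<mapsto> v c\<close>, whose inverse appears below.
\<close>

definition tangent_retraction ::
    "('m, 'e::real_normed_vector) chart set \<Rightarrow> ('m \<times> ('m, 'e) tvec \<Rightarrow> 'm) \<Rightarrow> bool" where
  "tangent_retraction A r \<longleftrightarrow>
     smooth_map (tangent_atlas A) A r \<and>
     (\<forall>p. r (p, tzero) = p) \<and>
     (\<forall>p. \<forall>c\<in>A. p \<in> fst c \<longrightarrow>
        ((\<lambda>u. snd c (r (p, inv_into (tangent_space A p) (\<lambda>v. v c) u)))
           has_derivative (\<lambda>u. u)) (at 0))"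

definition retraction_curve ::
    "('m \<times> ('m, 'e::real_normed_vector) tvec \<Rightarrow> 'm) \<Rightarrow> 'm \<times> ('m, 'e) tvec \<Rightarrow> real \<Rightarrow> 'm" where
  "retraction_curve r x t = r (fst x, tscale t (snd x))"

definition induces_flow ::
    "('m, 'e::real_normed_vector) chart set \<Rightarrow> ('m \<times> ('m, 'e) tvec \<Rightarrow> 'm) \<Rightarrow> bool" where
  "induces_flow A r \<longleftrightarrow>
     (\<forall>x\<in>tangent_bundle A. \<forall>t>0. \<forall>s>0.
        lifted_velocity A (retraction_curve r x) (t + s) =
        lifted_velocity A (retraction_curve r (lifted_velocity A (retraction_curve r x) t)) s)"

end

theory Submission
  imports Defs
begin

text \<open>
  Both conditions say the same thing about the curves \<open>\<gamma>(t) = r\<^sub>p(t v)\<close>: they are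
  geodesics, defined for all times, of one affine connection. The theorem splits at this point.
  
  If all retraction curves are geodesics of \<open>\<nabla>\<close>, uniqueness of geodesics gives
  everything else (\<open>geodesics_imp_exp\<close>, \<open>geodesics_imp_flow\<close>). The curve of
  \<open>(p, v)\<close> is the geodesic with that initial velocity, so its value at time 1 is both
  \<open>r (p, v)\<close> and \<open>exp (p, v)\<close>. A time shift of a geodesic is again a geodesic,
  hence the retraction curve of its own initial velocity; this is the flow equation.
  
  Suppose that \<open>r\<close> is the exponential map of \<open>\<nabla>\<close>. If \<open>\<gamma>\<close> is
  a geodesic with initial velocity \<open>T v\<close>, then \<open>s \<mapsto> \<gamma>(\<tau> s)\<close> is one with
  initial velocity \<open>\<tau> T v\<close>, so \<open>r\<^sub>p(\<tau> T v) = \<gamma>(\<tau>)\<close>. Since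
  \<open>T\<close> is arbitrary, the retraction curve is a geodesic near every time
  (\<open>exp_imp_geodesics\<close>). Geodesics with all these initial
  velocities exist because the domain of the exponential map is all of \<open>TM\<close>, and
  uniqueness makes the exponential map well defined.
  
  Suppose that \<open>r\<close> induces a flow. The connection is obtained by pulling vector fields back
  along \<open>r\<^sub>p\<close> to the vector space \<open>T\<^sub>pM\<close> and differentiating there at 0. In a chart
  its Christoffel symbol is minus the second derivative of \<open>r\<^sub>p\<close> at 0, so that every
  retraction curve satisfies the geodesic equation at time 0. By the flow equation, the curve after a
  time \<open>t > 0\<close> is the retraction curve of its velocity at \<open>t\<close>, so the equation
  holds at \<open>t\<close>; negative times follow from \<open>r\<^sub>p(t v) = r\<^sub>p((-t)(-v))\<close>
  (\<open>flow_geodesic\<close>).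
  
  Uniqueness of geodesics (\<open>geodesic_unique\<close>) is uniqueness for an ordinary differential
  equation with a locally Lipschitz right-hand side. For a connection given only by its algebraic
  axioms this requires Christoffel symbols that are well defined, bilinear and smooth, and these
  facts rest on cut-off functions.
\<close>

section \<open>Finite frames of the model space\<close>

text \<open>
  Riesz's argument in an inner product space. Orthonormal vectors have mutual distance
  \<open>sqrt 2\<close>, so no two of them lie in the same ball of radius 1/2, and finitely many such
  balls cover the compact unit ball. Hence there is an orthonormal set of maximal size, and the
  residual of an expansion along it vanishes, as it could otherwise be normalised and adjoined.
\<close>

lemma finite_orthonormal_frame:
  "\<exists>B :: 'a::{real_inner,heine_borel} set. finite B \<and> (\<forall>x. (\<Sum>b\<in>B. (x \<bullet> b) *\<^sub>R b) = x)"
proof -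
  define on where "on B \<longleftrightarrow> (\<forall>b\<in>B. norm b = 1) \<and> (\<forall>b\<in>B. \<forall>c\<in>B. b \<noteq> c \<longrightarrow> b \<bullet> c = 0)" for B :: "'a set"
  obtain K where K: "finite K" "cball (0::'a) 1 \<subseteq> (\<Union>x\<in>K. ball x (1/2))"
  proof -
    have "compact (cball (0::'a) 1)" by (rule compact_cball)
    then show ?thesis using that unfolding compact_eq_totally_bounded by (metis half_gt_zero zero_less_one)
  qed
  have bound: "finite B \<and> card B \<le> card K" if B: "on B" for B
  proof -
    have "\<forall>b\<in>B. \<exists>k\<in>K. b \<in> ball k (1/2)"
    proof
      fix b assume "b \<in> B"
      then have "b \<in> cball 0 1" using B by (simp add: on_def)
      then show "\<exists>k\<in>K. b \<in> ball k (1/2)" using K(2) by blast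
    qed
    then obtain g where g: "\<And>b. b \<in> B \<Longrightarrow> g b \<in> K \<and> b \<in> ball (g b) (1/2)"
      by metis
    have "inj_on g B"
    proof (rule inj_onI, rule ccontr)
      fix b c assume bc: "b \<in> B" "c \<in> B" "g b = g c" "b \<noteq> c"
      have "dist b c < 1" using g[OF bc(1)] g[OF bc(2)] bc(3)
        by (metis dist_commute dist_triangle_half_r mem_ball)
      then have *: "norm (b - c) ^ 2 < 1"
        by (simp add: dist_norm power_less_one_iff)
      have "norm (b - c) ^ 2 = norm b ^ 2 + norm c ^ 2 - 2 * (b \<bullet> c)"
        by (simp add: power2_norm_eq_inner algebra_simps inner_commute)
      also have "\<dots> = 2" using B bc by (auto simp: on_def)
      finally show False using * by simp
    qed
    then show ?thesis using g K(1)
      by (metis (no_types, lifting) card_inj_on_le finite_imageD finite_subset image_subsetI)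
  qed
  have "\<exists>B. on B \<and> (\<forall>B'. on B' \<longrightarrow> card B' \<le> card B)"
    by (rule ex_has_greatest_nat[of on "{}" card "Suc (card K)"]) (use bound in \<open>auto simp: on_def less_Suc_eq_le\<close>)
  then obtain B where B: "on B" and max: "\<And>B'. on B' \<Longrightarrow> card B' \<le> card B" by auto
  have fin: "finite B" using bound B by auto
  have "(\<Sum>b\<in>B. (x \<bullet> b) *\<^sub>R b) = x" for x
  proof (rule ccontr)
    assume ne: "\<not> ?thesis"
    define y where "y = x - (\<Sum>b\<in>B. (x \<bullet> b) *\<^sub>R b)"
    have y0: "y \<noteq> 0" using ne by (auto simp: y_def)
    have orth: "y \<bullet> c = 0" if "c \<in> B" for c
    proof -
      have "(\<Sum>b\<in>B. (x \<bullet> b) * (b \<bullet> c)) = (\<Sum>b\<in>B. if b = c then x \<bullet> c else 0)"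
      proof (rule sum.cong[OF refl])
        fix b assume "b \<in> B"
        then show "(x \<bullet> b) * (b \<bullet> c) = (if b = c then x \<bullet> c else 0)"
          using B that by (auto simp: on_def norm_eq_1)
      qed
      then show ?thesis using fin that
        by (simp add: y_def inner_diff_left inner_sum_left)
    qed
    define z where "z = (1 / norm y) *\<^sub>R y"
    have nz: "norm z = 1" using y0 by (simp add: z_def)
    have zc: "z \<bullet> c = 0" "c \<bullet> z = 0" if "c \<in> B" for c
      using orth[OF that] by (auto simp: z_def inner_commute)
    have "z \<notin> B" using zc nz by (auto simp: norm_eq_1)
    moreover have "on (insert z B)" using B nz zc by (auto simp: on_def)
    ultimately show False using max[of "insert z B"] fin by simp
  qed
  then show ?thesis using fin by blast
qed

text \<open>
  An orthonormal basis chosen once and for all. It takes the place of \<open>Basis\<close>, whose type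
  class excludes dimension 0.
\<close>

definition frame :: "'a::{real_inner,heine_borel} set" where
  "frame = (SOME B. finite B \<and> (\<forall>x. (\<Sum>b\<in>B. (x \<bullet> b) *\<^sub>R b) = x))"

lemma frame_expand: "(\<Sum>b\<in>frame. (x \<bullet> b) *\<^sub>R b) = (x :: 'a::{real_inner,heine_borel})"
  using someI_ex[OF finite_orthonormal_frame[where ?'a='a]] unfolding frame_def by auto

lemma linear_frame_expand:
  fixes L :: "'a::{real_inner,heine_borel} \<Rightarrow> 'b::real_vector"
  assumes "linear L"
  shows "L x = (\<Sum>b\<in>frame. (x \<bullet> b) *\<^sub>R L b)"
proof -
  have "L x = L (\<Sum>b\<in>frame. (x \<bullet> b) *\<^sub>R b)" by (simp add: frame_expand)
  also have "\<dots> = (\<Sum>b\<in>frame. (x \<bullet> b) *\<^sub>R L b)"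
    by (simp add: linear_sum[OF assms] linear_cmul[OF assms])
  finally show ?thesis .
qed

section \<open>Calculus of smooth functions\<close>

abbreviation fderiv :: "('a::real_normed_vector \<Rightarrow> 'b::real_normed_vector) \<Rightarrow> 'a \<Rightarrow> 'a \<Rightarrow> 'b" where
  "fderiv f x \<equiv> frechet_derivative f (at x)"

lemma fderiv_eq: "(f has_derivative L) (at x) \<Longrightarrow> fderiv f x v = L v"
  by (metis frechet_derivative_at)

lemma fderiv_cong:
  assumes "open S" "x \<in> S" "\<And>y. y \<in> S \<Longrightarrow> f y = g y"
  shows "fderiv f x = fderiv g x"
proof -
  have "(f has_derivative L) (at x) \<longleftrightarrow> (g has_derivative L) (at x)" for L
    using has_derivative_transform_within_open[OF _ assms(1,2), of f L UNIV g]
      has_derivative_transform_within_open[OF _ assms(1,2), of g L UNIV f] assms(3) by auto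
  then show ?thesis unfolding frechet_derivative_def by simp
qed

lemma hd_cong:
  assumes S: "open S" and eq: "\<And>x. x \<in> S \<Longrightarrow> f x = g x" and f: "higher_differentiable_on k f S"
  shows "higher_differentiable_on k g S"
  using eq f
proof (induction k arbitrary: f g)
  case 0
  then show ?case by (simp cong: continuous_on_cong)
next
  case (Suc k)
  have "g differentiable at x" if "x \<in> S" for x
  proof -
    have "f differentiable at x" using Suc.prems that by simp
    then obtain L where "(f has_derivative L) (at x)" by (auto simp: differentiable_def)
    then have "(g has_derivative L) (at x)"
      by (rule has_derivative_transform_within_open[OF _ S that]) (use Suc.prems in auto)
    then show ?thesis by (auto simp: differentiable_def)
  qed
  moreover have "higher_differentiable_on k (\<lambda>x. fderiv g x v) S" for v
    by (rule Suc.IH[of "\<lambda>x. fderiv f x v"])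
       (use Suc.prems fderiv_cong[OF S, of _ f g] in auto)
  ultimately show ?case by simp
qed

lemma hd_subset: "higher_differentiable_on k f S \<Longrightarrow> T \<subseteq> S \<Longrightarrow> higher_differentiable_on k f T"
  by (induction k arbitrary: f) (auto intro: continuous_on_subset)

lemma hd_Suc_imp: "higher_differentiable_on (Suc k) f S \<Longrightarrow> higher_differentiable_on k f S"
proof (induction k arbitrary: f)
  case 0
  then have "\<forall>x\<in>S. isCont f x" by (simp add: differentiable_imp_continuous_within)
  then show ?case by (simp add: continuous_at_imp_continuous_on)
next
  case (Suc k)
  then show ?case by (subst higher_differentiable_on.simps) auto
qed


text \<open>
  The recursive clause of \<open>higher_differentiable_on\<close> refers to
  \<open>frechet_derivative\<close>; this rule accepts any explicit formula for the derivative, so that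
  the closure properties below become inductions along the usual differentiation rules.
\<close>

lemma hd_SucI:
  assumes S: "open S" and d: "\<And>x. x \<in> S \<Longrightarrow> (f has_derivative f' x) (at x)"
    and h: "\<And>v. higher_differentiable_on k (\<lambda>x. f' x v) S"
  shows "higher_differentiable_on (Suc k) f S"
proof -
  have "higher_differentiable_on k (\<lambda>x. fderiv f x v) S" for v
    by (rule hd_cong[OF S _ h]) (simp add: fderiv_eq[OF d])
  then show ?thesis using d by (auto simp: differentiable_def)
qed

lemma hd_SucD:
  assumes "higher_differentiable_on (Suc k) f S"
  shows "x \<in> S \<Longrightarrow> (f has_derivative fderiv f x) (at x)"
    and "higher_differentiable_on k (\<lambda>x. fderiv f x v) S"
  using assms by (auto simp: frechet_derivative_works)

lemma hd_const: "open S \<Longrightarrow> higher_differentiable_on k (\<lambda>x. c) S"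
proof (induction k arbitrary: c)
  case (Suc k)
  show ?case by (rule hd_SucI[where f' = "\<lambda>x v. 0"]) (use Suc in auto)
qed simp

lemma hd_linear_comp:
  assumes S: "open S" and L: "bounded_linear L" and f: "higher_differentiable_on k f S"
  shows "higher_differentiable_on k (\<lambda>x. L (f x)) S"
  using f
proof (induction k arbitrary: f)
  case 0
  then show ?case using L by (auto intro: bounded_linear.continuous_on)
next
  case (Suc k)
  show ?case
    by (rule hd_SucI[OF S bounded_linear.has_derivative[OF L hd_SucD(1)[OF Suc.prems]]])
       (auto intro: Suc.IH hd_SucD(2)[OF Suc.prems])
qed

lemma hd_add:
  assumes S: "open S" and "higher_differentiable_on k f S" "higher_differentiable_on k g S"
  shows "higher_differentiable_on k (\<lambda>x. f x + g x) S"
  using assms(2-)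
proof (induction k arbitrary: f g)
  case 0
  then show ?case by (auto intro: continuous_on_add)
next
  case (Suc k)
  show ?case
    by (rule hd_SucI[OF S has_derivative_add[OF hd_SucD(1)[OF Suc.prems(1)] hd_SucD(1)[OF Suc.prems(2)]]])
       (auto intro: Suc.IH hd_SucD(2)[OF Suc.prems(1)] hd_SucD(2)[OF Suc.prems(2)])
qed

lemma hd_sum:
  assumes "open S" "\<And>i. i \<in> I \<Longrightarrow> higher_differentiable_on k (f i) S"
  shows "higher_differentiable_on k (\<lambda>x. \<Sum>i\<in>I. f i x) S"
  using assms(2)
  by (induction I rule: infinite_finite_induct) (auto intro: hd_const hd_add assms(1))

lemma hd_bilinear:
  assumes S: "open S" and P: "bounded_bilinear P"
    and "higher_differentiable_on k f S" "higher_differentiable_on k g S"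
  shows "higher_differentiable_on k (\<lambda>x. P (f x) (g x)) S"
  using assms(3-)
proof (induction k arbitrary: f g)
  case 0
  then show ?case using P by (auto intro: bounded_bilinear.continuous_on)
next
  case (Suc k)
  show ?case
  proof (rule hd_SucI[OF S, where f' = "\<lambda>x v. P (f x) (fderiv g x v) + P (fderiv f x v) (g x)"])
    show "((\<lambda>x. P (f x) (g x)) has_derivative
        (\<lambda>v. P (f x) (fderiv g x v) + P (fderiv f x v) (g x))) (at x)" if "x \<in> S" for x
      by (rule bounded_bilinear.FDERIV[OF P hd_SucD(1)[OF Suc.prems(1) that] hd_SucD(1)[OF Suc.prems(2) that]])
    show "higher_differentiable_on k (\<lambda>x. P (f x) (fderiv g x v) + P (fderiv f x v) (g x)) S" for v
      using Suc.IH[OF hd_Suc_imp[OF Suc.prems(1)] hd_SucD(2)[OF Suc.prems(2)]]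
        Suc.IH[OF hd_SucD(2)[OF Suc.prems(1)] hd_Suc_imp[OF Suc.prems(2)]] by (rule hd_add[OF S])
  qed
qed

text \<open>
  The chain rule evaluates the derivative of \<open>f\<close> in a direction that varies with the point,
  while the induction hypothesis concerns derivatives in fixed directions. The frame writes the former
  as a finite combination of the latter.
\<close>

lemma hd_compose:
  fixes g :: "'a::real_normed_vector \<Rightarrow> 'b::{real_inner,heine_borel}"
  assumes S: "open S" and T: "open T" and sub: "g ` S \<subseteq> T"
    and "higher_differentiable_on k f T" "higher_differentiable_on k g S"
  shows "higher_differentiable_on k (\<lambda>x. f (g x)) S"
  using assms(4-)
proof (induction k arbitrary: f)
  case 0
  then show ?case using sub by (auto intro: continuous_on_compose2)
next
  case (Suc k)
  have df: "(f has_derivative fderiv f y) (at y)" if "y \<in> T" for y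
    using hd_SucD(1)[OF Suc.prems(1) that] .
  show ?case
  proof (rule hd_SucI[OF S, where f' = "\<lambda>x v. \<Sum>b\<in>frame. (fderiv g x v \<bullet> b) *\<^sub>R fderiv f (g x) b"])
    fix x assume x: "x \<in> S"
    have "((\<lambda>x. f (g x)) has_derivative (\<lambda>v. fderiv f (g x) (fderiv g x v))) (at x)"
      by (rule has_derivative_compose[OF hd_SucD(1)[OF Suc.prems(2) x]]) (use df x sub in auto)
    moreover have "(\<lambda>v. fderiv f (g x) (fderiv g x v)) =
        (\<lambda>v. \<Sum>b\<in>frame. (fderiv g x v \<bullet> b) *\<^sub>R fderiv f (g x) b)"
      by (rule ext, rule linear_frame_expand[OF has_derivative_linear[OF df]]) (use x sub in auto)
    ultimately show "((\<lambda>x. f (g x)) has_derivative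
        (\<lambda>v. \<Sum>b\<in>frame. (fderiv g x v \<bullet> b) *\<^sub>R fderiv f (g x) b)) (at x)"
      by (rule back_subst)
  next
    fix v
    have "higher_differentiable_on k (\<lambda>x. fderiv f (g x) b) S" for b
      using Suc.IH[OF hd_SucD(2)[OF Suc.prems(1)]] hd_Suc_imp[OF Suc.prems(2)] .
    moreover have "higher_differentiable_on k (\<lambda>x. fderiv g x v \<bullet> b) S" for b
      by (rule hd_linear_comp[OF S bounded_linear_inner_left hd_SucD(2)[OF Suc.prems(2)]])
    ultimately show "higher_differentiable_on k
        (\<lambda>x. \<Sum>b\<in>frame. (fderiv g x v \<bullet> b) *\<^sub>R fderiv f (g x) b) S"
      by (intro hd_sum S hd_bilinear[OF S bounded_bilinear_scaleR])
  qed
qed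

lemma hd_local:
  assumes "\<And>x. x \<in> S \<Longrightarrow> \<exists>U. open U \<and> x \<in> U \<and> higher_differentiable_on k f U"
  shows "higher_differentiable_on k f S"
  using assms
proof (induction k arbitrary: f)
  case 0
  have "isCont f x" if "x \<in> S" for x
    using 0[OF that] continuous_on_eq_continuous_at by auto
  then show ?case by (simp add: continuous_at_imp_continuous_on)
next
  case (Suc k)
  have "higher_differentiable_on k (\<lambda>x. fderiv f x v) S" for v
    by (rule Suc.IH) (blast dest: Suc.prems intro: hd_SucD(2))
  moreover have "f differentiable at x" if "x \<in> S" for x
    using Suc.prems[OF that] by auto
  ultimately show ?case by simp
qed

lemma smooth_on_cong:
  "open S \<Longrightarrow> smooth_on f S \<Longrightarrow> (\<And>x. x \<in> S \<Longrightarrow> f x = g x) \<Longrightarrow> smooth_on g S"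
  unfolding smooth_on_def using hd_cong by blast

lemma smooth_on_subset: "smooth_on f S \<Longrightarrow> T \<subseteq> S \<Longrightarrow> smooth_on f T"
  unfolding smooth_on_def using hd_subset by blast

lemma smooth_on_local:
  "(\<And>x. x \<in> S \<Longrightarrow> \<exists>U. open U \<and> x \<in> U \<and> smooth_on f U) \<Longrightarrow> smooth_on f S"
  unfolding smooth_on_def by (intro allI hd_local) blast

lemma smooth_on_const: "open S \<Longrightarrow> smooth_on (\<lambda>x. c) S"
  unfolding smooth_on_def using hd_const by blast

lemma smooth_on_linear_comp:
  "open S \<Longrightarrow> bounded_linear L \<Longrightarrow> smooth_on f S \<Longrightarrow> smooth_on (\<lambda>x. L (f x)) S"
  unfolding smooth_on_def using hd_linear_comp by blast

lemma smooth_on_id: assumes "open S" shows "smooth_on (\<lambda>x. x) S"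
proof -
  have "higher_differentiable_on k (\<lambda>x. x) S" for k
  proof (cases k)
    case (Suc j)
    show ?thesis unfolding Suc
      by (rule hd_SucI[where f' = "\<lambda>x v. v"]) (use assms in \<open>auto intro: hd_const\<close>)
  qed simp
  then show ?thesis by (simp add: smooth_on_def)
qed

lemma smooth_on_linear: "open S \<Longrightarrow> bounded_linear L \<Longrightarrow> smooth_on L S"
  using smooth_on_linear_comp smooth_on_id by blast

lemma smooth_on_add:
  "open S \<Longrightarrow> smooth_on f S \<Longrightarrow> smooth_on g S \<Longrightarrow> smooth_on (\<lambda>x. f x + g x) S"
  unfolding smooth_on_def using hd_add by blast

lemma smooth_on_minus: "open S \<Longrightarrow> smooth_on f S \<Longrightarrow> smooth_on (\<lambda>x. - f x) S"
  by (rule smooth_on_linear_comp[OF _ bounded_linear_minus[OF bounded_linear_ident]])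

lemma smooth_on_diff:
  "open S \<Longrightarrow> smooth_on f S \<Longrightarrow> smooth_on g S \<Longrightarrow> smooth_on (\<lambda>x. f x - g x) S"
  using smooth_on_add[of S f "\<lambda>x. - g x"] smooth_on_minus by auto

lemma smooth_on_sum:
  "open S \<Longrightarrow> (\<And>i. i \<in> I \<Longrightarrow> smooth_on (f i) S) \<Longrightarrow> smooth_on (\<lambda>x. \<Sum>i\<in>I. f i x) S"
  unfolding smooth_on_def by (auto intro!: hd_sum)

lemma smooth_on_bilinear:
  "open S \<Longrightarrow> bounded_bilinear P \<Longrightarrow> smooth_on f S \<Longrightarrow> smooth_on g S \<Longrightarrow>
    smooth_on (\<lambda>x. P (f x) (g x)) S"
  unfolding smooth_on_def using hd_bilinear[of S P _ f g] by simp

lemmas smooth_on_scaleR = smooth_on_bilinear[OF _ bounded_bilinear_scaleR]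

lemma smooth_on_Pair:
  assumes "open S" "smooth_on f S" "smooth_on g S"
  shows "smooth_on (\<lambda>x. (f x, g x)) S"
proof -
  have "bounded_linear (\<lambda>y. (y, 0))" "bounded_linear (\<lambda>y. (0, y))"
    by (intro bounded_linear_Pair bounded_linear_ident bounded_linear_zero)+
  from this[THEN smooth_on_linear_comp[OF assms(1)]]
  have "smooth_on (\<lambda>x. (f x, 0) + (0, g x)) S"
    using assms by (intro smooth_on_add) auto
  then show ?thesis by simp
qed

lemma smooth_on_compose:
  fixes g :: "'a::real_normed_vector \<Rightarrow> 'b::{real_inner,heine_borel}"
  assumes "open S" "open T" "smooth_on f T" "smooth_on g S" "\<And>x. x \<in> S \<Longrightarrow> g x \<in> T"
  shows "smooth_on (\<lambda>x. f (g x)) S"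
proof -
  have "g ` S \<subseteq> T" using assms(5) by auto
  from hd_compose[OF assms(1,2) this, of _ f] show ?thesis
    using assms(3,4) unfolding smooth_on_def by blast
qed

lemma smooth_on_has_derivative:
  "smooth_on f S \<Longrightarrow> x \<in> S \<Longrightarrow> (f has_derivative fderiv f x) (at x)"
  unfolding smooth_on_def by (rule hd_SucD(1)) auto

lemma smooth_on_linear_fderiv: "smooth_on f S \<Longrightarrow> x \<in> S \<Longrightarrow> linear (fderiv f x)"
  using smooth_on_has_derivative has_derivative_linear by blast

lemma smooth_on_fderiv: "smooth_on f S \<Longrightarrow> smooth_on (\<lambda>x. fderiv f x v) S"
  unfolding smooth_on_def by (auto intro: hd_SucD(2))

lemma smooth_on_isCont: "smooth_on f S \<Longrightarrow> x \<in> S \<Longrightarrow> isCont f x"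
  using smooth_on_has_derivative has_derivative_continuous by blast

lemma smooth_on_continuous_on: "smooth_on f S \<Longrightarrow> continuous_on S f"
  by (simp add: continuous_at_imp_continuous_on smooth_on_isCont)

text \<open>
  Smoothness provides derivatives in constant directions only. A moving direction is expanded along
  the frame.
\<close>

lemma smooth_on_fderiv_at:
  fixes g :: "'a::real_normed_vector \<Rightarrow> 'b::{real_inner,heine_borel}"
  assumes "open S" "open T" "smooth_on f T" "smooth_on g S" "smooth_on h S"
    and sub: "\<And>x. x \<in> S \<Longrightarrow> g x \<in> T"
  shows "smooth_on (\<lambda>x. fderiv f (g x) (h x)) S"
proof -
  have "smooth_on (\<lambda>x. \<Sum>b\<in>frame. (h x \<bullet> b) *\<^sub>R fderiv f (g x) b) S"
  proof (intro smooth_on_sum smooth_on_scaleR assms)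
    fix b
    show "smooth_on (\<lambda>x. h x \<bullet> b) S"
      by (rule smooth_on_linear_comp[OF assms(1) bounded_linear_inner_left assms(5)])
    show "smooth_on (\<lambda>x. fderiv f (g x) b) S"
      by (rule smooth_on_compose[OF assms(1,2) smooth_on_fderiv[OF assms(3)] assms(4) sub])
  qed
  then show ?thesis
    by (rule smooth_on_cong[OF assms(1)])
       (simp add: linear_frame_expand[OF smooth_on_linear_fderiv[OF assms(3) sub], symmetric])
qed

text \<open>
  The operator norm of the derivative is bounded by the norms of the derivatives along the frame, which
  are continuous; the mean value inequality on a ball does the rest.
\<close>

lemma smooth_on_locally_lipschitz:
  fixes f :: "'a::{real_inner,heine_borel} \<Rightarrow> 'b::real_normed_vector"
  assumes S: "open S" and f: "smooth_on f S" and x: "x \<in> S"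
  obtains e L where "e > 0" "ball x e \<subseteq> S"
    "\<And>y z. y \<in> ball x e \<Longrightarrow> z \<in> ball x e \<Longrightarrow> norm (f y - f z) \<le> L * norm (y - z)"
proof -
  define M where "M y = (\<Sum>b\<in>frame. norm b * norm (fderiv f y b))" for y
  have on: "norm (fderiv f y v) \<le> M y * norm v" if "y \<in> S" for y v
  proof -
    have "fderiv f y v = (\<Sum>b\<in>frame. (v \<bullet> b) *\<^sub>R fderiv f y b)"
      by (rule linear_frame_expand[OF smooth_on_linear_fderiv[OF f that]])
    also have "norm \<dots> \<le> (\<Sum>b\<in>frame. norm ((v \<bullet> b) *\<^sub>R fderiv f y b))" by (rule norm_sum)
    also have "\<dots> \<le> (\<Sum>b\<in>frame. (norm v * norm b) * norm (fderiv f y b))"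
      by (intro sum_mono) (auto intro!: mult_right_mono Cauchy_Schwarz_ineq2)
    also have "\<dots> = M y * norm v" by (simp add: M_def sum_distrib_left sum_distrib_right ac_simps)
    finally show ?thesis .
  qed
  have "isCont M x" unfolding M_def
    using smooth_on_isCont[OF smooth_on_fderiv[OF f] x] by (intro continuous_intros) auto
  then have "\<forall>\<^sub>F y in at x. M y < M x + 1"
    unfolding isCont_def by (rule order_tendstoD) simp
  then obtain d where d: "d > 0" "\<And>y. y \<noteq> x \<Longrightarrow> dist y x < d \<Longrightarrow> M y < M x + 1"
    by (auto simp: eventually_at)
  obtain e where e: "e > 0" "ball x e \<subseteq> S" using S x open_contains_ball by blast
  define m where "m = min d e"
  have m: "m > 0" "ball x m \<subseteq> S" using d e by (auto simp: m_def)
  have bd: "onorm (fderiv f y) \<le> M x + 1" if "y \<in> ball x m" for y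
  proof (rule onorm_bound)
    show "0 \<le> M x + 1" by (auto simp: M_def intro!: add_nonneg_nonneg sum_nonneg)
    fix v
    have "M y \<le> M x + 1" using d(2)[of y] that by (cases "y = x") (auto simp: m_def dist_commute)
    then show "norm (fderiv f y v) \<le> (M x + 1) * norm v"
      using on[of y v] that m(2) by (meson mult_right_mono norm_ge_zero order_trans subsetD)
  qed
  show ?thesis
  proof (rule that[OF m])
    fix y z assume yz: "y \<in> ball x m" "z \<in> ball x m"
    show "norm (f y - f z) \<le> (M x + 1) * norm (y - z)"
      by (rule differentiable_bound[OF convex_ball _ bd yz])
         (rule has_derivative_at_withinI[OF smooth_on_has_derivative[OF f subsetD[OF m(2)]]])
  qed
qed

lemma vector_derivative_fderiv:
  fixes f :: "real \<Rightarrow> 'a::real_normed_vector"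
  assumes "f differentiable at t"
  shows "vector_derivative f (at t) = fderiv f t 1"
  using frechet_derivative_eq_vector_derivative[OF assms] by simp

section \<open>Second derivatives\<close>

text \<open>
  The second derivative, where the direction \<open>w\<close> is differentiated first.
\<close>

definition hess :: "('a::real_normed_vector \<Rightarrow> 'b::real_normed_vector) \<Rightarrow> 'a \<Rightarrow> 'a \<Rightarrow> 'a \<Rightarrow> 'b" where
  "hess f x u w = fderiv (\<lambda>y. fderiv f y w) x u"

lemma hess_cong:
  assumes "open S" "x \<in> S" "\<And>y. y \<in> S \<Longrightarrow> f y = g y"
  shows "hess f x u w = hess g x u w"
proof -
  have "fderiv f y w = fderiv g y w" if "y \<in> S" for y
    using fderiv_cong[OF assms(1) that assms(3)] by simp
  from fderiv_cong[OF assms(1,2) this] show ?thesis by (simp add: hess_def)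
qed

lemma hess_linear_left: "smooth_on f S \<Longrightarrow> x \<in> S \<Longrightarrow> linear (\<lambda>u. hess f x u w)"
  unfolding hess_def by (rule smooth_on_linear_fderiv[OF smooth_on_fderiv])

lemma hess_linear_right:
  assumes S: "open S" and f: "smooth_on f S" and x: "x \<in> S"
  shows "linear (hess f x u)"
proof (rule linearI)
  note lin = smooth_on_linear_fderiv[OF f]
  note D = smooth_on_has_derivative[OF smooth_on_fderiv[OF f] x]
  show "hess f x u (v + w) = hess f x u v + hess f x u w" for v w
  proof -
    have "hess f x u (v + w) = fderiv (\<lambda>y. fderiv f y v + fderiv f y w) x u"
      unfolding hess_def by (subst fderiv_cong[OF S x]) (auto simp: linear_add[OF lin])
    also have "\<dots> = hess f x u v + hess f x u w"
      unfolding hess_def by (rule fderiv_eq[OF has_derivative_add[OF D D]])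
    finally show ?thesis .
  qed
  show "hess f x u (a *\<^sub>R w) = a *\<^sub>R hess f x u w" for a w
  proof -
    have "hess f x u (a *\<^sub>R w) = fderiv (\<lambda>y. a *\<^sub>R fderiv f y w) x u"
      unfolding hess_def by (subst fderiv_cong[OF S x]) (auto simp: linear_cmul[OF lin])
    also have "\<dots> = a *\<^sub>R hess f x u w"
      unfolding hess_def by (rule fderiv_eq[OF has_derivative_scaleR_right[OF D]])
    finally show ?thesis .
  qed
qed

text \<open>
  A Leibniz rule for the pairing of a derivative with a vector when both the base point and the vector
  move. It contains the second order chain rule and the transformation of the derivatives of vector
  field components under a change of chart.
\<close>

lemma has_derivative_fderiv_at:
  fixes g :: "'a::real_normed_vector \<Rightarrow> 'b::{real_inner,heine_borel}"
  assumes S: "open S" and x: "x \<in> S" and T: "open T" and f: "smooth_on f T"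
    and sub: "\<And>y. y \<in> S \<Longrightarrow> g y \<in> T"
    and g: "(g has_derivative g') (at x)" and h: "(h has_derivative h') (at x)"
  shows "((\<lambda>y. fderiv f (g y) (h y)) has_derivative
           (\<lambda>u. hess f (g x) (g' u) (h x) + fderiv f (g x) (h' u))) (at x)"
proof -
  have gx: "g x \<in> T" using sub x .
  have "((\<lambda>y. fderiv f (g y) b) has_derivative (\<lambda>u. hess f (g x) (g' u) b)) (at x)" for b
    unfolding hess_def
    by (rule has_derivative_compose[OF g smooth_on_has_derivative[OF smooth_on_fderiv[OF f] gx]])
  moreover have "((\<lambda>y. h y \<bullet> b) has_derivative (\<lambda>u. h' u \<bullet> b)) (at x)" for b
    by (rule has_derivative_inner_left[OF h])
  ultimately have "((\<lambda>y. \<Sum>b\<in>frame. (h y \<bullet> b) *\<^sub>R fderiv f (g y) b) has_derivative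
      (\<lambda>u. \<Sum>b\<in>frame. (h x \<bullet> b) *\<^sub>R hess f (g x) (g' u) b + (h' u \<bullet> b) *\<^sub>R fderiv f (g x) b)) (at x)"
    by (intro has_derivative_sum has_derivative_scaleR)
  then have "((\<lambda>y. \<Sum>b\<in>frame. (h y \<bullet> b) *\<^sub>R fderiv f (g y) b) has_derivative
      (\<lambda>u. hess f (g x) (g' u) (h x) + fderiv f (g x) (h' u))) (at x)"
    by (simp add: sum.distrib linear_frame_expand[OF hess_linear_right[OF T f gx], symmetric]
        linear_frame_expand[OF smooth_on_linear_fderiv[OF f gx], symmetric])
  then show ?thesis
    by (rule has_derivative_transform_within_open[OF _ S x])
       (simp add: linear_frame_expand[OF smooth_on_linear_fderiv[OF f sub], symmetric])
qed

lemma hess_compose: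
  fixes g :: "'a::real_normed_vector \<Rightarrow> 'b::{real_inner,heine_borel}"
  assumes S: "open S" and x: "x \<in> S" and T: "open T" and f: "smooth_on f T"
    and g: "smooth_on g S" and sub: "\<And>y. y \<in> S \<Longrightarrow> g y \<in> T"
  shows "hess (\<lambda>y. f (g y)) x u w =
           hess f (g x) (fderiv g x u) (fderiv g x w) + fderiv f (g x) (hess g x u w)"
proof -
  have "fderiv (\<lambda>y. f (g y)) y w = fderiv f (g y) (fderiv g y w)" if "y \<in> S" for y
    by (rule fderiv_eq[OF has_derivative_compose[OF smooth_on_has_derivative[OF g that]
          smooth_on_has_derivative[OF f sub[OF that]]]])
  then have "hess (\<lambda>y. f (g y)) x u w = fderiv (\<lambda>y. fderiv f (g y) (fderiv g y w)) x u"
    unfolding hess_def by (subst fderiv_cong[OF S x]) auto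
  also have "\<dots> = hess f (g x) (fderiv g x u) (fderiv g x w) + fderiv f (g x) (hess g x u w)"
    unfolding hess_def[of g]
    by (rule fderiv_eq[OF has_derivative_fderiv_at[OF S x T f sub smooth_on_has_derivative[OF g x]
          smooth_on_has_derivative[OF smooth_on_fderiv[OF g] x]]])
  finally show ?thesis .
qed

lemma hess_linear:
  assumes "bounded_linear L"
  shows "fderiv L x u = L u" "hess L x u w = 0"
proof -
  have *: "fderiv L y v = L v" for y v
    by (rule fderiv_eq[OF bounded_linear_imp_has_derivative[OF assms]])
  show "fderiv L x u = L u" by (rule *)
  show "hess L x u w = 0"
    by (simp add: hess_def * fderiv_eq[OF has_derivative_const])
qed

lemma smooth_on_hess:
  fixes g :: "'a::real_normed_vector \<Rightarrow> 'b::{real_inner,heine_borel}"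
  assumes S: "open S" and T: "open T" and f: "smooth_on f T"
    and g: "smooth_on g S" and h: "smooth_on h S" and k: "smooth_on k S"
    and sub: "\<And>x. x \<in> S \<Longrightarrow> g x \<in> T"
  shows "smooth_on (\<lambda>x. hess f (g x) (h x) (k x)) S"
proof -
  have "smooth_on (\<lambda>x. \<Sum>b\<in>frame. (k x \<bullet> b) *\<^sub>R hess f (g x) (h x) b) S"
  proof (intro smooth_on_sum smooth_on_scaleR S)
    fix b
    show "smooth_on (\<lambda>x. k x \<bullet> b) S"
      by (rule smooth_on_linear_comp[OF S bounded_linear_inner_left k])
    show "smooth_on (\<lambda>x. hess f (g x) (h x) b) S"
      unfolding hess_def by (rule smooth_on_fderiv_at[OF S T smooth_on_fderiv[OF f] g h sub])
  qed
  then show ?thesis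
    by (rule smooth_on_cong[OF S])
       (simp add: linear_frame_expand[OF hess_linear_right[OF T f sub], symmetric])
qed

text \<open>
  Second derivatives in the fibre direction are second derivatives of a function of base point and
  fibre point together. This is how the second derivative of \<open>r\<^sub>p\<close> is seen to depend
  smoothly on \<open>p\<close>.
\<close>

lemma hess_partial:
  fixes f :: "'a::{real_inner,heine_borel} \<times> 'b::{real_inner,heine_borel} \<Rightarrow> 'c::real_normed_vector"
  assumes T: "open T" and f: "smooth_on f T" and x: "(x, y) \<in> T"
  shows "hess (\<lambda>y. f (x, y)) y u w = hess f (x, y) (0, u) (0, w)"
proof -
  define S where "S = {y. (x, y) \<in> T}"
  have S: "open S"
  proof -
    have "open ((\<lambda>y. (x, y)) -` T)" by (rule open_vimage[OF T]) (intro continuous_intros)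
    then show ?thesis by (simp add: S_def vimage_def)
  qed
  have d: "fderiv (\<lambda>y. (x, y)) z v = (0, v)" for z v :: 'b
    by (rule fderiv_eq) (auto intro!: derivative_eq_intros)
  then have h: "hess (\<lambda>y. (x, y)) y u w = 0"
    by (simp add: hess_def fderiv_eq[OF has_derivative_const])
  have g: "smooth_on (\<lambda>y. (x, y)) S" by (intro smooth_on_Pair smooth_on_const smooth_on_id S)
  have "hess (\<lambda>y. f (x, y)) y u w =
      hess f (x, y) (fderiv (\<lambda>y. (x, y)) y u) (fderiv (\<lambda>y. (x, y)) y w) +
      fderiv f (x, y) (hess (\<lambda>y. (x, y)) y u w)"
    by (rule hess_compose[OF S _ T f g]) (use x in \<open>simp_all add: S_def\<close>)
  then show ?thesis
    by (simp only: d h linear_0[OF smooth_on_linear_fderiv[OF f x]] add_0_right)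
qed

section \<open>Bump functions\<close>

text \<open>
  For \<open>P = 1\<close> this is \<open>exp (- 1/t)\<close> extended by 0. The polynomial is carried along
  because the derivatives have the same form, so that smoothness is an induction for all \<open>P\<close>
  at once.
\<close>

definition flat :: "real poly \<Rightarrow> real \<Rightarrow> real" where
  "flat P t = (if t > 0 then poly P (inverse t) * exp (- inverse t) else 0)"

lemma poly_exp_tendsto_0: "((\<lambda>y. y ^ k * poly P y * exp (- y)) \<longlongrightarrow> (0::real)) at_top"
proof (induction P arbitrary: k)
  case (pCons a P)
  have "((\<lambda>y. a * (y ^ k / exp y) + y ^ Suc k * poly P y * exp (- y)) \<longlongrightarrow> a * 0 + 0) at_top"
    by (intro tendsto_add tendsto_mult tendsto_const tendsto_power_div_exp_0 pCons.IH)
  moreover have "a * (y ^ k / exp y) + y ^ Suc k * poly P y * exp (- y) =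
      y ^ k * poly (pCons a P) y * exp (- y)" for y
    by (simp add: exp_minus field_simps)
  ultimately show ?case by simp
qed simp

lemma flat_tendsto_0: "(flat P \<longlongrightarrow> 0) (at 0)"
proof (rule filterlim_split_at_real)
  have "((\<lambda>t. 0) \<longlongrightarrow> (0::real)) (at_left 0)" by simp
  then show "(flat P \<longlongrightarrow> 0) (at_left 0)"
    by (rule Lim_transform_eventually)
       (auto simp: flat_def eventually_at_filter)
  have "((\<lambda>t. poly P (inverse t) * exp (- inverse t)) \<longlongrightarrow> 0) (at_right 0)"
    using filterlim_compose[OF poly_exp_tendsto_0[of 0 P] filterlim_inverse_at_top_right] by simp
  then show "(flat P \<longlongrightarrow> 0) (at_right 0)"
    by (rule Lim_transform_eventually) (auto simp: flat_def eventually_at_filter)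
qed

lemma flat_has_derivative:
  "(flat P has_real_derivative flat ([:0, 0, 1:] * (P - pderiv P)) t) (at t)"
proof (cases t "0::real" rule: linorder_cases)
  case less
  have "((\<lambda>_. 0) has_real_derivative 0) (at t)" by simp
  then have "(flat P has_real_derivative 0) (at t)"
    by (rule has_field_derivative_transform_within_open[where S = "{..<0}"])
       (use less in \<open>auto simp: flat_def\<close>)
  then show ?thesis using less by (simp add: flat_def)
next
  case equal
  have "((\<lambda>h. flat (pCons 0 P) h) \<longlongrightarrow> 0) (at 0)" by (rule flat_tendsto_0)
  then have "((\<lambda>h. (flat P (0 + h) - flat P 0) / h) \<longlongrightarrow> 0) (at 0)"
    by (rule Lim_transform_eventually)
       (auto simp: flat_def eventually_at_filter field_simps)
  then show ?thesis using equal by (simp add: DERIV_def flat_def)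
next
  case greater
  have "((\<lambda>t. poly P (inverse t) * exp (- inverse t)) has_real_derivative
      flat ([:0, 0, 1:] * (P - pderiv P)) t) (at t)"
    using greater
    by (auto intro!: derivative_eq_intros DERIV_chain2[OF poly_DERIV]
        simp: flat_def field_simps power2_eq_square)
  then show ?thesis
    by (rule has_field_derivative_transform_within_open[where S = "{0<..}"])
       (use greater in \<open>auto simp: flat_def\<close>)
qed

lemma smooth_on_flat: "smooth_on (flat P) UNIV"
proof -
  have "higher_differentiable_on k (flat P) UNIV" for k
  proof (induction k arbitrary: P)
    case 0
    then show ?case
      using DERIV_isCont[OF flat_has_derivative] by (simp add: continuous_at_imp_continuous_on)
  next
    case (Suc k)
    show ?case
      by (rule hd_SucI[OF open_UNIV flat_has_derivative[unfolded has_field_derivative_def]])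
         (auto intro: hd_linear_comp[OF open_UNIV bounded_linear_mult_left] Suc)
  qed
  then show ?thesis by (simp add: smooth_on_def)
qed

text \<open>
  Let \<open>f\<close> be \<open>exp (- 1/t)\<close> extended by 0 and \<open>a = f 1\<close>. Then
  \<open>f (a - f t)\<close> equals the constant \<open>f a > 0\<close> for \<open>t \<le> 0\<close>, and it
  vanishes once \<open>f t \<ge> a\<close>, which by monotonicity is the case for \<open>t \<ge> 1\<close>.
\<close>

lemma smooth_cutoff:
  obtains \<beta> :: "real \<Rightarrow> real"
  where "smooth_on \<beta> UNIV" "\<And>t. t \<le> 0 \<Longrightarrow> \<beta> t = 1" "\<And>t. t \<ge> 1 \<Longrightarrow> \<beta> t = 0"
proof -
  define f where "f = flat 1"
  define a where "a = f 1"
  have f0: "f t = 0" if "t \<le> 0" for t using that by (simp add: f_def flat_def)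
  have a: "a > 0" "f a > 0" by (simp_all add: a_def f_def flat_def)
  have f1: "f t \<ge> a" if "t \<ge> 1" for t
    using that by (simp add: a_def f_def flat_def field_simps)
  have sm: "smooth_on f UNIV" by (simp add: f_def smooth_on_flat)
  have "smooth_on (\<lambda>t. f (a - f t)) UNIV"
    by (rule smooth_on_compose[OF open_UNIV open_UNIV sm
          smooth_on_diff[OF open_UNIV smooth_on_const[OF open_UNIV] sm]]) auto
  then have "smooth_on (\<lambda>t. inverse (f a) * f (a - f t)) UNIV"
    by (intro smooth_on_linear_comp[OF _ bounded_linear_mult_right]) auto
  then show ?thesis
    by (rule that) (use a f0 f1 in auto)
qed

lemma bump_function:
  fixes x\<^sub>0 :: "'a::{real_inner,heine_borel}"
  assumes "e > 0"
  obtains \<beta> :: "'a \<Rightarrow> real"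
  where "smooth_on \<beta> UNIV" "\<And>x. x \<in> ball x\<^sub>0 (e / 2) \<Longrightarrow> \<beta> x = 1" "\<And>x. x \<notin> ball x\<^sub>0 e \<Longrightarrow> \<beta> x = 0"
proof -
  obtain \<beta> :: "real \<Rightarrow> real" where \<beta>: "smooth_on \<beta> UNIV"
    "\<And>t. t \<le> 0 \<Longrightarrow> \<beta> t = 1" "\<And>t. t \<ge> 1 \<Longrightarrow> \<beta> t = 0" by (rule smooth_cutoff) blast
  \<comment> \<open>The scaling makes \<open>s \<le> 0\<close> on the ball of radius \<open>e / sqrt 2\<close> and \<open>s \<ge> 1\<close> outside that of radius \<open>e\<close>.\<close>
  define s where "s x = (2 / e\<^sup>2) * ((x - x\<^sub>0) \<bullet> (x - x\<^sub>0)) - 1" for x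
  have d: "smooth_on (\<lambda>x. x - x\<^sub>0) UNIV"
    by (intro smooth_on_diff smooth_on_id smooth_on_const) auto
  have "smooth_on s UNIV" unfolding s_def
    by (intro smooth_on_diff smooth_on_const smooth_on_linear_comp[OF _ bounded_linear_mult_right]
        smooth_on_bilinear[OF _ bounded_bilinear_inner d d]) auto
  then have sm: "smooth_on (\<lambda>x. \<beta> (s x)) UNIV"
    by (rule smooth_on_compose[OF open_UNIV open_UNIV \<beta>(1)]) auto
  have s: "s x = 2 * (dist x\<^sub>0 x / e)\<^sup>2 - 1" for x
    by (simp add: s_def power2_norm_eq_inner[symmetric] dist_norm norm_minus_commute power_divide)
  show ?thesis
  proof (rule that[OF sm])
    fix x assume "x \<in> ball x\<^sub>0 (e / 2)"
    then have "dist x\<^sub>0 x / e \<le> 1/2" using assms by (simp add: field_simps)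
    then have "(dist x\<^sub>0 x / e)\<^sup>2 \<le> (1/2)\<^sup>2" using assms by (intro power_mono) auto
    moreover have "(1/2::real)\<^sup>2 = 1/4" by (simp add: power2_eq_square)
    ultimately have "s x \<le> 0" unfolding s by linarith
    then show "\<beta> (s x) = 1" by (rule \<beta>(2))
  next
    fix x assume "x \<notin> ball x\<^sub>0 e"
    then have "1 \<le> dist x\<^sub>0 x / e" using assms by (simp add: field_simps)
    then have "1 \<le> (dist x\<^sub>0 x / e)\<^sup>2" by (simp add: one_le_power)
    then show "\<beta> (s x) = 0" by (intro \<beta>) (simp add: s)
  qed
qed

section \<open>Smooth maps in prescribed charts\<close>

text \<open>
  What an atlas requires apart from the topology of the space of points. In this form it also holds
  for \<open>tangent_atlas\<close> and \<open>open_atlas\<close>, whose points are only a subset of a type.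
\<close>

definition chart_system :: "('a, 'e::real_normed_vector) chart set \<Rightarrow> bool" where
  "chart_system A \<longleftrightarrow>
     (\<forall>c\<in>A. inj_on (snd c) (fst c) \<and> open (snd c ` fst c)) \<and>
     (\<forall>c\<in>A. \<forall>d\<in>A. open (snd c ` (fst c \<inter> fst d)) \<and>
        smooth_on (transition c d) (snd c ` (fst c \<inter> fst d)))"

lemma chart_inv_left: "inj_on (snd c) (fst c) \<Longrightarrow> p \<in> fst c \<Longrightarrow> chart_inv c (snd c p) = p"
  unfolding chart_inv_def by (rule inv_into_f_f)

lemma chart_inv_in: "x \<in> snd c ` fst c \<Longrightarrow> chart_inv c x \<in> fst c"
  unfolding chart_inv_def by (rule inv_into_into)

lemma chart_system_open_atlas: "open S \<Longrightarrow> chart_system (open_atlas S)"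
  unfolding chart_system_def open_atlas_def
  by (auto simp: transition_def chart_inv_def intro!: smooth_on_cong[OF _ smooth_on_id])

text \<open>
  \<open>smooth_map\<close> guarantees one suitable pair of charts at each point; composition with the
  transition maps on both sides transfers smoothness to any prescribed pair.
\<close>

lemma smooth_map_in_charts:
  fixes A :: "('a, 'e::{real_inner,heine_borel}) chart set"
    and B :: "('b, 'f::{real_inner,heine_borel}) chart set"
  assumes A: "chart_system A" and B: "chart_system B" and f: "smooth_map A B f"
    and c: "c \<in> A" "x \<in> fst c" and d: "d \<in> B" "f x \<in> fst d"
  obtains W where "open W" "snd c x \<in> W" "W \<subseteq> snd c ` fst c"
    "\<And>y. y \<in> W \<Longrightarrow> f (chart_inv c y) \<in> fst d"
    "smooth_on (\<lambda>y. snd d (f (chart_inv c y))) W"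
proof -
  have inj: "inj_on (snd c) (fst c)" "\<And>c'. c' \<in> A \<Longrightarrow> inj_on (snd c') (fst c')"
     "\<And>d'. d' \<in> B \<Longrightarrow> inj_on (snd d') (fst d')"
    using A B c by (auto simp: chart_system_def)
  have "x \<in> (\<Union>c\<in>A. fst c)" using c by auto
  with f obtain c' d' W' where c': "c' \<in> A" "x \<in> fst c'" and d': "d' \<in> B"
    and W': "open W'" "W' \<subseteq> snd c' ` fst c'" "snd c' x \<in> W'" "f ` chart_inv c' ` W' \<subseteq> fst d'"
    and sm: "smooth_on (snd d' \<circ> f \<circ> chart_inv c') W'"
    unfolding smooth_map_def by blast
  define g where "g = snd d' \<circ> f \<circ> chart_inv c'"
  define S where "S = snd c ` (fst c \<inter> fst c')"
  define T where "T = snd d' ` (fst d' \<inter> fst d)"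
  have oS: "open S" and oT: "open T" and smS: "smooth_on (transition c c') S"
    and smT: "smooth_on (transition d' d) T"
    using A B c c' d d' by (auto simp: chart_system_def S_def T_def)
  define W1 where "W1 = S \<inter> transition c c' -` W'"
  have oW1: "open W1" unfolding W1_def
    using continuous_open_preimage[OF smooth_on_continuous_on[OF smS] oS W'(1)] .
  have sm1: "smooth_on (\<lambda>y. g (transition c c' y)) W1"
    by (rule smooth_on_compose[OF oW1 W'(1) sm[folded g_def] smooth_on_subset[OF smS]])
       (auto simp: W1_def)
  define W where "W = W1 \<inter> (\<lambda>y. g (transition c c' y)) -` T"
  have oW: "open W" unfolding W_def
    using continuous_open_preimage[OF smooth_on_continuous_on[OF sm1] oW1 oT] .
  have sm2: "smooth_on (\<lambda>y. transition d' d (g (transition c c' y))) W"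
    by (rule smooth_on_compose[OF oW oT smT smooth_on_subset[OF sm1]])
       (auto simp: W_def)
  have tr: "transition c c' (snd c q) = snd c' q" if "q \<in> fst c" for q
    using that inj(1) by (simp add: transition_def chart_inv_left)
  have gq: "g (snd c' q) = snd d' (f q)" if "q \<in> fst c'" for q
    using that inj(2)[OF c'(1)] by (simp add: g_def chart_inv_left)
  have W_iff: "\<exists>q. y = snd c q \<and> q \<in> fst c \<and> q \<in> fst c' \<and> snd c' q \<in> W' \<and> f q \<in> fst d' \<and> f q \<in> fst d"
    if "y \<in> W" for y
  proof -
    obtain q where y: "y = snd c q" and qc: "q \<in> fst c" "q \<in> fst c'"
      using \<open>y \<in> W\<close> by (auto simp: W_def W1_def S_def)
    then have q: "y = snd c q" "q \<in> fst c" "q \<in> fst c'" "snd c' q \<in> W'" "snd d' (f q) \<in> T"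
      using \<open>y \<in> W\<close> by (simp_all add: W_def W1_def tr gq)
    have "f q \<in> fst d'" using W'(4) q(3,4) inj(2)[OF c'(1)] by (force simp: chart_inv_left)
    moreover from this have "f q \<in> fst d"
      using q(5) inj(3)[OF d'] by (auto simp: T_def dest: inj_onD)
    ultimately show ?thesis using q by auto
  qed
  show ?thesis
  proof (rule that[OF oW])
    have "f x \<in> fst d'" using W'(3,4) c'(2) inj(2)[OF c'(1)] by (force simp: chart_inv_left)
    then show "snd c x \<in> W" using c c' d W'(3) by (auto simp: W_def W1_def S_def T_def tr gq)
    show "W \<subseteq> snd c ` fst c" by (auto simp: W_def W1_def S_def)
    show "f (chart_inv c y) \<in> fst d" if "y \<in> W" for y
      using W_iff[OF that] inj(1) by (auto simp: chart_inv_left)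
    show "smooth_on (\<lambda>y. snd d (f (chart_inv c y))) W"
    proof (rule smooth_on_cong[OF oW sm2])
      fix y assume "y \<in> W"
      then obtain q where q: "y = snd c q" "q \<in> fst c" "q \<in> fst c'" "f q \<in> fst d'"
        using W_iff by blast
      then show "transition d' d (g (transition c c' y)) = snd d (f (chart_inv c y))"
        using inj(1) inj(3)[OF d'] by (simp add: tr gq chart_inv_left) (simp add: transition_def chart_inv_left)
    qed
  qed
qed

section \<open>Coordinates on the manifold and on its tangent bundle\<close>

text \<open>
  The tangent vector at \<open>p\<close> with component \<open>u\<close> in the chart \<open>c\<close>.
\<close>

definition tangent_of :: "('m, 'e::real_normed_vector) chart set \<Rightarrow> ('m, 'e) chart \<Rightarrow> 'm \<Rightarrow> 'e \<Rightarrow> ('m, 'e) tvec" where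
  "tangent_of A c p u =
     (\<lambda>d. if d \<in> A \<and> p \<in> fst d then fderiv (transition c d) (snd c p) u else 0)"

locale smooth_mfd =
  fixes A :: "('m::{t2_space,second_countable_topology}, 'e::{real_inner,heine_borel}) chart set"
  assumes smooth_manifold: "smooth_manifold A"
begin

lemma chart_at: obtains c where "c \<in> A" "p \<in> fst c"
  using smooth_manifold unfolding smooth_manifold_def by blast

lemma chart_props:
  assumes "c \<in> A"
  shows "open (fst c)" "open (snd c ` fst c)" "continuous_on (fst c) (snd c)"
    "continuous_on (snd c ` fst c) (chart_inv c)" "inj_on (snd c) (fst c)"
proof -
  have *: "open (fst c) \<and> open (snd c ` fst c) \<and>
      homeomorphism (fst c) (snd c ` fst c) (snd c) (chart_inv c)"
    using assms smooth_manifold unfolding smooth_manifold_def by blast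
  then show "open (fst c)" "open (snd c ` fst c)" "continuous_on (fst c) (snd c)"
    "continuous_on (snd c ` fst c) (chart_inv c)" by (simp_all add: homeomorphism_def)
  show "inj_on (snd c) (fst c)"
    using * by (intro inj_on_inverseI[where g = "chart_inv c"]) (simp add: homeomorphism_def)
qed

lemma cinv [simp]: "c \<in> A \<Longrightarrow> p \<in> fst c \<Longrightarrow> chart_inv c (snd c p) = p"
  by (rule chart_inv_left[OF chart_props(5)])

lemma open_chart_image:
  assumes "c \<in> A" "open U"
  shows "open (snd c ` (fst c \<inter> U))"
proof -
  have "snd c ` (fst c \<inter> U) = snd c ` fst c \<inter> chart_inv c -` U"
    using assms(1) by auto
  then show ?thesis
    using continuous_open_preimage[OF chart_props(4,2)] assms by metis
qed

lemma open_chart_preimage: "c \<in> A \<Longrightarrow> open V \<Longrightarrow> open (fst c \<inter> snd c -` V)"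
  by (rule continuous_open_preimage[OF chart_props(3,1)])

lemma overlap_open: "c \<in> A \<Longrightarrow> d \<in> A \<Longrightarrow> open (snd c ` (fst c \<inter> fst d))"
  by (rule open_chart_image[OF _ chart_props(1)])

lemma transition_smooth:
  "c \<in> A \<Longrightarrow> d \<in> A \<Longrightarrow> smooth_on (transition c d) (snd c ` (fst c \<inter> fst d))"
  using smooth_manifold unfolding smooth_manifold_def by blast

lemma chart_system: "chart_system A"
  unfolding chart_system_def using chart_props overlap_open transition_smooth by blast

lemma transition_apply: "c \<in> A \<Longrightarrow> p \<in> fst c \<Longrightarrow> transition c d (snd c p) = snd d p"
  by (simp add: transition_def)

lemma jac_linear: "c \<in> A \<Longrightarrow> d \<in> A \<Longrightarrow> p \<in> fst c \<Longrightarrow> p \<in> fst d \<Longrightarrow>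
    linear (fderiv (transition c d) (snd c p))"
  by (rule smooth_on_linear_fderiv[OF transition_smooth]) auto

lemma jac_deriv: "c \<in> A \<Longrightarrow> d \<in> A \<Longrightarrow> p \<in> fst c \<Longrightarrow> p \<in> fst d \<Longrightarrow>
    (transition c d has_derivative fderiv (transition c d) (snd c p)) (at (snd c p))"
  by (rule smooth_on_has_derivative[OF transition_smooth]) auto

lemma jac_self: assumes "c \<in> A" "p \<in> fst c" shows "fderiv (transition c c) (snd c p) u = u"
proof -
  have "fderiv (transition c c) (snd c p) = fderiv (\<lambda>x. x) (snd c p)"
    by (rule fderiv_cong[OF chart_props(2)[OF assms(1)]])
       (use assms in \<open>auto simp: transition_apply\<close>)
  then show ?thesis by (simp add: fderiv_eq[OF has_derivative_ident])
qed

lemma jac_chain: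
  assumes "c \<in> A" "d \<in> A" "e \<in> A" "p \<in> fst c" "p \<in> fst d" "p \<in> fst e"
  shows "fderiv (transition d e) (snd d p) (fderiv (transition c d) (snd c p) u) =
           fderiv (transition c e) (snd c p) u"
proof -
  have "fderiv (transition c e) (snd c p) = fderiv (\<lambda>x. transition d e (transition c d x)) (snd c p)"
    by (rule fderiv_cong[OF open_chart_image[OF assms(1), of "fst d \<inter> fst e"]])
       (use assms chart_props(1)[OF assms(2)] chart_props(1)[OF assms(3)] in \<open>auto simp: transition_apply\<close>)
  moreover have "((\<lambda>x. transition d e (transition c d x)) has_derivative
      (\<lambda>u. fderiv (transition d e) (snd d p) (fderiv (transition c d) (snd c p) u))) (at (snd c p))"
    using jac_deriv[OF assms(2,3,5,6)] assms
    by (intro has_derivative_compose[OF jac_deriv[OF assms(1,2,4,5)]]) (simp add: transition_apply)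
  ultimately show ?thesis by (simp add: fderiv_eq)
qed

lemma tangent_jac: "v \<in> tangent_space A p \<Longrightarrow> c \<in> A \<Longrightarrow> d \<in> A \<Longrightarrow> p \<in> fst c \<Longrightarrow> p \<in> fst d \<Longrightarrow>
    v d = fderiv (transition c d) (snd c p) (v c)"
  unfolding tangent_space_def by blast

lemma tangent_off: "v \<in> tangent_space A p \<Longrightarrow> c \<notin> A \<or> p \<notin> fst c \<Longrightarrow> v c = 0"
  unfolding tangent_space_def by blast

lemma tangent_spaceI:
  assumes "\<And>c. c \<notin> A \<or> p \<notin> fst c \<Longrightarrow> v c = 0"
    and "\<And>c d. c \<in> A \<Longrightarrow> d \<in> A \<Longrightarrow> p \<in> fst c \<Longrightarrow> p \<in> fst d \<Longrightarrow>
      v d = fderiv (transition c d) (snd c p) (v c)"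
  shows "v \<in> tangent_space A p"
  unfolding tangent_space_def using assms by blast

lemma tangent_eqI:
  assumes v: "v \<in> tangent_space A p" and w: "w \<in> tangent_space A p"
    and c: "c \<in> A" "p \<in> fst c" "v c = w c"
  shows "v = w"
proof
  fix d
  show "v d = w d"
  proof (cases "d \<in> A \<and> p \<in> fst d")
    case True
    then show ?thesis using tangent_jac[OF v c(1) _ c(2)] tangent_jac[OF w c(1) _ c(2)] c(3) by simp
  next
    case False
    then show ?thesis using tangent_off[OF v, of d] tangent_off[OF w, of d] by simp
  qed
qed

lemma tangent_of_in: "c \<in> A \<Longrightarrow> p \<in> fst c \<Longrightarrow> tangent_of A c p u \<in> tangent_space A p"
  by (rule tangent_spaceI) (auto simp: tangent_of_def jac_chain)

lemma tangent_of_self: "c \<in> A \<Longrightarrow> p \<in> fst c \<Longrightarrow> tangent_of A c p u c = u"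
  by (simp add: tangent_of_def jac_self)

lemma tangent_of_coord:
  "v \<in> tangent_space A p \<Longrightarrow> c \<in> A \<Longrightarrow> p \<in> fst c \<Longrightarrow> tangent_of A c p (v c) = v"
  by (rule tangent_eqI[OF tangent_of_in]) (auto simp: tangent_of_self)

lemma tangent_of_comp:
  "c \<in> A \<Longrightarrow> d \<in> A \<Longrightarrow> p \<in> fst c \<Longrightarrow> p \<in> fst d \<Longrightarrow>
    tangent_of A c p u d = fderiv (transition c d) (snd c p) u"
  by (simp add: tangent_of_def)

lemma tangent_space_tzero: "tzero \<in> tangent_space A p"
  by (rule tangent_spaceI) (simp_all add: tzero_def linear_0[OF jac_linear])

lemma tangent_space_tscale: "v \<in> tangent_space A p \<Longrightarrow> tscale a v \<in> tangent_space A p"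
proof (rule tangent_spaceI)
  assume v: "v \<in> tangent_space A p"
  show "tscale a v c = 0" if "c \<notin> A \<or> p \<notin> fst c" for c
    using tangent_off[OF v that] by (simp add: tscale_def)
  show "tscale a v d = fderiv (transition c d) (snd c p) (tscale a v c)"
    if cd: "c \<in> A" "d \<in> A" "p \<in> fst c" "p \<in> fst d" for c d
    unfolding tscale_def linear_cmul[OF jac_linear[OF cd]] tangent_jac[OF v cd, symmetric] by (rule refl)
qed

lemma tangent_space_tadd:
  "v \<in> tangent_space A p \<Longrightarrow> w \<in> tangent_space A p \<Longrightarrow> tadd v w \<in> tangent_space A p"
proof (rule tangent_spaceI)
  assume v: "v \<in> tangent_space A p" and w: "w \<in> tangent_space A p"
  show "tadd v w c = 0" if "c \<notin> A \<or> p \<notin> fst c" for c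
    using tangent_off[OF v that] tangent_off[OF w that] by (simp add: tadd_def)
  show "tadd v w d = fderiv (transition c d) (snd c p) (tadd v w c)"
    if cd: "c \<in> A" "d \<in> A" "p \<in> fst c" "p \<in> fst d" for c d
    unfolding tadd_def linear_add[OF jac_linear[OF cd]]
      tangent_jac[OF v cd, symmetric] tangent_jac[OF w cd, symmetric] by (rule refl)
qed

lemma tangent_chart_image:
  assumes "c \<in> A"
  shows "snd (tangent_chart A c) ` (fst (tangent_chart A c) \<inter> {(p, v). p \<in> S}) = (snd c ` (fst c \<inter> S)) \<times> UNIV"
proof
  show "snd (tangent_chart A c) ` (fst (tangent_chart A c) \<inter> {(p, v). p \<in> S}) \<subseteq>
      (snd c ` (fst c \<inter> S)) \<times> UNIV"
    by (auto simp: tangent_chart_def)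
  show "(snd c ` (fst c \<inter> S)) \<times> UNIV \<subseteq>
      snd (tangent_chart A c) ` (fst (tangent_chart A c) \<inter> {(p, v). p \<in> S})"
  proof
    fix z assume "z \<in> (snd c ` (fst c \<inter> S)) \<times> (UNIV :: 'e set)"
    then obtain p u where "z = (snd c p, u)" "p \<in> fst c" "p \<in> S" by blast
    then show "z \<in> snd (tangent_chart A c) ` (fst (tangent_chart A c) \<inter> {(p, v). p \<in> S})"
      by (intro rev_image_eqI[of "(p, tangent_of A c p u)"])
         (simp_all add: tangent_chart_def tangent_of_in[OF assms] tangent_of_self[OF assms])
  qed
qed

lemma tangent_chart_image': "c \<in> A \<Longrightarrow> snd (tangent_chart A c) ` fst (tangent_chart A c) = (snd c ` fst c) \<times> UNIV"
  using tangent_chart_image[of c UNIV] by simp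

lemma tangent_chart_inj: "c \<in> A \<Longrightarrow> inj_on (snd (tangent_chart A c)) (fst (tangent_chart A c))"
  by (rule inj_onI) (auto simp: tangent_chart_def dest: inj_onD[OF chart_props(5)] intro: tangent_eqI[of _ _ _ c])

lemma tangent_chart_inv:
  assumes "c \<in> A" "p \<in> fst c"
  shows "chart_inv (tangent_chart A c) (snd c p, u) = (p, tangent_of A c p u)"
  using chart_inv_left[OF tangent_chart_inj[OF assms(1)], of "(p, tangent_of A c p u)"]
    assms tangent_of_in tangent_of_self by (simp add: tangent_chart_def)

lemma tangent_transition:
  assumes "c \<in> A" "d \<in> A" "p \<in> fst c" "p \<in> fst d"
  shows "transition (tangent_chart A c) (tangent_chart A d) (snd c p, u) =
           (snd d p, fderiv (transition c d) (snd c p) u)"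
  using assms by (simp add: transition_def[of "tangent_chart A c"] tangent_chart_inv) (simp add: tangent_chart_def tangent_of_comp)

text \<open>
  The transition maps of the tangent bundle are \<open>(x, u) \<mapsto> (\<phi>(x), d\<phi>\<^sub>x u)\<close>
  for a transition map \<open>\<phi>\<close> of the manifold.
\<close>

lemma chart_system_tangent: "chart_system (tangent_atlas A)"
proof -
  have "smooth_on (transition (tangent_chart A c) (tangent_chart A d))
     (snd c ` (fst c \<inter> fst d) \<times> UNIV)" if cd: "c \<in> A" "d \<in> A" for c d
  proof -
    note o = overlap_open[OF cd]
    have oU: "open (snd c ` (fst c \<inter> fst d) \<times> (UNIV :: 'e set))" by (intro open_Times o) auto
    have f: "smooth_on fst (snd c ` (fst c \<inter> fst d) \<times> (UNIV :: 'e set))"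
      "smooth_on snd (snd c ` (fst c \<inter> fst d) \<times> (UNIV :: 'e set))"
      by (intro smooth_on_linear oU bounded_linear_fst bounded_linear_snd)+
    have "smooth_on (\<lambda>z. (transition c d (fst z), fderiv (transition c d) (fst z) (snd z)))
       (snd c ` (fst c \<inter> fst d) \<times> UNIV)"
      by (intro smooth_on_Pair oU smooth_on_compose[OF oU o transition_smooth[OF cd] f(1)]
            smooth_on_fderiv_at[OF oU o transition_smooth[OF cd] f]) auto
    then show ?thesis
      by (rule smooth_on_cong[OF oU]) (use cd in \<open>auto simp: tangent_transition transition_apply\<close>)
  qed
  moreover have "fst (tangent_chart A c) \<inter> fst (tangent_chart A d) =
      fst (tangent_chart A c) \<inter> {(p, v). p \<in> fst d}" for c d
    by (auto simp: tangent_chart_def)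
  ultimately show ?thesis
    unfolding chart_system_def tangent_atlas_def
    by (auto simp: tangent_chart_inj tangent_chart_image' tangent_chart_image
        intro!: open_Times chart_props overlap_open)
qed

section \<open>Smooth functions, vector fields and curves in coordinates\<close>

lemma vf_tangent: "X \<in> vector_fields A \<Longrightarrow> X p \<in> tangent_space A p"
  by (simp add: vector_fields_def)

lemma vf_smooth:
  assumes X: "X \<in> vector_fields A" and c: "c \<in> A"
  shows "smooth_on (\<lambda>x. X (chart_inv c x) c) (snd c ` fst c)"
proof (rule smooth_on_local)
  fix x assume "x \<in> snd c ` fst c"
  then obtain p where p: "p \<in> fst c" "x = snd c p" by auto
  have d: "(p, X p) \<in> fst (tangent_chart A c)"
    using p vf_tangent[OF X] by (simp add: tangent_chart_def)
  have sm: "smooth_map A (tangent_atlas A) (\<lambda>p. (p, X p))"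
    using X by (simp add: vector_fields_def)
  have e: "tangent_chart A c \<in> tangent_atlas A" using c by (simp add: tangent_atlas_def)
  obtain W where W: "open W" "snd c p \<in> W"
    "smooth_on (\<lambda>y. snd (tangent_chart A c) (chart_inv c y, X (chart_inv c y))) W"
    by (rule smooth_map_in_charts[OF chart_system chart_system_tangent sm c p(1) e d])
  from smooth_on_linear_comp[OF W(1) bounded_linear_snd W(3)] W(1,2) p
  show "\<exists>U. open U \<and> x \<in> U \<and> smooth_on (\<lambda>x. X (chart_inv c x) c) U"
    by (auto simp: tangent_chart_def)
qed

lemma vfI:
  assumes T: "\<And>p. X p \<in> tangent_space A p"
    and S: "\<And>p. \<exists>c W. c \<in> A \<and> p \<in> fst c \<and> open W \<and> snd c p \<in> W \<and> W \<subseteq> snd c ` fst c \<and>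
      smooth_on (\<lambda>x. X (chart_inv c x) c) W"
  shows "X \<in> vector_fields A"
proof -
  have "smooth_map A (tangent_atlas A) (\<lambda>p. (p, X p))"
    unfolding smooth_map_def
  proof
    fix p
    obtain c W where c: "c \<in> A" "p \<in> fst c" and W: "open W" "snd c p \<in> W" "W \<subseteq> snd c ` fst c"
      and sm: "smooth_on (\<lambda>x. X (chart_inv c x) c) W" using S[of p] by blast
    have "smooth_on (snd (tangent_chart A c) \<circ> (\<lambda>p. (p, X p)) \<circ> chart_inv c) W"
      by (rule smooth_on_cong[OF W(1) smooth_on_Pair[OF W(1) smooth_on_id[OF W(1)] sm]])
         (use W(3) c in \<open>auto simp: tangent_chart_def\<close>)
    moreover have "(\<lambda>p. (p, X p)) ` chart_inv c ` W \<subseteq> fst (tangent_chart A c)"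
      using W(3) T by (auto simp: tangent_chart_def chart_inv_in)
    ultimately show "\<exists>c\<in>A. \<exists>d\<in>tangent_atlas A. \<exists>W. p \<in> fst c \<and> open W \<and> W \<subseteq> snd c ` fst c \<and>
        snd c p \<in> W \<and> (\<lambda>p. (p, X p)) ` chart_inv c ` W \<subseteq> fst d \<and>
        smooth_on (snd d \<circ> (\<lambda>p. (p, X p)) \<circ> chart_inv c) W"
      using c W unfolding tangent_atlas_def by blast
  qed
  then show ?thesis using T by (simp add: vector_fields_def)
qed

lemma sf_smooth:
  assumes f: "f \<in> smooth_functions A" and c: "c \<in> A"
  shows "smooth_on (\<lambda>x. f (chart_inv c x)) (snd c ` fst c)"
proof (rule smooth_on_local)
  fix x assume "x \<in> snd c ` fst c"
  then obtain p where p: "p \<in> fst c" "x = snd c p" by auto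
  have sm: "smooth_map A (open_atlas UNIV) f" using f by (simp add: smooth_functions_def)
  have d: "(UNIV, \<lambda>x. x) \<in> open_atlas UNIV" "f p \<in> fst (UNIV, \<lambda>x. x)" by (simp_all add: open_atlas_def)
  obtain W where "open W" "snd c p \<in> W" "smooth_on (\<lambda>y. f (chart_inv c y)) W"
    by (rule smooth_map_in_charts[OF chart_system chart_system_open_atlas[OF open_UNIV] sm c p(1) d]) simp
  then show "\<exists>U. open U \<and> x \<in> U \<and> smooth_on (\<lambda>x. f (chart_inv c x)) U"
    using p by auto
qed

lemma sfI:
  assumes "\<And>p. \<exists>c W. c \<in> A \<and> p \<in> fst c \<and> open W \<and> snd c p \<in> W \<and> W \<subseteq> snd c ` fst c \<and>
      smooth_on (\<lambda>x. f (chart_inv c x)) W"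
  shows "f \<in> smooth_functions A"
  unfolding smooth_functions_def smooth_map_def open_atlas_def
proof (intro CollectI ballI)
  fix p
  obtain c W where "c \<in> A" "p \<in> fst c" "open W" "snd c p \<in> W" "W \<subseteq> snd c ` fst c"
    "smooth_on (\<lambda>x. f (chart_inv c x)) W" using assms[of p] by blast
  then show "\<exists>c\<in>A. \<exists>d\<in>{(UNIV, \<lambda>x. x)}. \<exists>W. p \<in> fst c \<and> open W \<and> W \<subseteq> snd c ` fst c \<and>
      snd c p \<in> W \<and> f ` chart_inv c ` W \<subseteq> fst d \<and> smooth_on (snd d \<circ> f \<circ> chart_inv c) W"
    by (intro bexI[of _ c] bexI[of _ "(UNIV, \<lambda>x. x)"] exI[of _ W]) (auto simp: o_def)
qed

lemma sf_const: "(\<lambda>p. a) \<in> smooth_functions A"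
proof (rule sfI)
  fix p
  obtain c where "c \<in> A" "p \<in> fst c" by (rule chart_at)
  then show "\<exists>c W. c \<in> A \<and> p \<in> fst c \<and> open W \<and> snd c p \<in> W \<and> W \<subseteq> snd c ` fst c \<and>
      smooth_on (\<lambda>x. a) W"
    by (intro exI[of _ c] exI[of _ "snd c ` fst c"]) (simp add: chart_props smooth_on_const)
qed

lemma vf_comb:
  assumes "f \<in> smooth_functions A" "g \<in> smooth_functions A" "X \<in> vector_fields A" "Y \<in> vector_fields A"
  shows "(\<lambda>p. tadd (tscale (f p) (X p)) (tscale (g p) (Y p))) \<in> vector_fields A"
proof (rule vfI)
  show "tadd (tscale (f p) (X p)) (tscale (g p) (Y p)) \<in> tangent_space A p" for p
    using assms by (intro tangent_space_tadd tangent_space_tscale vf_tangent)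
  fix p
  obtain c where c: "c \<in> A" "p \<in> fst c" by (rule chart_at)
  note o = chart_props(2)[OF c(1)]
  have "smooth_on (\<lambda>x. f (chart_inv c x) *\<^sub>R X (chart_inv c x) c + g (chart_inv c x) *\<^sub>R Y (chart_inv c x) c)
      (snd c ` fst c)"
    using assms c by (intro smooth_on_add smooth_on_scaleR o sf_smooth vf_smooth)
  then show "\<exists>c W. c \<in> A \<and> p \<in> fst c \<and> open W \<and> snd c p \<in> W \<and> W \<subseteq> snd c ` fst c \<and>
      smooth_on (\<lambda>x. tadd (tscale (f (chart_inv c x)) (X (chart_inv c x)))
        (tscale (g (chart_inv c x)) (Y (chart_inv c x))) c) W"
    using c o by (intro exI[of _ c] exI[of _ "snd c ` fst c"]) (auto simp: tadd_def tscale_def)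
qed

text \<open>
  \<open>vf_apply\<close> uses an unspecified chart. The derivative of a function along a tangent vector is
  the same in every chart, by the chain rule and the transformation law of tangent vectors.
\<close>

lemma vf_apply_coord:
  assumes f: "f \<in> smooth_functions A" and X: "X \<in> vector_fields A" and c: "c \<in> A" "p \<in> fst c"
  shows "vf_apply A X f p = fderiv (\<lambda>x. f (chart_inv c x)) (snd c p) (X p c)"
proof -
  define d where "d = (SOME d. d \<in> A \<and> p \<in> fst d)"
  have d: "d \<in> A" "p \<in> fst d" using someI[of "\<lambda>d. d \<in> A \<and> p \<in> fst d" c] c by (auto simp: d_def)
  have D: "((\<lambda>x. f (chart_inv d x)) has_derivative fderiv (\<lambda>x. f (chart_inv d x)) (snd d p)) (at (snd d p))"
    by (rule smooth_on_has_derivative[OF sf_smooth[OF f d(1)]]) (use d in auto)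
  have "fderiv (\<lambda>x. f (chart_inv c x)) (snd c p) = fderiv (\<lambda>x. f (chart_inv d (transition c d x))) (snd c p)"
    by (rule fderiv_cong[OF overlap_open[OF c(1) d(1)]]) (use c d in \<open>auto simp: transition_apply\<close>)
  moreover have "((\<lambda>x. f (chart_inv d (transition c d x))) has_derivative
      (\<lambda>u. fderiv (\<lambda>x. f (chart_inv d x)) (snd d p) (fderiv (transition c d) (snd c p) u))) (at (snd c p))"
    by (rule has_derivative_compose[OF jac_deriv[OF c(1) d(1) c(2) d(2)]])
       (use D c in \<open>simp add: transition_apply\<close>)
  ultimately have "fderiv (\<lambda>x. f (chart_inv c x)) (snd c p) (X p c) =
      fderiv (\<lambda>x. f (chart_inv d x)) (snd d p) (X p d)"
    using tangent_jac[OF vf_tangent[OF X] c(1) d(1) c(2) d(2)] by (simp add: fderiv_eq)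
  then show ?thesis by (simp add: vf_apply_def d_def[symmetric] o_def)
qed

lemma curve_smooth:
  assumes I: "open (I :: real set)" and \<gamma>: "smooth_map (open_atlas I) A \<gamma>" and t: "t \<in> I" and c: "c \<in> A" "\<gamma> t \<in> fst c"
  obtains W where "open W" "t \<in> W" "W \<subseteq> I" "\<And>\<tau>. \<tau> \<in> W \<Longrightarrow> \<gamma> \<tau> \<in> fst c"
    "smooth_on (\<lambda>\<tau>. snd c (\<gamma> \<tau>)) W"
proof -
  have inv: "chart_inv (I, \<lambda>x. x) y = y" if "y \<in> I" for y
    using chart_inv_left[of "(I, \<lambda>x. x)" y] that by simp
  have d: "(I, \<lambda>x. x) \<in> open_atlas I" "t \<in> fst (I, \<lambda>x. x)" using t by (simp_all add: open_atlas_def)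
  obtain W where W: "open W" "t \<in> W" "W \<subseteq> I" "\<And>y. y \<in> W \<Longrightarrow> \<gamma> (chart_inv (I, \<lambda>x. x) y) \<in> fst c"
    and sm: "smooth_on (\<lambda>y. snd c (\<gamma> (chart_inv (I, \<lambda>x. x) y))) W"
    by (rule smooth_map_in_charts[OF chart_system_open_atlas[OF I] chart_system \<gamma> d c]) simp
  show ?thesis
    by (rule that[OF W(1-3) _ smooth_on_cong[OF W(1) sm]]) (use W inv in \<open>force+\<close>)
qed

lemma curveI:
  assumes "\<And>t. t \<in> (I :: real set) \<Longrightarrow> \<exists>c W. c \<in> A \<and> open W \<and> t \<in> W \<and> W \<subseteq> I \<and> \<gamma> ` W \<subseteq> fst c \<and>
    smooth_on (\<lambda>\<tau>. snd c (\<gamma> \<tau>)) W"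
  shows "smooth_map (open_atlas I) A \<gamma>"
proof -
  have inv: "chart_inv (I, \<lambda>x. x) y = y" if "y \<in> I" for y
    using chart_inv_left[of "(I, \<lambda>x. x)" y] that by simp
  have "\<exists>d\<in>A. \<exists>W. open W \<and> W \<subseteq> I \<and> t \<in> W \<and> \<gamma> ` chart_inv (I, \<lambda>x. x) ` W \<subseteq> fst d \<and>
      smooth_on (snd d \<circ> \<gamma> \<circ> chart_inv (I, \<lambda>x. x)) W" if "t \<in> I" for t
  proof -
    obtain c W where c: "c \<in> A" "open W" "t \<in> W" "W \<subseteq> I" "\<gamma> ` W \<subseteq> fst c"
      and sm: "smooth_on (\<lambda>\<tau>. snd c (\<gamma> \<tau>)) W" using assms \<open>t \<in> I\<close> by blast
    have "smooth_on (snd c \<circ> \<gamma> \<circ> chart_inv (I, \<lambda>x. x)) W"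
      by (rule smooth_on_cong[OF c(2) sm]) (use c(4) inv in auto)
    moreover have "chart_inv (I, \<lambda>x. x) ` W = W" using inv c(4) by force
    ultimately show ?thesis using c by (intro bexI[of _ c] exI[of _ W]) simp_all
  qed
  then show ?thesis unfolding smooth_map_def open_atlas_def by simp
qed

lemma velocity_coord: "c \<in> A \<Longrightarrow> \<gamma> t \<in> fst c \<Longrightarrow>
    velocity A \<gamma> t c = vector_derivative (\<lambda>\<tau>. snd c (\<gamma> \<tau>)) (at t)"
  by (simp add: velocity_def o_def)

lemma velocity_tangent:
  assumes I: "open I" and \<gamma>: "smooth_map (open_atlas I) A \<gamma>" and t: "t \<in> I"
  shows "velocity A \<gamma> t \<in> tangent_space A (\<gamma> t)"
proof -
  have "velocity A \<gamma> t d = fderiv (transition c d) (snd c (\<gamma> t)) (velocity A \<gamma> t c)"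
    if cd: "c \<in> A" "d \<in> A" "\<gamma> t \<in> fst c" "\<gamma> t \<in> fst d" for c d
  proof -
    obtain W where W: "open W" "t \<in> W" "\<And>\<tau>. \<tau> \<in> W \<Longrightarrow> \<gamma> \<tau> \<in> fst c"
        "smooth_on (\<lambda>\<tau>. snd c (\<gamma> \<tau>)) W" using curve_smooth[OF I \<gamma> t cd(1,3)] by metis
    have "((\<lambda>\<tau>. transition c d (snd c (\<gamma> \<tau>))) has_derivative
        (\<lambda>s. fderiv (transition c d) (snd c (\<gamma> t)) (fderiv (\<lambda>\<tau>. snd c (\<gamma> \<tau>)) t s))) (at t)"
      by (rule has_derivative_compose[OF smooth_on_has_derivative[OF W(4,2)] jac_deriv[OF cd]])
    then have D: "((\<lambda>\<tau>. snd d (\<gamma> \<tau>)) has_derivative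
        (\<lambda>s. fderiv (transition c d) (snd c (\<gamma> t)) (fderiv (\<lambda>\<tau>. snd c (\<gamma> \<tau>)) t s))) (at t)"
      by (rule has_derivative_transform_within_open[OF _ W(1,2)]) (use W(3) cd in \<open>simp add: transition_apply\<close>)
    have "(\<lambda>\<tau>. snd d (\<gamma> \<tau>)) differentiable at t" "(\<lambda>\<tau>. snd c (\<gamma> \<tau>)) differentiable at t"
      using D smooth_on_has_derivative[OF W(4,2)] unfolding differentiable_def by blast+
    then show ?thesis using cd
      by (simp add: velocity_coord vector_derivative_fderiv fderiv_eq[OF D])
  qed
  moreover have "velocity A \<gamma> t c = 0" if "c \<notin> A \<or> \<gamma> t \<notin> fst c" for c
    using that by (auto simp: velocity_def)
  ultimately show ?thesis by (intro tangent_spaceI)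
qed

section \<open>Cut-off functions and coordinate fields on the manifold\<close>

text \<open>
  A bump function of the model space is supported in a closed ball of the chart. The set \<open>K\<close>
  corresponding to that ball is compact, hence closed in the Hausdorff space, so that objects that
  vanish off \<open>K\<close> extend smoothly by 0 beyond the domain of the chart.
\<close>

lemma chart_bump:
  assumes c: "c \<in> A" "p \<in> fst c" and N: "open N" "p \<in> N"
  obtains \<beta> K N' where "smooth_on \<beta> (UNIV :: 'e set)" "closed K" "K \<subseteq> fst c \<inter> N"
    "\<And>q. q \<in> fst c \<Longrightarrow> q \<notin> K \<Longrightarrow> \<beta> (snd c q) = (0::real)"
    "open N'" "p \<in> N'" "N' \<subseteq> fst c" "\<And>q. q \<in> N' \<Longrightarrow> \<beta> (snd c q) = 1"
proof -
  have "open (snd c ` (fst c \<inter> N))" "snd c p \<in> snd c ` (fst c \<inter> N)"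
    using open_chart_image c N by auto
  then obtain e where e: "e > 0" "cball (snd c p) e \<subseteq> snd c ` (fst c \<inter> N)"
    using open_contains_cball by blast
  obtain \<beta> :: "'e \<Rightarrow> real" where \<beta>: "smooth_on \<beta> UNIV"
    "\<And>x. x \<in> ball (snd c p) (e / 2) \<Longrightarrow> \<beta> x = 1" "\<And>x. x \<notin> ball (snd c p) e \<Longrightarrow> \<beta> x = 0"
    using bump_function[OF e(1)] by metis
  define K where "K = chart_inv c ` cball (snd c p) e"
  have "cball (snd c p) e \<subseteq> snd c ` fst c" using e(2) by blast
  then have "compact K" unfolding K_def
    by (intro compact_continuous_image compact_cball continuous_on_subset[OF chart_props(4)[OF c(1)]])
  then have "closed K" by (rule compact_imp_closed)
  show ?thesis
  proof (rule that[OF \<beta>(1) \<open>closed K\<close>])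
    show "K \<subseteq> fst c \<inter> N"
    proof
      fix q assume "q \<in> K"
      then obtain x where x: "x \<in> cball (snd c p) e" "q = chart_inv c x" by (auto simp: K_def)
      then obtain q' where "q' \<in> fst c \<inter> N" "x = snd c q'" using e(2) by blast
      then show "q \<in> fst c \<inter> N" using x c by simp
    qed
    show "\<beta> (snd c q) = 0" if "q \<in> fst c" "q \<notin> K" for q
    proof (rule \<beta>(3))
      show "snd c q \<notin> ball (snd c p) e"
      proof
        assume "snd c q \<in> ball (snd c p) e"
        then have "chart_inv c (snd c q) \<in> K" unfolding K_def by (intro imageI) auto
        then show False using that c by simp
      qed
    qed
    show "open (fst c \<inter> snd c -` ball (snd c p) (e / 2))" by (rule open_chart_preimage[OF c(1) open_ball])
  qed (use c e \<beta> in auto)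
qed

lemma bump_on_manifold:
  assumes N: "open N" "p \<in> N"
  obtains h where "h \<in> smooth_functions A" "h p = 1" "\<And>q. q \<notin> N \<Longrightarrow> h q = 0"
proof -
  obtain c where c: "c \<in> A" "p \<in> fst c" by (rule chart_at)
  obtain \<beta> K N' where \<beta>: "smooth_on \<beta> (UNIV :: 'e set)" "closed K" "K \<subseteq> fst c \<inter> N"
    "\<And>q. q \<in> fst c \<Longrightarrow> q \<notin> K \<Longrightarrow> \<beta> (snd c q) = (0::real)"
    "p \<in> N'" "\<And>q. q \<in> N' \<Longrightarrow> \<beta> (snd c q) = 1"
    using chart_bump[OF c N] by metis
  define h where "h q = (if q \<in> fst c then \<beta> (snd c q) else 0)" for q
  have "h \<in> smooth_functions A"
  proof (rule sfI)
    fix q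
    show "\<exists>c W. c \<in> A \<and> q \<in> fst c \<and> open W \<and> snd c q \<in> W \<and> W \<subseteq> snd c ` fst c \<and>
      smooth_on (\<lambda>x. h (chart_inv c x)) W"
    proof (cases "q \<in> fst c")
      case True
      note o = chart_props(2)[OF c(1)]
      have "smooth_on (\<lambda>x. h (chart_inv c x)) (snd c ` fst c)"
        by (rule smooth_on_cong[OF o smooth_on_subset[OF \<beta>(1)]]) (use c in \<open>auto simp: h_def\<close>)
      then show ?thesis using c True o by blast
    next
      case False
      obtain d where d: "d \<in> A" "q \<in> fst d" by (rule chart_at)
      have o: "open (snd d ` (fst d \<inter> - K))" using open_chart_image[OF d(1)] \<beta>(2) by auto
      have "smooth_on (\<lambda>x. h (chart_inv d x)) (snd d ` (fst d \<inter> - K))"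
        by (rule smooth_on_cong[OF o smooth_on_const[OF o, of 0]]) (use d \<beta>(4) in \<open>auto simp: h_def\<close>)
      moreover have "q \<notin> K" using False \<beta>(3) by auto
      ultimately show ?thesis using d o
        by (intro exI[of _ d] exI[of _ "snd d ` (fst d \<inter> - K)"]) auto
    qed
  qed
  then show ?thesis
    by (rule that) (use c \<beta> in \<open>auto simp: h_def\<close>)
qed

text \<open>
  One neighbourhood \<open>N\<close> serves all \<open>u\<close>, so that Christoffel symbols at different
  points of \<open>N\<close> and for different arguments can be computed from the same fields.
\<close>

lemma coordinate_fields:
  assumes c: "c \<in> A" "p \<in> fst c"
  obtains N where "open N" "p \<in> N" "N \<subseteq> fst c"
    "\<And>u. \<exists>U\<in>vector_fields A. \<forall>q\<in>N. U q c = u"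
proof -
  obtain \<beta> K N where \<beta>: "smooth_on \<beta> (UNIV :: 'e set)" "closed K" "K \<subseteq> fst c \<inter> UNIV"
    "\<And>q. q \<in> fst c \<Longrightarrow> q \<notin> K \<Longrightarrow> \<beta> (snd c q) = (0::real)"
    and N: "open N" "p \<in> N" "N \<subseteq> fst c" "\<And>q. q \<in> N \<Longrightarrow> \<beta> (snd c q) = 1"
    using chart_bump[OF c open_UNIV UNIV_I] by metis
  show ?thesis
  proof (rule that[OF N(1-3)])
    fix u
    define U where "U q = (if q \<in> fst c then tscale (\<beta> (snd c q)) (tangent_of A c q u) else tzero)" for q
    have "U \<in> vector_fields A"
    proof (rule vfI)
      show "U q \<in> tangent_space A q" for q
        using c by (simp add: U_def tangent_space_tzero tangent_space_tscale tangent_of_in)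
      fix q
      show "\<exists>c W. c \<in> A \<and> q \<in> fst c \<and> open W \<and> snd c q \<in> W \<and> W \<subseteq> snd c ` fst c \<and>
        smooth_on (\<lambda>x. U (chart_inv c x) c) W"
      proof (cases "q \<in> fst c")
        case True
        note o = chart_props(2)[OF c(1)]
        have "smooth_on (\<lambda>x. U (chart_inv c x) c) (snd c ` fst c)"
          by (rule smooth_on_cong[OF o smooth_on_scaleR[OF o smooth_on_subset[OF \<beta>(1)] smooth_on_const[OF o, of u]]])
             (use c in \<open>auto simp: U_def tscale_def tangent_of_self\<close>)
        then show ?thesis using c True o by blast
      next
        case False
        obtain d where d: "d \<in> A" "q \<in> fst d" by (rule chart_at)
        have o: "open (snd d ` (fst d \<inter> - K))" using open_chart_image[OF d(1)] \<beta>(2) by auto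
        have "smooth_on (\<lambda>x. U (chart_inv d x) d) (snd d ` (fst d \<inter> - K))"
          by (rule smooth_on_cong[OF o smooth_on_const[OF o, of 0]])
             (use d \<beta>(4) in \<open>auto simp: U_def tscale_def tzero_def\<close>)
        moreover have "q \<notin> K" using False \<beta>(3) by auto
        ultimately show ?thesis using d o
          by (intro exI[of _ d] exI[of _ "snd d ` (fst d \<inter> - K)"]) auto
      qed
    qed
    moreover have "U q c = u" if "q \<in> N" for q
      using that N(3,4) c(1) by (auto simp: U_def tscale_def tangent_of_self subset_iff)
    ultimately show "\<exists>U\<in>vector_fields A. \<forall>q\<in>N. U q c = u" by blast
  qed
qed

end

section \<open>Uniqueness for ordinary differential equations\<close>

text \<open>
  The squared distance \<open>\<phi>\<close> of the two solutions satisfies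
  \<open>\<bar>\<phi>'\<bar> \<le> 2 L \<phi>\<close>. Hence \<open>\<phi> t * exp (- 2 L t)\<close> is
  nonincreasing and \<open>\<phi> t * exp (2 L t)\<close> is nondecreasing; as \<open>\<phi>\<close> is
  nonnegative and vanishes at \<open>t\<^sub>0\<close>, it vanishes on both sides.
\<close>

lemma ode_unique:
  fixes z\<^sub>1 z\<^sub>2 :: "real \<Rightarrow> 'a::real_inner"
  assumes d1: "\<And>t. t \<in> ball t\<^sub>0 e \<Longrightarrow> (z\<^sub>1 has_vector_derivative F (z\<^sub>1 t)) (at t)"
    and d2: "\<And>t. t \<in> ball t\<^sub>0 e \<Longrightarrow> (z\<^sub>2 has_vector_derivative F (z\<^sub>2 t)) (at t)"
    and lip: "\<And>t. t \<in> ball t\<^sub>0 e \<Longrightarrow> norm (F (z\<^sub>1 t) - F (z\<^sub>2 t)) \<le> L * norm (z\<^sub>1 t - z\<^sub>2 t)"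
    and init: "z\<^sub>1 t\<^sub>0 = z\<^sub>2 t\<^sub>0" and t: "t \<in> ball t\<^sub>0 e"
  shows "z\<^sub>1 t = z\<^sub>2 t"
proof -
  define w where "w t = z\<^sub>1 t - z\<^sub>2 t" for t
  define g where "g t = F (z\<^sub>1 t) - F (z\<^sub>2 t)" for t
  define \<phi> where "\<phi> t = w t \<bullet> w t" for t
  have \<phi>0: "\<phi> t \<ge> 0" for t by (simp add: \<phi>_def)
  have D\<phi>: "(\<phi> has_real_derivative 2 * (w t \<bullet> g t)) (at t)" if "t \<in> ball t\<^sub>0 e" for t
  proof -
    have "(w has_vector_derivative g t) (at t)"
      unfolding w_def g_def by (rule has_vector_derivative_diff[OF d1 d2]) (use that in auto)
    then have "(w has_derivative (\<lambda>h. h *\<^sub>R g t)) (at t)" by (simp add: has_vector_derivative_def)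
    moreover have "(\<lambda>h. w t \<bullet> (h *\<^sub>R g t) + (h *\<^sub>R g t) \<bullet> w t) = (*) (2 * (w t \<bullet> g t))"
      by (simp add: fun_eq_iff inner_commute)
    ultimately show ?thesis
      unfolding \<phi>_def has_field_derivative_def using has_derivative_inner[of w _ t UNIV w] by metis
  qed
  have bd: "\<bar>2 * (w t \<bullet> g t)\<bar> \<le> 2 * L * \<phi> t" if "t \<in> ball t\<^sub>0 e" for t
  proof -
    have "\<bar>w t \<bullet> g t\<bar> \<le> norm (w t) * norm (g t)" by (rule Cauchy_Schwarz_ineq2)
    also have "\<dots> \<le> norm (w t) * (L * norm (w t))"
      using lip[OF that] by (intro mult_left_mono) (auto simp: w_def g_def)
    also have "\<dots> = L * \<phi> t" by (simp add: \<phi>_def power2_norm_eq_inner[symmetric] power2_eq_square)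
    finally show ?thesis by simp
  qed
  have "\<phi> t \<le> 0"
  proof (cases "t\<^sub>0 \<le> t")
    case True
    have in_ball: "s \<in> ball t\<^sub>0 e" if "t\<^sub>0 \<le> s" "s \<le> t" for s using that t by (auto simp: dist_real_def)
    have "\<phi> t * exp (- 2 * L * t) \<le> \<phi> t\<^sub>0 * exp (- 2 * L * t\<^sub>0)"
    proof (rule DERIV_nonpos_imp_nonincreasing[OF True])
      fix s assume s: "t\<^sub>0 \<le> s" "s \<le> t"
      have "((\<lambda>s. \<phi> s * exp (- 2 * L * s)) has_real_derivative
          (2 * (w s \<bullet> g s) - 2 * L * \<phi> s) * exp (- 2 * L * s)) (at s)"
        by (auto intro!: derivative_eq_intros D\<phi>[OF in_ball[OF s]] simp: algebra_simps)
      moreover have "(2 * (w s \<bullet> g s) - 2 * L * \<phi> s) * exp (- 2 * L * s) \<le> 0"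
        using bd[OF in_ball[OF s]] by (intro mult_nonpos_nonneg) auto
      ultimately show "\<exists>y. ((\<lambda>s. \<phi> s * exp (- 2 * L * s)) has_real_derivative y) (at s) \<and> y \<le> 0"
        by blast
    qed
    also have "\<phi> t\<^sub>0 = 0" using init by (simp add: \<phi>_def w_def)
    finally show ?thesis by (simp add: mult_le_0_iff)
  next
    case False
    then have le: "t \<le> t\<^sub>0" by simp
    have in_ball: "s \<in> ball t\<^sub>0 e" if "t \<le> s" "s \<le> t\<^sub>0" for s using that t by (auto simp: dist_real_def)
    have "\<phi> t * exp (2 * L * t) \<le> \<phi> t\<^sub>0 * exp (2 * L * t\<^sub>0)"
    proof (rule DERIV_nonneg_imp_nondecreasing[OF le])
      fix s assume s: "t \<le> s" "s \<le> t\<^sub>0"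
      have "((\<lambda>s. \<phi> s * exp (2 * L * s)) has_real_derivative
          (2 * (w s \<bullet> g s) + 2 * L * \<phi> s) * exp (2 * L * s)) (at s)"
        by (auto intro!: derivative_eq_intros D\<phi>[OF in_ball[OF s]] simp: algebra_simps)
      moreover have "0 \<le> (2 * (w s \<bullet> g s) + 2 * L * \<phi> s) * exp (2 * L * s)"
        using bd[OF in_ball[OF s]] by (intro mult_nonneg_nonneg) auto
      ultimately show "\<exists>y. ((\<lambda>s. \<phi> s * exp (2 * L * s)) has_real_derivative y) (at s) \<and> 0 \<le> y"
        by blast
    qed
    also have "\<phi> t\<^sub>0 = 0" using init by (simp add: \<phi>_def w_def)
    finally show ?thesis by (simp add: mult_le_0_iff)
  qed
  then have "\<phi> t = 0" using \<phi>0[of t] by simp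
  then show ?thesis by (simp add: \<phi>_def w_def)
qed

lemma vector_derivative_cong_open:
  assumes "open S" "t \<in> S" "\<And>s. s \<in> S \<Longrightarrow> f s = g s"
  shows "vector_derivative f (at t) = vector_derivative g (at t)"
proof -
  have "(f has_vector_derivative L) (at t) \<longleftrightarrow> (g has_vector_derivative L) (at t)" for L
    using has_vector_derivative_transform_within_open[of f L t S g]
      has_vector_derivative_transform_within_open[of g L t S f] assms by auto
  then show ?thesis by (simp add: vector_derivative_def)
qed

section \<open>Smooth curves\<close>

context smooth_mfd
begin

lemma curve_has_velocity:
  assumes "open I" "smooth_map (open_atlas I) A \<gamma>" "t \<in> I" "c \<in> A" "\<gamma> t \<in> fst c"
  shows "((\<lambda>\<tau>. snd c (\<gamma> \<tau>)) has_vector_derivative velocity A \<gamma> t c) (at t)"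
proof -
  obtain W where W: "open W" "t \<in> W" "W \<subseteq> I" "\<And>\<tau>. \<tau> \<in> W \<Longrightarrow> \<gamma> \<tau> \<in> fst c"
    "smooth_on (\<lambda>\<tau>. snd c (\<gamma> \<tau>)) W" by (rule curve_smooth[OF assms]) (rule that; assumption)
  have "(\<lambda>\<tau>. snd c (\<gamma> \<tau>)) differentiable at t"
    using smooth_on_has_derivative[OF W(5,2)] by (auto simp: differentiable_def)
  then show ?thesis by (simp add: velocity_coord assms(4,5) vector_derivative_works)
qed

lemma velocity_differentiable:
  assumes "open I" "smooth_map (open_atlas I) A \<gamma>" "t \<in> I" "c \<in> A" "\<gamma> t \<in> fst c"
  shows "((\<lambda>\<tau>. velocity A \<gamma> \<tau> c) has_vector_derivative
           vector_derivative (\<lambda>\<tau>. velocity A \<gamma> \<tau> c) (at t)) (at t)"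
proof -
  obtain W where W: "open W" "t \<in> W" "W \<subseteq> I" "\<And>\<tau>. \<tau> \<in> W \<Longrightarrow> \<gamma> \<tau> \<in> fst c"
    "smooth_on (\<lambda>\<tau>. snd c (\<gamma> \<tau>)) W" by (rule curve_smooth[OF assms]) (rule that; assumption)
  have eq: "fderiv (\<lambda>\<tau>. snd c (\<gamma> \<tau>)) \<tau> 1 = velocity A \<gamma> \<tau> c" if "\<tau> \<in> W" for \<tau>
  proof -
    have "(\<lambda>\<tau>. snd c (\<gamma> \<tau>)) differentiable at \<tau>"
      using smooth_on_has_derivative[OF W(5) that] by (auto simp: differentiable_def)
    then show ?thesis by (simp add: velocity_coord assms(4) W(4)[OF that] vector_derivative_fderiv)
  qed
  have "smooth_on (\<lambda>\<tau>. velocity A \<gamma> \<tau> c) W"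
    by (rule smooth_on_cong[OF W(1) smooth_on_fderiv[OF W(5)] eq])
  from smooth_on_has_derivative[OF this W(2)]
  have "(\<lambda>\<tau>. velocity A \<gamma> \<tau> c) differentiable at t" by (auto simp: differentiable_def)
  then show ?thesis by (simp add: vector_derivative_works)
qed

lemma curve_open_preimage:
  assumes I: "open (I :: real set)" and \<gamma>: "smooth_map (open_atlas I) A \<gamma>" and U: "open U"
  shows "open {t\<in>I. \<gamma> t \<in> U}"
proof (rule Topological_Spaces.openI)
  fix t assume "t \<in> {t\<in>I. \<gamma> t \<in> U}"
  then have t: "t \<in> I" "\<gamma> t \<in> U" by auto
  obtain c where c: "c \<in> A" "\<gamma> t \<in> fst c" by (rule chart_at)
  obtain W where W: "open W" "t \<in> W" "W \<subseteq> I" "\<And>\<tau>. \<tau> \<in> W \<Longrightarrow> \<gamma> \<tau> \<in> fst c"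
    "smooth_on (\<lambda>\<tau>. snd c (\<gamma> \<tau>)) W" by (rule curve_smooth[OF I \<gamma> t(1) c]) (rule that; assumption)
  define V where "V = W \<inter> (\<lambda>\<tau>. snd c (\<gamma> \<tau>)) -` (snd c ` (fst c \<inter> U))"
  have "open V" unfolding V_def
    by (rule continuous_open_preimage[OF smooth_on_continuous_on[OF W(5)] W(1) open_chart_image[OF c(1) U]])
  moreover have "t \<in> V" using W t c by (auto simp: V_def)
  moreover have "V \<subseteq> {t\<in>I. \<gamma> t \<in> U}"
    using W(3,4) inj_onD[OF chart_props(5)[OF c(1)]] by (fastforce simp: V_def)
  ultimately show "\<exists>T. open T \<and> t \<in> T \<and> T \<subseteq> {t\<in>I. \<gamma> t \<in> U}" by blast
qed

lemma velocity_affine: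
  assumes I: "open (I :: real set)" and \<gamma>: "smooth_map (open_atlas I) A \<gamma>" and t: "a * t + b \<in> I"
  shows "velocity A (\<lambda>t. \<gamma> (a * t + b)) t = tscale a (velocity A \<gamma> (a * t + b))"
proof
  fix c
  show "velocity A (\<lambda>t. \<gamma> (a * t + b)) t c = tscale a (velocity A \<gamma> (a * t + b)) c"
  proof (cases "c \<in> A \<and> \<gamma> (a * t + b) \<in> fst c")
    case True
    have "((\<lambda>t. a * t + b) has_vector_derivative a) (at t)"
      by (auto intro!: derivative_eq_intros simp: has_vector_derivative_def)
    then have "((\<lambda>\<tau>. snd c (\<gamma> \<tau>)) \<circ> (\<lambda>t. a * t + b) has_vector_derivative
        a *\<^sub>R velocity A \<gamma> (a * t + b) c) (at t)"
      by (rule vector_diff_chain_at) (use True in \<open>auto intro!: curve_has_velocity[OF I \<gamma> t]\<close>)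
    then have "vector_derivative (\<lambda>t. snd c (\<gamma> (a * t + b))) (at t) = a *\<^sub>R velocity A \<gamma> (a * t + b) c"
      by (intro vector_derivative_at) (simp add: o_def)
    then show ?thesis using True by (simp add: velocity_coord tscale_def)
  next
    case False
    then show ?thesis by (auto simp: velocity_def tscale_def)
  qed
qed

lemma velocity_cong:
  assumes "open J" "t \<in> J" "\<And>\<tau>. \<tau> \<in> J \<Longrightarrow> \<gamma> \<tau> = \<gamma>' \<tau>"
  shows "velocity A \<gamma> t = velocity A \<gamma>' t"
proof -
  have "vector_derivative (snd c \<circ> \<gamma>) (at t) = vector_derivative (snd c \<circ> \<gamma>') (at t)" for c :: "('m, 'e) chart"
    by (rule vector_derivative_cong_open[OF assms(1,2)]) (simp add: assms(3))
  then show ?thesis using assms(2,3) by (intro ext) (simp add: velocity_def)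
qed

lemma smooth_curve_affine:
  assumes I: "open (I :: real set)" and \<gamma>: "smooth_map (open_atlas I) A \<gamma>"
  shows "open {t. a * t + b \<in> I}"
    and "smooth_map (open_atlas {t. a * t + b \<in> I}) A (\<lambda>t. \<gamma> (a * t + b))"
proof -
  have op: "open {t. a * t + b \<in> W}" if "open W" for W :: "real set"
  proof -
    have "open ((\<lambda>t. a * t + b) -` W)" by (rule open_vimage[OF that]) (intro continuous_intros)
    then show ?thesis by (simp add: vimage_def)
  qed
  show "open {t. a * t + b \<in> I}" by (rule op[OF I])
  have lin: "smooth_on (\<lambda>t. a * t + b) S" if "open S" for S
    by (intro smooth_on_add[OF that] smooth_on_const[OF that] smooth_on_linear[OF that bounded_linear_mult_right])
  show "smooth_map (open_atlas {t. a * t + b \<in> I}) A (\<lambda>t. \<gamma> (a * t + b))"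
  proof (rule curveI)
    fix t assume "t \<in> {t. a * t + b \<in> I}"
    then have t: "a * t + b \<in> I" by simp
    obtain c where c: "c \<in> A" "\<gamma> (a * t + b) \<in> fst c" by (rule chart_at)
    obtain W where W: "open W" "a * t + b \<in> W" "W \<subseteq> I" "\<And>\<tau>. \<tau> \<in> W \<Longrightarrow> \<gamma> \<tau> \<in> fst c"
      "smooth_on (\<lambda>\<tau>. snd c (\<gamma> \<tau>)) W" by (rule curve_smooth[OF I \<gamma> t c]) (rule that; assumption)
    have "smooth_on (\<lambda>t. snd c (\<gamma> (a * t + b))) {t. a * t + b \<in> W}"
      by (rule smooth_on_compose[OF op[OF W(1)] W(1,5) lin[OF op[OF W(1)]]]) simp
    then show "\<exists>c W. c \<in> A \<and> open W \<and> t \<in> W \<and> W \<subseteq> {t. a * t + b \<in> I} \<and>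
        (\<lambda>t. \<gamma> (a * t + b)) ` W \<subseteq> fst c \<and> smooth_on (\<lambda>t. snd c (\<gamma> (a * t + b))) W"
      using c(1) W op[OF W(1)] by (intro exI[of _ c] exI[of _ "{t. a * t + b \<in> W}"]) auto
  qed
qed

end

section \<open>Christoffel symbols of an affine connection\<close>

lemma tscale_1 [simp]: "tscale 1 v = v"
  by (simp add: tscale_def)

lemma tadd_tscale_0 [simp]: "tadd v (tscale 0 w) = v"
  by (simp add: tscale_def tadd_def)

lemma tadd_apply: "tadd v w c = v c + w c" and tscale_apply: "tscale a v c = a *\<^sub>R v c"
  by (simp_all add: tadd_def tscale_def)

locale affine_mfd = smooth_mfd A for A :: "('m::{t2_space,second_countable_topology}, 'e::{real_inner,heine_borel}) chart set" +
  fixes nabla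
  assumes connection: "affine_connection A nabla"
begin

abbreviation "\<Gamma> \<equiv> christoffel A nabla"

lemma nabla_vf: "X \<in> vector_fields A \<Longrightarrow> Y \<in> vector_fields A \<Longrightarrow> nabla X Y \<in> vector_fields A"
  using connection unfolding affine_connection_def by (elim conjE) simp

lemma nabla_comb:
  assumes "f \<in> smooth_functions A" "g \<in> smooth_functions A"
    "X \<in> vector_fields A" "Y \<in> vector_fields A" "Z \<in> vector_fields A"
  shows "nabla (\<lambda>p. tadd (tscale (f p) (X p)) (tscale (g p) (Y p))) Z p =
           tadd (tscale (f p) (nabla X Z p)) (tscale (g p) (nabla Y Z p))"
proof -
  have "nabla (\<lambda>p. tadd (tscale (f p) (X p)) (tscale (g p) (Y p))) Z =
           (\<lambda>p. tadd (tscale (f p) (nabla X Z p)) (tscale (g p) (nabla Y Z p)))"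
    using connection assms unfolding affine_connection_def by (elim conjE) blast
  then show ?thesis by (rule fun_cong)
qed

lemma nabla_add:
  assumes "X \<in> vector_fields A" "Y \<in> vector_fields A" "Z \<in> vector_fields A"
  shows "nabla X (\<lambda>p. tadd (Y p) (Z p)) p = tadd (nabla X Y p) (nabla X Z p)"
proof -
  have "nabla X (\<lambda>p. tadd (Y p) (Z p)) = (\<lambda>p. tadd (nabla X Y p) (nabla X Z p))"
    using connection assms unfolding affine_connection_def by (elim conjE) blast
  then show ?thesis by (rule fun_cong)
qed

lemma nabla_leibniz:
  assumes "X \<in> vector_fields A" "Y \<in> vector_fields A" "f \<in> smooth_functions A"
  shows "nabla X (\<lambda>p. tscale (f p) (Y p)) p =
           tadd (tscale (f p) (nabla X Y p)) (tscale (vf_apply A X f p) (Y p))"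
proof -
  have "nabla X (\<lambda>p. tscale (f p) (Y p)) =
           (\<lambda>p. tadd (tscale (f p) (nabla X Y p)) (tscale (vf_apply A X f p) (Y p)))"
    using connection assms unfolding affine_connection_def by (elim conjE) blast
  then show ?thesis by (rule fun_cong)
qed

text \<open>
  A connection takes global fields as arguments. Multiplication with a function \<open>h\<close> that is
  supported in \<open>N\<close> and has \<open>h p = 1\<close> makes fields equal that agree on
  \<open>N\<close>. In the first argument \<open>h\<close> can be pulled out; in the second, the Leibniz
  rule adds \<open>X(h) Y\<close>, which at \<open>p\<close> is the same for both fields.
\<close>

lemma nabla_local:
  assumes vf: "X \<in> vector_fields A" "X' \<in> vector_fields A" "Y \<in> vector_fields A" "Y' \<in> vector_fields A"
    and N: "open N" "p \<in> N" and eq: "\<And>q. q \<in> N \<Longrightarrow> X q = X' q" "\<And>q. q \<in> N \<Longrightarrow> Y q = Y' q"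
  shows "nabla X Y p = nabla X' Y' p"
proof -
  obtain h where h: "h \<in> smooth_functions A" "h p = 1" "\<And>q. q \<notin> N \<Longrightarrow> h q = 0"
    using bump_on_manifold[OF N] by metis
  have sc: "tscale (h q) (X q) = tscale (h q) (X' q)" "tscale (h q) (Y q) = tscale (h q) (Y' q)" for q
    using eq h(3) by (cases "q \<in> N"; simp add: tscale_def)+
  have "nabla X Y p = nabla X' Y p"
    using nabla_comb[OF h(1) sf_const[of 0] vf(1,1,3), of p] nabla_comb[OF h(1) sf_const[of 0] vf(2,1,3), of p]
    by (simp add: sc h(2))
  moreover have "tadd (nabla X' Y p) (tscale (vf_apply A X' h p) (Y p)) =
      tadd (nabla X' Y' p) (tscale (vf_apply A X' h p) (Y p))"
    using nabla_leibniz[OF vf(2,3) h(1), of p] nabla_leibniz[OF vf(2,4) h(1), of p] eq(2)[OF N(2)]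
    by (simp add: sc h(2))
  then have "nabla X' Y p = nabla X' Y' p"
    by (simp add: tadd_def fun_eq_iff)
  ultimately show ?thesis by simp
qed

text \<open>
  The definite description in \<open>christoffel\<close> is unique by locality: any two fields with the
  same constant component near \<open>p\<close> agree near \<open>p\<close>.
\<close>

lemma christoffel_eq:
  assumes c: "c \<in> A" "p \<in> fst c" and U: "U \<in> vector_fields A" "coordinate_constant_near c p u U"
    and W: "W \<in> vector_fields A" "coordinate_constant_near c p w W"
  shows "\<Gamma> c p u w = nabla U W p c"
  unfolding christoffel_def
proof (rule the_equality)
  show "\<exists>U'\<in>vector_fields A. \<exists>W'\<in>vector_fields A. coordinate_constant_near c p u U' \<and>
      coordinate_constant_near c p w W' \<and> nabla U W p c = nabla U' W' p c"
    using U W by blast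
  fix z assume "\<exists>U\<in>vector_fields A. \<exists>W\<in>vector_fields A. coordinate_constant_near c p u U \<and>
      coordinate_constant_near c p w W \<and> z = nabla U W p c"
  then obtain U' W' where U': "U' \<in> vector_fields A" "coordinate_constant_near c p u U'"
    and W': "W' \<in> vector_fields A" "coordinate_constant_near c p w W'" and z: "z = nabla U' W' p c"
    by blast
  obtain N1 where N1: "open N1" "p \<in> N1" "N1 \<subseteq> fst c" "\<forall>q\<in>N1. U q c = u"
    using U(2) unfolding coordinate_constant_near_def by blast
  obtain N2 where N2: "open N2" "p \<in> N2" "\<forall>q\<in>N2. W q c = w"
    using W(2) unfolding coordinate_constant_near_def by blast
  obtain N3 where N3: "open N3" "p \<in> N3" "\<forall>q\<in>N3. U' q c = u"
    using U'(2) unfolding coordinate_constant_near_def by blast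
  obtain N4 where N4: "open N4" "p \<in> N4" "\<forall>q\<in>N4. W' q c = w"
    using W'(2) unfolding coordinate_constant_near_def by blast
  define N where "N = N1 \<inter> N2 \<inter> N3 \<inter> N4"
  have "nabla U' W' p = nabla U W p"
  proof (rule nabla_local[OF U'(1) U(1) W'(1) W(1)])
    show "open N" "p \<in> N" using N1 N2 N3 N4 by (auto simp: N_def)
    fix q assume "q \<in> N"
    then have q: "q \<in> fst c" "U q c = u" "U' q c = u" "W q c = w" "W' q c = w"
      using N1 N2 N3 N4 by (auto simp: N_def)
    show "U' q = U q" by (rule tangent_eqI[OF vf_tangent[OF U'(1)] vf_tangent[OF U(1)] c(1) q(1)]) (simp add: q)
    show "W' q = W q" by (rule tangent_eqI[OF vf_tangent[OF W'(1)] vf_tangent[OF W(1)] c(1) q(1)]) (simp add: q)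
  qed
  then show "z = nabla U W p c" by (simp add: z)
qed

lemma christoffel_on:
  assumes c: "c \<in> A" and N: "open N" "N \<subseteq> fst c" "p \<in> N"
    and U: "U \<in> vector_fields A" "\<And>q. q \<in> N \<Longrightarrow> U q c = u"
    and W: "W \<in> vector_fields A" "\<And>q. q \<in> N \<Longrightarrow> W q c = w"
  shows "\<Gamma> c p u w = nabla U W p c"
proof (rule christoffel_eq[OF c _ U(1) _ W(1)])
  show "p \<in> fst c" using N by auto
  show "coordinate_constant_near c p u U" "coordinate_constant_near c p w W"
    unfolding coordinate_constant_near_def using N U W by blast+
qed

lemma christoffel_linear_left:
  assumes c: "c \<in> A" "p \<in> fst c"
  shows "linear (\<lambda>u. \<Gamma> c p u w)"
proof -
  obtain N where N: "open N" "p \<in> N" "N \<subseteq> fst c"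
    and ex: "\<And>u. \<exists>U\<in>vector_fields A. \<forall>q\<in>N. U q c = u"
    using coordinate_fields[OF c] by metis
  obtain W where W: "W \<in> vector_fields A" "\<And>q. q \<in> N \<Longrightarrow> W q c = w" using ex by metis
  have comb: "\<Gamma> c p (a *\<^sub>R u + b *\<^sub>R v) w = a *\<^sub>R \<Gamma> c p u w + b *\<^sub>R \<Gamma> c p v w" for a b u v
  proof -
    obtain U where U: "U \<in> vector_fields A" "\<And>q. q \<in> N \<Longrightarrow> U q c = u" using ex by metis
    obtain V where V: "V \<in> vector_fields A" "\<And>q. q \<in> N \<Longrightarrow> V q c = v" using ex by metis
    have "\<Gamma> c p (a *\<^sub>R u + b *\<^sub>R v) w = nabla (\<lambda>p. tadd (tscale a (U p)) (tscale b (V p))) W p c"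
      by (rule christoffel_on[OF c(1) N(1,3,2) vf_comb[OF sf_const sf_const U(1) V(1)] _ W])
         (simp add: U V tadd_apply tscale_apply)
    also have "\<dots> = a *\<^sub>R nabla U W p c + b *\<^sub>R nabla V W p c"
      by (simp add: nabla_comb[OF sf_const sf_const U(1) V(1) W(1)] tadd_apply tscale_apply)
    also have "\<dots> = a *\<^sub>R \<Gamma> c p u w + b *\<^sub>R \<Gamma> c p v w"
      by (simp add: christoffel_on[OF c(1) N(1,3,2) U W] christoffel_on[OF c(1) N(1,3,2) V W])
    finally show ?thesis .
  qed
  show ?thesis using comb[of 1 _ 1] comb[of _ _ 0 0] by (intro linearI) auto
qed

lemma christoffel_linear_right:
  assumes c: "c \<in> A" "p \<in> fst c"
  shows "linear (\<Gamma> c p u)"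
proof -
  obtain N where N: "open N" "p \<in> N" "N \<subseteq> fst c"
    and ex: "\<And>u. \<exists>U\<in>vector_fields A. \<forall>q\<in>N. U q c = u"
    using coordinate_fields[OF c] by metis
  obtain U where U: "U \<in> vector_fields A" "\<And>q. q \<in> N \<Longrightarrow> U q c = u" using ex by metis
  show ?thesis
  proof (rule linearI)
    fix v w
    obtain V where V: "V \<in> vector_fields A" "\<And>q. q \<in> N \<Longrightarrow> V q c = v" using ex by metis
    obtain W where W: "W \<in> vector_fields A" "\<And>q. q \<in> N \<Longrightarrow> W q c = w" using ex by metis
    have "(\<lambda>p. tadd (V p) (W p)) \<in> vector_fields A"
      using vf_comb[OF sf_const[of 1] sf_const[of 1] V(1) W(1)] by simp
    then have "\<Gamma> c p u (v + w) = nabla U (\<lambda>p. tadd (V p) (W p)) p c"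
      by (intro christoffel_on[OF c(1) N(1,3,2) U]) (simp_all add: V W tadd_apply)
    then show "\<Gamma> c p u (v + w) = \<Gamma> c p u v + \<Gamma> c p u w"
      by (simp add: nabla_add[OF U(1) V(1) W(1)] tadd_apply
          christoffel_on[OF c(1) N(1,3,2) U V] christoffel_on[OF c(1) N(1,3,2) U W])
    fix a
    have "(\<lambda>p. tscale a (V p)) \<in> vector_fields A"
      using vf_comb[OF sf_const[of a] sf_const[of 0] V(1) V(1)] by simp
    then have "\<Gamma> c p u (a *\<^sub>R v) = nabla U (\<lambda>p. tscale a (V p)) p c"
      by (intro christoffel_on[OF c(1) N(1,3,2) U]) (simp_all add: V tscale_apply)
    moreover have "vf_apply A U (\<lambda>p. a) p = 0"
      by (simp add: vf_apply_coord[OF sf_const U(1) c] fderiv_eq[OF has_derivative_const])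
    ultimately show "\<Gamma> c p u (a *\<^sub>R v) = a *\<^sub>R \<Gamma> c p u v"
      by (simp add: nabla_leibniz[OF U(1) V(1) sf_const] tscale_apply
          christoffel_on[OF c(1) N(1,3,2) U V])
  qed
qed

text \<open>
  Near a given point, the symbol is a component of the single smooth field
  \<open>\<nabla>\<^bsub>U\<^esub> W\<close> for coordinate fields \<open>U\<close> and \<open>W\<close>.
\<close>

lemma christoffel_smooth:
  assumes c: "c \<in> A"
  shows "smooth_on (\<lambda>x. \<Gamma> c (chart_inv c x) u w) (snd c ` fst c)"
proof (rule smooth_on_local)
  fix x assume "x \<in> snd c ` fst c"
  then obtain p where p: "p \<in> fst c" "x = snd c p" by auto
  obtain N where N: "open N" "p \<in> N" "N \<subseteq> fst c"
    and ex: "\<And>u. \<exists>U\<in>vector_fields A. \<forall>q\<in>N. U q c = u"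
    using coordinate_fields[OF c p(1)] by metis
  obtain U where U: "U \<in> vector_fields A" "\<And>q. q \<in> N \<Longrightarrow> U q c = u" using ex by metis
  obtain W where W: "W \<in> vector_fields A" "\<And>q. q \<in> N \<Longrightarrow> W q c = w" using ex by metis
  have o: "open (snd c ` (fst c \<inter> N))" by (rule open_chart_image[OF c N(1)])
  have "smooth_on (\<lambda>x. nabla U W (chart_inv c x) c) (snd c ` (fst c \<inter> N))"
    by (rule smooth_on_subset[OF vf_smooth[OF nabla_vf[OF U(1) W(1)] c]]) auto
  then have "smooth_on (\<lambda>x. \<Gamma> c (chart_inv c x) u w) (snd c ` (fst c \<inter> N))"
    by (rule smooth_on_cong[OF o]) (use c christoffel_on[OF c N(1,3) _ U W] in auto)
  then show "\<exists>V. open V \<and> x \<in> V \<and> smooth_on (\<lambda>x. \<Gamma> c (chart_inv c x) u w) V"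
    using o p N by (intro exI[of _ "snd c ` (fst c \<inter> N)"]) auto
qed

text \<open>
  Bilinearity reduces joint smoothness in point and vector to the symbols of frame vectors. The
  Lipschitz condition for the geodesic equation needs the joint statement.
\<close>

lemma christoffel_joint_smooth:
  assumes c: "c \<in> A"
  shows "smooth_on (\<lambda>z. \<Gamma> c (chart_inv c (fst z)) (snd z) (snd z)) ((snd c ` fst c) \<times> UNIV)"
    (is "smooth_on _ ?S")
proof -
  have o: "open ?S" by (intro open_Times chart_props c open_UNIV)
  have "smooth_on (\<lambda>z. \<Sum>b\<in>frame. (snd z \<bullet> b) *\<^sub>R (\<Sum>b'\<in>frame. (snd z \<bullet> b') *\<^sub>R \<Gamma> c (chart_inv c (fst z)) b b')) ?S"
  proof (intro smooth_on_sum[OF o] smooth_on_scaleR[OF o])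
    show "smooth_on (\<lambda>z. snd z \<bullet> b) ?S" for b
      by (intro smooth_on_linear_comp[OF o bounded_linear_inner_left] smooth_on_linear[OF o bounded_linear_snd])
    then show "smooth_on (\<lambda>z. snd z \<bullet> b) ?S" for b .
    show "smooth_on (\<lambda>z. \<Gamma> c (chart_inv c (fst z)) b b') ?S" for b b'
      by (rule smooth_on_compose[OF o chart_props(2)[OF c] christoffel_smooth[OF c]
            smooth_on_linear[OF o bounded_linear_fst]]) auto
  qed
  then show ?thesis
  proof (rule smooth_on_cong[OF o])
    fix z :: "'e \<times> 'e" assume "z \<in> ?S"
    then have q: "chart_inv c (fst z) \<in> fst c" by (auto intro: chart_inv_in)
    show "(\<Sum>b\<in>frame. (snd z \<bullet> b) *\<^sub>R (\<Sum>b'\<in>frame. (snd z \<bullet> b') *\<^sub>R \<Gamma> c (chart_inv c (fst z)) b b')) =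
        \<Gamma> c (chart_inv c (fst z)) (snd z) (snd z)"
      unfolding linear_frame_expand[OF christoffel_linear_right[OF c q], symmetric]
        linear_frame_expand[OF christoffel_linear_left[OF c q], symmetric] by (rule refl)
  qed
qed

section \<open>Geodesics\<close>

lemma geodesic_onD:
  assumes "geodesic_on A nabla I \<gamma>"
  shows "open I" "is_interval I" "smooth_map (open_atlas I) A \<gamma>"
    "t \<in> I \<Longrightarrow> covariant_derivative_along A nabla \<gamma> (velocity A \<gamma>) t = tzero"
  using assms by (auto simp: geodesic_on_def)

lemma covariant_derivative_zero_iff:
  "covariant_derivative_along A nabla \<gamma> V t = tzero \<longleftrightarrow>
     (\<forall>c\<in>A. \<gamma> t \<in> fst c \<longrightarrow>
        vector_derivative (\<lambda>\<tau>. V \<tau> c) (at t) = - \<Gamma> c (\<gamma> t) (velocity A \<gamma> t c) (V t c))"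
  unfolding covariant_derivative_along_def tzero_def fun_eq_iff eq_neg_iff_add_eq_0
  by meson

lemma geodesic_coord:
  assumes \<gamma>: "geodesic_on A nabla I \<gamma>" and t: "t \<in> I" and c: "c \<in> A" "\<gamma> t \<in> fst c"
  shows "((\<lambda>\<tau>. (snd c (\<gamma> \<tau>), velocity A \<gamma> \<tau> c)) has_vector_derivative
           (velocity A \<gamma> t c, - \<Gamma> c (\<gamma> t) (velocity A \<gamma> t c) (velocity A \<gamma> t c))) (at t)"
proof (rule has_vector_derivative_Pair)
  note g = geodesic_onD[OF \<gamma>]
  show "((\<lambda>\<tau>. snd c (\<gamma> \<tau>)) has_vector_derivative velocity A \<gamma> t c) (at t)"
    by (rule curve_has_velocity[OF g(1,3) t c])
  show "((\<lambda>\<tau>. velocity A \<gamma> \<tau> c) has_vector_derivative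
      - \<Gamma> c (\<gamma> t) (velocity A \<gamma> t c) (velocity A \<gamma> t c)) (at t)"
    using velocity_differentiable[OF g(1,3) t c] g(4)[OF t] c
    unfolding covariant_derivative_zero_iff by simp
qed

text \<open>
  In a chart the geodesic equation is the first order equation \<open>z' = F z\<close> for position and
  velocity, with the smooth right-hand side \<open>F (x, u) = (u, - \<Gamma>\<^sub>x(u, u))\<close>.
\<close>

lemma geodesic_unique_local:
  assumes \<gamma>1: "geodesic_on A nabla I\<^sub>1 \<gamma>\<^sub>1" and \<gamma>2: "geodesic_on A nabla I\<^sub>2 \<gamma>\<^sub>2"
    and t: "t\<^sub>0 \<in> I\<^sub>1" "t\<^sub>0 \<in> I\<^sub>2"
    and init: "lifted_velocity A \<gamma>\<^sub>1 t\<^sub>0 = lifted_velocity A \<gamma>\<^sub>2 t\<^sub>0"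
  obtains e where "e > 0" "\<And>t. t \<in> ball t\<^sub>0 e \<Longrightarrow> lifted_velocity A \<gamma>\<^sub>1 t = lifted_velocity A \<gamma>\<^sub>2 t"
proof -
  note g1 = geodesic_onD[OF \<gamma>1] and g2 = geodesic_onD[OF \<gamma>2]
  obtain c where c: "c \<in> A" "\<gamma>\<^sub>1 t\<^sub>0 \<in> fst c" by (rule chart_at)
  have init': "\<gamma>\<^sub>2 t\<^sub>0 = \<gamma>\<^sub>1 t\<^sub>0" "velocity A \<gamma>\<^sub>2 t\<^sub>0 = velocity A \<gamma>\<^sub>1 t\<^sub>0"
    using init by (auto simp: lifted_velocity_def)
  define z where "z \<gamma> t = (snd c (\<gamma> t), velocity A \<gamma> t c)" for \<gamma> t
  define S where "S = (snd c ` fst c) \<times> (UNIV :: 'e set)"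
  define F where "F x = (snd x, - \<Gamma> c (chart_inv c (fst x)) (snd x) (snd x))" for x
  have oS: "open S" unfolding S_def by (intro open_Times chart_props c open_UNIV)
  have "smooth_on F S" unfolding F_def
    by (rule smooth_on_Pair[OF oS smooth_on_linear[OF oS bounded_linear_snd] smooth_on_minus[OF oS]])
       (use christoffel_joint_smooth[OF c(1)] in \<open>simp add: S_def\<close>)
  moreover have "z \<gamma>\<^sub>1 t\<^sub>0 \<in> S" using c by (auto simp: z_def S_def)
  ultimately obtain d L where d: "d > 0" "ball (z \<gamma>\<^sub>1 t\<^sub>0) d \<subseteq> S"
    and lip: "\<And>x y. x \<in> ball (z \<gamma>\<^sub>1 t\<^sub>0) d \<Longrightarrow> y \<in> ball (z \<gamma>\<^sub>1 t\<^sub>0) d \<Longrightarrow> norm (F x - F y) \<le> L * norm (x - y)"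
    using smooth_on_locally_lipschitz[OF oS] by metis
  have zd: "(z \<gamma> has_vector_derivative F (z \<gamma> t)) (at t)"
    if "geodesic_on A nabla I \<gamma>" "t \<in> I" "\<gamma> t \<in> fst c" for \<gamma> I t
    using geodesic_coord[OF that(1,2) c(1) that(3)] c(1) that(3) unfolding z_def[abs_def] F_def by simp
  have near: "\<forall>\<^sub>F t in nhds t\<^sub>0. t \<in> I \<and> \<gamma> t \<in> fst c \<and> z \<gamma> t \<in> ball (z \<gamma>\<^sub>1 t\<^sub>0) d"
    if g: "geodesic_on A nabla I \<gamma>" "t\<^sub>0 \<in> I" "\<gamma> t\<^sub>0 = \<gamma>\<^sub>1 t\<^sub>0" "z \<gamma> t\<^sub>0 = z \<gamma>\<^sub>1 t\<^sub>0" for \<gamma> I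
  proof -
    have "open {t\<in>I. \<gamma> t \<in> fst c}"
      by (rule curve_open_preimage[OF geodesic_onD(1,3)[OF g(1)] chart_props(1)[OF c(1)]])
    then have "\<forall>\<^sub>F t in nhds t\<^sub>0. t \<in> {t\<in>I. \<gamma> t \<in> fst c}"
      by (rule eventually_nhds_in_open) (use g c in auto)
    moreover have "isCont (z \<gamma>) t\<^sub>0"
      using has_vector_derivative_continuous[OF zd[OF g(1,2)]] g(3) c by simp
    then have "\<forall>\<^sub>F t in nhds t\<^sub>0. z \<gamma> t \<in> ball (z \<gamma>\<^sub>1 t\<^sub>0) d"
      unfolding isCont_def tendsto_at_iff_tendsto_nhds
      by (rule topological_tendstoD) (use d g(4) in auto)
    ultimately show ?thesis by eventually_elim auto
  qed
  have "\<forall>\<^sub>F t in nhds t\<^sub>0. (t \<in> I\<^sub>1 \<and> \<gamma>\<^sub>1 t \<in> fst c \<and> z \<gamma>\<^sub>1 t \<in> ball (z \<gamma>\<^sub>1 t\<^sub>0) d) \<and>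
      (t \<in> I\<^sub>2 \<and> \<gamma>\<^sub>2 t \<in> fst c \<and> z \<gamma>\<^sub>2 t \<in> ball (z \<gamma>\<^sub>1 t\<^sub>0) d)"
    by (intro eventually_conj near[OF \<gamma>1 t(1)] near[OF \<gamma>2 t(2)]) (simp_all add: init' z_def)
  then obtain e where e: "e > 0" and ev: "\<And>t. dist t t\<^sub>0 < e \<Longrightarrow>
      (t \<in> I\<^sub>1 \<and> \<gamma>\<^sub>1 t \<in> fst c \<and> z \<gamma>\<^sub>1 t \<in> ball (z \<gamma>\<^sub>1 t\<^sub>0) d) \<and>
      (t \<in> I\<^sub>2 \<and> \<gamma>\<^sub>2 t \<in> fst c \<and> z \<gamma>\<^sub>2 t \<in> ball (z \<gamma>\<^sub>1 t\<^sub>0) d)"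
    unfolding eventually_nhds_metric by blast
  have ev': "t \<in> I\<^sub>1" "\<gamma>\<^sub>1 t \<in> fst c" "z \<gamma>\<^sub>1 t \<in> ball (z \<gamma>\<^sub>1 t\<^sub>0) d"
    "t \<in> I\<^sub>2" "\<gamma>\<^sub>2 t \<in> fst c" "z \<gamma>\<^sub>2 t \<in> ball (z \<gamma>\<^sub>1 t\<^sub>0) d" if "t \<in> ball t\<^sub>0 e" for t
    using ev[of t] that by (simp_all add: dist_commute)
  show ?thesis
  proof (rule that[OF e])
    fix t assume t': "t \<in> ball t\<^sub>0 e"
    have "z \<gamma>\<^sub>1 t = z \<gamma>\<^sub>2 t"
    proof (rule ode_unique[where F = F and L = L and z\<^sub>1 = "z \<gamma>\<^sub>1" and z\<^sub>2 = "z \<gamma>\<^sub>2", OF _ _ _ _ t'])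
      show "(z \<gamma>\<^sub>1 has_vector_derivative F (z \<gamma>\<^sub>1 t)) (at t)" if "t \<in> ball t\<^sub>0 e" for t
        by (rule zd[OF \<gamma>1 ev'(1,2)[OF that]])
      show "(z \<gamma>\<^sub>2 has_vector_derivative F (z \<gamma>\<^sub>2 t)) (at t)" if "t \<in> ball t\<^sub>0 e" for t
        by (rule zd[OF \<gamma>2 ev'(4,5)[OF that]])
      show "norm (F (z \<gamma>\<^sub>1 t) - F (z \<gamma>\<^sub>2 t)) \<le> L * norm (z \<gamma>\<^sub>1 t - z \<gamma>\<^sub>2 t)" if "t \<in> ball t\<^sub>0 e" for t
        by (rule lip[OF ev'(3,6)[OF that]])
      show "z \<gamma>\<^sub>1 t\<^sub>0 = z \<gamma>\<^sub>2 t\<^sub>0" by (simp add: z_def init')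
    qed
    then have eq: "snd c (\<gamma>\<^sub>1 t) = snd c (\<gamma>\<^sub>2 t)" "velocity A \<gamma>\<^sub>1 t c = velocity A \<gamma>\<^sub>2 t c" by (simp_all add: z_def)
    have p: "\<gamma>\<^sub>1 t = \<gamma>\<^sub>2 t"
      by (rule inj_onD[OF chart_props(5)[OF c(1)] eq(1) ev'(2)[OF t'] ev'(5)[OF t']])
    have "velocity A \<gamma>\<^sub>1 t = velocity A \<gamma>\<^sub>2 t"
      by (rule tangent_eqI[of "velocity A \<gamma>\<^sub>1 t" "\<gamma>\<^sub>1 t" "velocity A \<gamma>\<^sub>2 t" c])
         (use velocity_tangent[OF g1(1,3) ev'(1)[OF t']] velocity_tangent[OF g2(1,3) ev'(4)[OF t']]
            p c(1) ev'(2)[OF t'] eq(2) in simp_all)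
    with p show "lifted_velocity A \<gamma>\<^sub>1 t = lifted_velocity A \<gamma>\<^sub>2 t" by (simp add: lifted_velocity_def)
  qed
qed

text \<open>
  The times at which position and velocity agree form an open set by local uniqueness. The complement
  is open too: different positions are separated by the Hausdorff property, different velocities at
  a common position by continuity in a chart. The common interval is connected.
\<close>

theorem geodesic_unique:
  assumes \<gamma>1: "geodesic_on A nabla I\<^sub>1 \<gamma>\<^sub>1" and \<gamma>2: "geodesic_on A nabla I\<^sub>2 \<gamma>\<^sub>2"
    and t: "t\<^sub>0 \<in> I\<^sub>1" "t\<^sub>0 \<in> I\<^sub>2"
    and init: "lifted_velocity A \<gamma>\<^sub>1 t\<^sub>0 = lifted_velocity A \<gamma>\<^sub>2 t\<^sub>0"
    and t1: "t\<^sub>1 \<in> I\<^sub>1" "t\<^sub>1 \<in> I\<^sub>2"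
  shows "lifted_velocity A \<gamma>\<^sub>1 t\<^sub>1 = lifted_velocity A \<gamma>\<^sub>2 t\<^sub>1"
proof -
  note g1 = geodesic_onD[OF \<gamma>1] and g2 = geodesic_onD[OF \<gamma>2]
  define J where "J = I\<^sub>1 \<inter> I\<^sub>2"
  define S where "S = {t\<in>J. lifted_velocity A \<gamma>\<^sub>1 t = lifted_velocity A \<gamma>\<^sub>2 t}"
  have oJ: "open J" using g1(1) g2(1) by (auto simp: J_def)
  have "connected J" unfolding J_def
    by (intro is_interval_connected is_interval_Int g1(2) g2(2))
  moreover have "open S"
  proof (rule Topological_Spaces.openI)
    fix t assume "t \<in> S"
    then have t: "t \<in> J" "t \<in> I\<^sub>1" "t \<in> I\<^sub>2" "lifted_velocity A \<gamma>\<^sub>1 t = lifted_velocity A \<gamma>\<^sub>2 t" by (auto simp: S_def J_def)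
    obtain e where e: "e > 0" "\<And>s. s \<in> ball t e \<Longrightarrow> lifted_velocity A \<gamma>\<^sub>1 s = lifted_velocity A \<gamma>\<^sub>2 s"
      using geodesic_unique_local[OF \<gamma>1 \<gamma>2 t(2-4)] by metis
    show "\<exists>T. open T \<and> t \<in> T \<and> T \<subseteq> S"
      by (rule exI[of _ "J \<inter> ball t e"]) (use e t oJ in \<open>auto simp: S_def\<close>)
  qed
  moreover have "open (J - S)"
  proof (rule Topological_Spaces.openI)
    fix t assume "t \<in> J - S"
    then have t: "t \<in> J" "t \<in> I\<^sub>1" "t \<in> I\<^sub>2" "lifted_velocity A \<gamma>\<^sub>1 t \<noteq> lifted_velocity A \<gamma>\<^sub>2 t" by (auto simp: S_def J_def)
    show "\<exists>T. open T \<and> t \<in> T \<and> T \<subseteq> J - S"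
    proof (cases "\<gamma>\<^sub>1 t = \<gamma>\<^sub>2 t")
      case False
      then obtain U V where UV: "open U" "open V" "\<gamma>\<^sub>1 t \<in> U" "\<gamma>\<^sub>2 t \<in> V" "U \<inter> V = {}"
        using hausdorff by metis
      have "open ({t\<in>I\<^sub>1. \<gamma>\<^sub>1 t \<in> U} \<inter> {t\<in>I\<^sub>2. \<gamma>\<^sub>2 t \<in> V})"
        by (intro open_Int curve_open_preimage g1 g2 UV)
      moreover have "{t\<in>I\<^sub>1. \<gamma>\<^sub>1 t \<in> U} \<inter> {t\<in>I\<^sub>2. \<gamma>\<^sub>2 t \<in> V} \<subseteq> J - S"
        using UV(5) by (auto simp: J_def S_def lifted_velocity_def)
      ultimately show ?thesis using t UV by blast
    next
      case True
      obtain c where c: "c \<in> A" "\<gamma>\<^sub>1 t \<in> fst c" by (rule chart_at)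
      have c2: "\<gamma>\<^sub>2 t \<in> fst c" using c True by simp
      define D where "D s = velocity A \<gamma>\<^sub>1 s c - velocity A \<gamma>\<^sub>2 s c" for s
      have ne: "velocity A \<gamma>\<^sub>1 t c \<noteq> velocity A \<gamma>\<^sub>2 t c"
        using tangent_eqI[OF velocity_tangent[OF g1(1,3) t(2)] _ c, of "velocity A \<gamma>\<^sub>2 t"]
          velocity_tangent[OF g2(1,3) t(3)] True t(4) by (auto simp: lifted_velocity_def)
      have "isCont D t"
        unfolding D_def using has_vector_derivative_continuous[OF velocity_differentiable[OF g1(1,3) t(2) c]]
          has_vector_derivative_continuous[OF velocity_differentiable[OF g2(1,3) t(3) c(1) c2]]
        by (rule continuous_diff)
      then have "\<forall>\<^sub>F s in nhds t. D s \<in> - {0}"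
        unfolding isCont_def tendsto_at_iff_tendsto_nhds
        by (rule topological_tendstoD) (use ne in \<open>auto simp: D_def\<close>)
      moreover have "\<forall>\<^sub>F s in nhds t. s \<in> J" by (rule eventually_nhds_in_open[OF oJ t(1)])
      ultimately have "\<forall>\<^sub>F s in nhds t. s \<in> J - S"
        by eventually_elim (auto simp: S_def D_def lifted_velocity_def)
      then show ?thesis unfolding eventually_nhds by blast
    qed
  qed
  ultimately have "S \<inter> J = {} \<or> (J - S) \<inter> J = {}"
    by (intro connectedD) auto
  moreover have "t\<^sub>0 \<in> S \<inter> J" using t init by (auto simp: S_def J_def)
  ultimately have "t\<^sub>1 \<in> S" using t1 by (auto simp: J_def)
  then show ?thesis by (simp add: S_def)
qed

text \<open>
  The second derivative and the quadratic term of the geodesic equation both acquire the factor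
  \<open>a\<^sup>2\<close>. The cases of interest are shifts (\<open>a = 1\<close>), reversal
  (\<open>a = - 1\<close>), and rescaling of the initial velocity, including \<open>a = 0\<close>.
\<close>

lemma covariant_derivative_affine:
  assumes I: "open I" and \<gamma>: "smooth_map (open_atlas I) A \<gamma>" and t: "a * t + b \<in> I"
    and zero: "covariant_derivative_along A nabla \<gamma> (velocity A \<gamma>) (a * t + b) = tzero"
  shows "covariant_derivative_along A nabla (\<lambda>t. \<gamma> (a * t + b)) (velocity A (\<lambda>t. \<gamma> (a * t + b))) t = tzero"
  unfolding covariant_derivative_zero_iff
proof (intro ballI impI)
  fix c assume c: "c \<in> A" "\<gamma> (a * t + b) \<in> fst c"
  note o = smooth_curve_affine(1)[OF I \<gamma>, of a b]
  let ?s = "a * t + b" and ?\<delta> = "\<lambda>t. \<gamma> (a * t + b)"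
  have v: "velocity A ?\<delta> s c = a *\<^sub>R velocity A \<gamma> (a * s + b) c" if "s \<in> {t. a * t + b \<in> I}" for s
    using velocity_affine[OF I \<gamma>, of a s b] that by (simp add: tscale_apply)
  have "((\<lambda>t. a * t + b) has_vector_derivative a) (at t)"
    by (auto intro!: derivative_eq_intros simp: has_vector_derivative_def)
  then have "((\<lambda>\<tau>. velocity A \<gamma> \<tau> c) \<circ> (\<lambda>t. a * t + b) has_vector_derivative
      a *\<^sub>R vector_derivative (\<lambda>\<tau>. velocity A \<gamma> \<tau> c) (at ?s)) (at t)"
    by (rule vector_diff_chain_at) (rule velocity_differentiable[OF I \<gamma> t c])
  then have "((\<lambda>s. a *\<^sub>R velocity A \<gamma> (a * s + b) c) has_vector_derivative
      a *\<^sub>R a *\<^sub>R vector_derivative (\<lambda>\<tau>. velocity A \<gamma> \<tau> c) (at ?s)) (at t)"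
    by (intro bounded_linear.has_vector_derivative[OF bounded_linear_scaleR_right]) (simp add: o_def)
  then have "((\<lambda>s. velocity A ?\<delta> s c) has_vector_derivative
      a *\<^sub>R a *\<^sub>R vector_derivative (\<lambda>\<tau>. velocity A \<gamma> \<tau> c) (at ?s)) (at t)"
  proof (rule has_vector_derivative_transform_within_open[OF _ o])
    show "t \<in> {t. a * t + b \<in> I}" using t by simp
    show "a *\<^sub>R velocity A \<gamma> (a * s + b) c = velocity A ?\<delta> s c" if "s \<in> {t. a * t + b \<in> I}" for s
      by (rule v[OF that, symmetric])
  qed
  then have "vector_derivative (\<lambda>s. velocity A ?\<delta> s c) (at t) =
      a *\<^sub>R a *\<^sub>R vector_derivative (\<lambda>\<tau>. velocity A \<gamma> \<tau> c) (at ?s)"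
    by (rule vector_derivative_at)
  also have "\<dots> = a *\<^sub>R a *\<^sub>R - \<Gamma> c (?\<delta> t) (velocity A \<gamma> ?s c) (velocity A \<gamma> ?s c)"
    using zero c unfolding covariant_derivative_zero_iff by simp
  also have "\<dots> = - \<Gamma> c (?\<delta> t) (a *\<^sub>R velocity A \<gamma> ?s c) (a *\<^sub>R velocity A \<gamma> ?s c)"
    by (simp add: linear_cmul[OF christoffel_linear_left[OF c]] linear_cmul[OF christoffel_linear_right[OF c]])
  finally show "vector_derivative (\<lambda>s. velocity A ?\<delta> s c) (at t) =
      - \<Gamma> c (?\<delta> t) (velocity A ?\<delta> t c) (velocity A ?\<delta> t c)"
    using v[of t] t by simp
qed

lemma geodesic_affine:
  assumes \<gamma>: "geodesic_on A nabla I \<gamma>"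
  shows "geodesic_on A nabla {t. a * t + b \<in> I} (\<lambda>t. \<gamma> (a * t + b))"
proof -
  note g = geodesic_onD[OF \<gamma>]
  have "is_interval {t. a * t + b \<in> I}"
    unfolding is_interval_1
  proof (intro ballI allI impI)
    fix x y z assume xy: "x \<in> {t. a * t + b \<in> I}" "y \<in> {t. a * t + b \<in> I}" and z: "x \<le> z \<and> z \<le> y"
    have "(a * x + b \<le> a * z + b \<and> a * z + b \<le> a * y + b) \<or> (a * y + b \<le> a * z + b \<and> a * z + b \<le> a * x + b)"
      using z by (cases "a \<ge> 0") (auto intro: mult_left_mono mult_left_mono_neg)
    then show "z \<in> {t. a * t + b \<in> I}"
      using g(2) xy unfolding is_interval_1 by blast
  qed
  then show ?thesis
    unfolding geodesic_on_def
    using smooth_curve_affine[OF g(1,3), of a b] covariant_derivative_affine[OF g(1,3) _ g(4)] by blast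
qed

lemma covariant_derivative_cong:
  assumes "open J" "t \<in> J" "\<And>\<tau>. \<tau> \<in> J \<Longrightarrow> \<gamma> \<tau> = \<gamma>' \<tau>"
  shows "covariant_derivative_along A nabla \<gamma> (velocity A \<gamma>) t =
           covariant_derivative_along A nabla \<gamma>' (velocity A \<gamma>') t"
proof -
  note v = velocity_cong[OF assms(1) _ assms(3)]
  have "vector_derivative (\<lambda>\<tau>. velocity A \<gamma> \<tau> c) (at t) = vector_derivative (\<lambda>\<tau>. velocity A \<gamma>' \<tau> c) (at t)" for c
    by (rule vector_derivative_cong_open[OF assms(1,2)]) (simp add: v)
  then show ?thesis
    using assms(2,3) v[OF assms(2)] by (intro ext) (simp add: covariant_derivative_along_def)
qed

lemma geodesic_local:
  assumes "\<And>t. \<exists>J \<gamma>'. t \<in> J \<and> geodesic_on A nabla J \<gamma>' \<and> (\<forall>\<tau>\<in>J. \<gamma> \<tau> = \<gamma>' \<tau>)"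
  shows "geodesic_on A nabla UNIV \<gamma>"
proof -
  have "smooth_map (open_atlas UNIV) A \<gamma>"
  proof (rule curveI)
    fix t :: real
    obtain J \<gamma>' where J: "t \<in> J" "geodesic_on A nabla J \<gamma>'" "\<And>\<tau>. \<tau> \<in> J \<Longrightarrow> \<gamma> \<tau> = \<gamma>' \<tau>"
      using assms[of t] by blast
    obtain c where c: "c \<in> A" "\<gamma>' t \<in> fst c" by (rule chart_at)
    obtain W where W: "open W" "t \<in> W" "W \<subseteq> J" "\<And>\<tau>. \<tau> \<in> W \<Longrightarrow> \<gamma>' \<tau> \<in> fst c"
      "smooth_on (\<lambda>\<tau>. snd c (\<gamma>' \<tau>)) W"
      by (rule curve_smooth[OF geodesic_onD(1,3)[OF J(2)] J(1) c]) (rule that; assumption)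
    have "smooth_on (\<lambda>\<tau>. snd c (\<gamma> \<tau>)) W"
      by (rule smooth_on_cong[OF W(1,5)]) (use W(3) J(3) in auto)
    moreover have "\<gamma> ` W \<subseteq> fst c" using W(3,4) J(3) by force
    ultimately show "\<exists>c W. c \<in> A \<and> open W \<and> t \<in> W \<and> W \<subseteq> UNIV \<and> \<gamma> ` W \<subseteq> fst c \<and>
        smooth_on (\<lambda>\<tau>. snd c (\<gamma> \<tau>)) W"
      using c W by (intro exI[of _ c] exI[of _ W]) simp
  qed
  moreover have "covariant_derivative_along A nabla \<gamma> (velocity A \<gamma>) t = tzero" for t
  proof -
    obtain J \<gamma>' where J: "t \<in> J" "geodesic_on A nabla J \<gamma>'" "\<And>\<tau>. \<tau> \<in> J \<Longrightarrow> \<gamma> \<tau> = \<gamma>' \<tau>"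
      using assms[of t] by blast
    show ?thesis
      using covariant_derivative_cong[OF geodesic_onD(1)[OF J(2)] J(1,3)] geodesic_onD(4)[OF J(2,1)] by simp
  qed
  ultimately show ?thesis by (simp add: geodesic_on_def)
qed

lemma exp_map_eq:
  assumes \<gamma>: "exp_geodesic A nabla x \<gamma>"
  shows "exp_map A nabla x = \<gamma> 1"
  unfolding exp_map_def
proof (rule the_equality)
  show "\<exists>\<gamma>'. exp_geodesic A nabla x \<gamma>' \<and> \<gamma> 1 = \<gamma>' 1" using \<gamma> by blast
  fix q assume "\<exists>\<gamma>'. exp_geodesic A nabla x \<gamma>' \<and> q = \<gamma>' 1"
  then obtain \<gamma>' where \<gamma>': "exp_geodesic A nabla x \<gamma>'" "q = \<gamma>' 1" by blast
  obtain I where I: "{0, 1} \<subseteq> I" "geodesic_on A nabla I \<gamma>" "lifted_velocity A \<gamma> 0 = x"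
    using \<gamma> unfolding exp_geodesic_def by blast
  obtain I' where I': "{0, 1} \<subseteq> I'" "geodesic_on A nabla I' \<gamma>'" "lifted_velocity A \<gamma>' 0 = x"
    using \<gamma>'(1) unfolding exp_geodesic_def by blast
  have "lifted_velocity A \<gamma> 1 = lifted_velocity A \<gamma>' 1"
    using geodesic_unique[OF I(2) I'(2), of 0 1] I I' by simp
  then show "q = \<gamma> 1" by (simp add: \<gamma>'(2) lifted_velocity_def)
qed

end

section \<open>Retractions in coordinates\<close>

text \<open>
  The restriction \<open>r\<^sub>p\<close> in the chart \<open>c\<close>, as a map of the model space.
\<close>

definition retraction_coord ::
    "('m, 'e::real_normed_vector) chart set \<Rightarrow> ('m \<times> ('m, 'e) tvec \<Rightarrow> 'm) \<Rightarrow> ('m, 'e) chart \<Rightarrow> 'm \<Rightarrow> 'e \<Rightarrow> 'e" where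
  "retraction_coord A r c p u = snd c (r (p, tangent_of A c p u))"

text \<open>
  Write \<open>f\<close> for \<open>r\<^sub>p\<close> in the chart \<open>c\<close>. The pull-back \<open>Z\<close> of
  a field \<open>Y\<close> along \<open>r\<^sub>p\<close> is given by \<open>df\<^sub>u Z(u) = Y(f(u))\<close>.
  Differentiation at \<open>u = 0\<close> in the direction \<open>X(p)\<close> gives
  \<open>d\<^sup>2f\<^sub>0(X, Y) + dZ\<^sub>0 X = dY X\<close>, as \<open>df\<^sub>0\<close> is the identity.
  The connection is \<open>dZ\<^sub>0 X\<close>.
\<close>

definition retraction_connection ::
    "('m, 'e::real_normed_vector) chart set \<Rightarrow> ('m \<times> ('m, 'e) tvec \<Rightarrow> 'm) \<Rightarrow>
     ('m \<Rightarrow> ('m, 'e) tvec) \<Rightarrow> ('m \<Rightarrow> ('m, 'e) tvec) \<Rightarrow> 'm \<Rightarrow> ('m, 'e) tvec" where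
  "retraction_connection A r X Y p = (\<lambda>c. if c \<in> A \<and> p \<in> fst c
     then fderiv (\<lambda>x. Y (chart_inv c x) c) (snd c p) (X p c) -
          hess (retraction_coord A r c p) 0 (X p c) (Y p c)
     else 0)"

locale retraction_mfd = smooth_mfd A for A :: "('m::{t2_space,second_countable_topology}, 'e::{real_inner,heine_borel}) chart set" +
  fixes r
  assumes retraction: "tangent_retraction A r"
begin

abbreviation "R \<equiv> retraction_coord A r"

lemma r_tzero: "r (p, tzero) = p"
  using retraction by (simp add: tangent_retraction_def)

lemma tangent_of_0: "c \<in> A \<Longrightarrow> p \<in> fst c \<Longrightarrow> tangent_of A c p 0 = tzero"
  using tangent_of_coord[OF tangent_space_tzero, of c p] by (simp add: tzero_def)

lemma R_0: "c \<in> A \<Longrightarrow> p \<in> fst c \<Longrightarrow> R c p 0 = snd c p"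
  by (simp add: retraction_coord_def tangent_of_0 r_tzero)

lemma R_has_derivative:
  assumes c: "c \<in> A" "p \<in> fst c"
  shows "(R c p has_derivative (\<lambda>u. u)) (at 0)"
proof -
  have inj: "inj_on (\<lambda>v. v c) (tangent_space A p)"
    by (rule inj_onI) (rule tangent_eqI[OF _ _ c])
  have "inv_into (tangent_space A p) (\<lambda>v. v c) u = tangent_of A c p u" for u
    by (rule inv_into_f_eq[OF inj]) (simp_all add: tangent_of_in tangent_of_self c)
  moreover have "((\<lambda>u. snd c (r (p, inv_into (tangent_space A p) (\<lambda>v. v c) u)))
      has_derivative (\<lambda>u. u)) (at 0)"
    using retraction c unfolding tangent_retraction_def by blast
  ultimately show ?thesis unfolding retraction_coord_def[abs_def] by simp
qed

lemma r_joint_smooth: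
  assumes c: "c \<in> A" "p \<in> fst c" and v: "v \<in> tangent_space A p" and d: "d \<in> A" "r (p, v) \<in> fst d"
  obtains W where "open W" "(snd c p, v c) \<in> W" "W \<subseteq> (snd c ` fst c) \<times> UNIV"
    "\<And>q u. q \<in> fst c \<Longrightarrow> (snd c q, u) \<in> W \<Longrightarrow> r (q, tangent_of A c q u) \<in> fst d"
    "smooth_on (\<lambda>z. snd d (r (chart_inv c (fst z), tangent_of A c (chart_inv c (fst z)) (snd z)))) W"
proof -
  have sm: "smooth_map (tangent_atlas A) A r" using retraction by (simp add: tangent_retraction_def)
  have tc: "tangent_chart A c \<in> tangent_atlas A" using c by (simp add: tangent_atlas_def)
  have pv: "(p, v) \<in> fst (tangent_chart A c)" using c v by (simp add: tangent_chart_def)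
  obtain W where W: "open W" "snd (tangent_chart A c) (p, v) \<in> W"
      "W \<subseteq> snd (tangent_chart A c) ` fst (tangent_chart A c)"
      "\<And>y. y \<in> W \<Longrightarrow> r (chart_inv (tangent_chart A c) y) \<in> fst d"
      "smooth_on (\<lambda>y. snd d (r (chart_inv (tangent_chart A c) y))) W"
    by (rule smooth_map_in_charts[OF chart_system_tangent chart_system sm tc pv d]) (rule that; assumption)
  have sub: "W \<subseteq> (snd c ` fst c) \<times> UNIV" using W(3) tangent_chart_image'[OF c(1)] by simp
  show ?thesis
  proof (rule that[OF W(1) _ sub])
    show "(snd c p, v c) \<in> W" using W(2) by (simp add: tangent_chart_def)
    show "r (q, tangent_of A c q u) \<in> fst d" if "q \<in> fst c" "(snd c q, u) \<in> W" for q u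
      using W(4)[OF that(2)] by (simp add: tangent_chart_inv[OF c(1) that(1)])
    show "smooth_on (\<lambda>z. snd d (r (chart_inv c (fst z), tangent_of A c (chart_inv c (fst z)) (snd z)))) W"
    proof (rule smooth_on_cong[OF W(1,5)])
      fix z assume "z \<in> W"
      then obtain q u where q: "q \<in> fst c" "z = (snd c q, u)" using sub by (cases z) auto
      then show "snd d (r (chart_inv (tangent_chart A c) z)) =
          snd d (r (chart_inv c (fst z), tangent_of A c (chart_inv c (fst z)) (snd z)))"
        by (simp add: tangent_chart_inv[OF c(1)] c(1))
    qed
  qed
qed

definition Rjoint :: "('m, 'e) chart \<Rightarrow> 'e \<times> 'e \<Rightarrow> 'e" where
  "Rjoint c z = R c (chart_inv c (fst z)) (snd z)"

lemma Rjoint_smooth: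
  assumes c: "c \<in> A" "p \<in> fst c"
  obtains W where "open W" "(snd c p, 0) \<in> W" "W \<subseteq> (snd c ` fst c) \<times> UNIV"
    "\<And>q u. q \<in> fst c \<Longrightarrow> (snd c q, u) \<in> W \<Longrightarrow> r (q, tangent_of A c q u) \<in> fst c"
    "smooth_on (Rjoint c) W"
proof -
  have "r (p, tzero) \<in> fst c" by (simp add: r_tzero c)
  then obtain W where "open W" "(snd c p, tzero c) \<in> W" "W \<subseteq> (snd c ` fst c) \<times> UNIV"
    "\<And>q u. q \<in> fst c \<Longrightarrow> (snd c q, u) \<in> W \<Longrightarrow> r (q, tangent_of A c q u) \<in> fst c"
    "smooth_on (\<lambda>z. snd c (r (chart_inv c (fst z), tangent_of A c (chart_inv c (fst z)) (snd z)))) W"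
    by (rule r_joint_smooth[OF c tangent_space_tzero c(1)]) (rule that; assumption)
  then show ?thesis
    by (intro that[of W]) (simp_all add: tzero_def Rjoint_def[abs_def] retraction_coord_def)
qed

lemma R_smooth:
  assumes c: "c \<in> A" "p \<in> fst c"
  obtains S where "open S" "0 \<in> S" "smooth_on (R c p) S"
    "\<And>u. u \<in> S \<Longrightarrow> r (p, tangent_of A c p u) \<in> fst c"
proof -
  obtain W where W: "open W" "(snd c p, 0) \<in> W" "W \<subseteq> (snd c ` fst c) \<times> UNIV"
    "\<And>q u. q \<in> fst c \<Longrightarrow> (snd c q, u) \<in> W \<Longrightarrow> r (q, tangent_of A c q u) \<in> fst c"
    "smooth_on (Rjoint c) W" by (rule Rjoint_smooth[OF c]) (rule that; assumption)
  define S where "S = {u. (snd c p, u) \<in> W}"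
  have S: "open S"
  proof -
    have "open ((\<lambda>u. (snd c p, u)) -` W)" by (rule open_vimage[OF W(1)]) (intro continuous_intros)
    then show ?thesis by (simp add: S_def vimage_def)
  qed
  have "smooth_on (\<lambda>u. Rjoint c (snd c p, u)) S"
    by (rule smooth_on_compose[OF S W(1,5) smooth_on_Pair[OF S smooth_on_const[OF S] smooth_on_id[OF S]]])
       (simp add: S_def)
  then have "smooth_on (R c p) S" by (simp add: Rjoint_def c)
  then show ?thesis by (intro that[OF S]) (use W(2,4) c in \<open>auto simp: S_def\<close>)
qed

section \<open>The curves of a retraction\<close>

lemma retraction_curve_smooth:
  assumes x: "x \<in> tangent_bundle A"
  shows "smooth_map (open_atlas UNIV) A (retraction_curve r x)"
proof (rule curveI)
  fix t :: real
  obtain p v where pv: "x = (p, v)" "v \<in> tangent_space A p" using x by (auto simp: tangent_bundle_def)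
  obtain c where c: "c \<in> A" "p \<in> fst c" by (rule chart_at)
  obtain d where d: "d \<in> A" "r (p, tscale t v) \<in> fst d" by (rule chart_at)
  obtain W where W: "open W" "(snd c p, tscale t v c) \<in> W" "W \<subseteq> (snd c ` fst c) \<times> UNIV"
    "\<And>q u. q \<in> fst c \<Longrightarrow> (snd c q, u) \<in> W \<Longrightarrow> r (q, tangent_of A c q u) \<in> fst d"
    "smooth_on (\<lambda>z. snd d (r (chart_inv c (fst z), tangent_of A c (chart_inv c (fst z)) (snd z)))) W"
    by (rule r_joint_smooth[OF c tangent_space_tscale[OF pv(2)] d]) (rule that; assumption)
  have tc: "tangent_of A c p (\<tau> *\<^sub>R v c) = tscale \<tau> v" for \<tau>
    using tangent_of_coord[OF tangent_space_tscale[OF pv(2)] c] by (simp add: tscale_apply)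
  define V where "V = {\<tau>. (snd c p, \<tau> *\<^sub>R v c) \<in> W}"
  have V: "open V"
  proof -
    have "open ((\<lambda>\<tau>. (snd c p, \<tau> *\<^sub>R v c)) -` W)" by (rule open_vimage[OF W(1)]) (intro continuous_intros)
    then show ?thesis by (simp add: V_def vimage_def)
  qed
  have "smooth_on (\<lambda>\<tau>. (snd c p, \<tau> *\<^sub>R v c)) V"
    by (rule smooth_on_Pair[OF V smooth_on_const[OF V] smooth_on_linear[OF V bounded_linear_scaleR_left]])
  from smooth_on_compose[OF V W(1,5) this]
  have "smooth_on (\<lambda>\<tau>. snd d (retraction_curve r x \<tau>)) V"
    by (simp add: V_def tc c retraction_curve_def pv)
  moreover have "retraction_curve r x ` V \<subseteq> fst d"
    using W(4)[OF c(2)] by (auto simp: V_def retraction_curve_def pv tc[symmetric])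
  ultimately show "\<exists>c W. c \<in> A \<and> open W \<and> t \<in> W \<and> W \<subseteq> UNIV \<and> retraction_curve r x ` W \<subseteq> fst c \<and>
      smooth_on (\<lambda>\<tau>. snd c (retraction_curve r x \<tau>)) W"
    using d(1) V W(2) by (intro exI[of _ d] exI[of _ V]) (simp add: V_def tscale_apply)
qed

lemma retraction_curve_coord:
  assumes v: "v \<in> tangent_space A p" and c: "c \<in> A" "p \<in> fst c"
  shows "snd c (retraction_curve r (p, v) \<tau>) = R c p (\<tau> *\<^sub>R v c)"
  using tangent_of_coord[OF tangent_space_tscale[OF v] c, of \<tau>]
  by (simp add: retraction_curve_def retraction_coord_def tscale_apply)

lemma retraction_curve_0: "retraction_curve r (p, v) 0 = p"
  using r_tzero[of p] by (simp add: retraction_curve_def tscale_def tzero_def)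

lemma retraction_curve_initial:
  assumes x: "x \<in> tangent_bundle A"
  shows "lifted_velocity A (retraction_curve r x) 0 = x"
proof -
  obtain p v where pv: "x = (p, v)" "v \<in> tangent_space A p" using x by (auto simp: tangent_bundle_def)
  have "velocity A (retraction_curve r x) 0 c = v c" for c
  proof (cases "c \<in> A \<and> p \<in> fst c")
    case True
    have "((\<lambda>\<tau>. R c p (\<tau> *\<^sub>R v c)) has_derivative (\<lambda>s. s *\<^sub>R v c)) (at 0)"
      by (rule has_derivative_compose[OF bounded_linear_imp_has_derivative[OF bounded_linear_scaleR_left]])
         (use R_has_derivative True in simp)
    then have "((\<lambda>\<tau>. snd c (retraction_curve r x \<tau>)) has_vector_derivative v c) (at 0)"
      using retraction_curve_coord[OF pv(2)] True by (simp add: has_vector_derivative_def pv(1))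
    then have "vector_derivative (\<lambda>\<tau>. snd c (retraction_curve r x \<tau>)) (at 0) = v c"
      by (rule vector_derivative_at)
    then show ?thesis using True by (simp add: velocity_coord pv(1) retraction_curve_0)
  next
    case False
    then show ?thesis using tangent_off[OF pv(2), of c] by (auto simp: velocity_def pv(1) retraction_curve_0)
  qed
  then show ?thesis by (auto simp: lifted_velocity_def pv(1) retraction_curve_0)
qed

text \<open>
  In the chart, the curve is \<open>\<tau> \<mapsto> f(\<tau> v)\<close> with \<open>f\<close> the coordinate
  expression of \<open>r\<^sub>p\<close>, and the inner function is linear.
\<close>

lemma retraction_curve_acceleration:
  assumes v: "v \<in> tangent_space A p" and c: "c \<in> A" "p \<in> fst c"
  shows "vector_derivative (\<lambda>\<tau>. velocity A (retraction_curve r (p, v)) \<tau> c) (at 0) =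
           hess (R c p) 0 (v c) (v c)"
proof -
  let ?\<gamma> = "retraction_curve r (p, v)"
  have x: "(p, v) \<in> tangent_bundle A" using v by (simp add: tangent_bundle_def)
  have c0: "?\<gamma> 0 \<in> fst c" by (simp add: retraction_curve_0 c)
  obtain W where W: "open W" "0 \<in> W" "W \<subseteq> UNIV" "\<And>\<tau>. \<tau> \<in> W \<Longrightarrow> ?\<gamma> \<tau> \<in> fst c"
    "smooth_on (\<lambda>\<tau>. snd c (?\<gamma> \<tau>)) W"
    by (rule curve_smooth[OF open_UNIV retraction_curve_smooth[OF x] UNIV_I c(1) c0]) (rule that; assumption)
  obtain S where S: "open S" "0 \<in> S" "smooth_on (R c p) S"
    by (rule R_smooth[OF c])
  have lin: "bounded_linear (\<lambda>\<tau>. \<tau> *\<^sub>R v c)" by (rule bounded_linear_scaleR_left)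
  define V where "V = (\<lambda>\<tau>. \<tau> *\<^sub>R v c) -` S"
  have V: "open V" unfolding V_def by (rule open_vimage[OF S(1)]) (intro continuous_intros)
  have vel: "velocity A ?\<gamma> \<tau> c = fderiv (\<lambda>\<tau>. snd c (?\<gamma> \<tau>)) \<tau> 1" if "\<tau> \<in> W" for \<tau>
  proof -
    have "(\<lambda>\<tau>. snd c (?\<gamma> \<tau>)) differentiable at \<tau>"
      using smooth_on_has_derivative[OF W(5) that] by (auto simp: differentiable_def)
    then show ?thesis by (simp add: velocity_coord c(1) W(4)[OF that] vector_derivative_fderiv)
  qed
  have "vector_derivative (\<lambda>\<tau>. velocity A ?\<gamma> \<tau> c) (at 0) =
      vector_derivative (\<lambda>\<tau>. fderiv (\<lambda>\<tau>. snd c (?\<gamma> \<tau>)) \<tau> 1) (at 0)"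
    by (rule vector_derivative_cong_open[OF W(1,2) vel])
  also have "\<dots> = hess (\<lambda>\<tau>. snd c (?\<gamma> \<tau>)) 0 1 1"
    unfolding hess_def
    by (rule vector_derivative_fderiv)
       (use smooth_on_has_derivative[OF smooth_on_fderiv[OF W(5)] W(2)] in \<open>auto simp: differentiable_def\<close>)
  also have "\<dots> = hess (\<lambda>\<tau>. R c p (\<tau> *\<^sub>R v c)) 0 1 1"
    by (simp add: retraction_curve_coord[OF v c])
  also have "\<dots> = hess (R c p) (0 *\<^sub>R v c) (v c) (v c) + fderiv (R c p) (0 *\<^sub>R v c) 0"
    using hess_compose[OF V _ S(1,3) smooth_on_linear[OF V lin], of 0 1 1] S(2)
    by (simp add: V_def hess_linear[OF lin])
  also have "\<dots> = hess (R c p) 0 (v c) (v c)"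
    using linear_0[OF smooth_on_linear_fderiv[OF S(3,2)]] by simp
  finally show ?thesis .
qed

section \<open>The connection of a retraction\<close>

text \<open>
  The coordinate expressions of \<open>r\<^sub>p\<close> in two charts satisfy
  \<open>f\<^sub>d \<circ> J = \<phi> \<circ> f\<^sub>c\<close> near 0, with \<open>\<phi>\<close> the transition
  map and \<open>J\<close> its derivative at \<open>p\<close>. Since \<open>J\<close> is linear, the second order
  chain rule leaves the second derivative of \<open>\<phi>\<close> as the only inhomogeneous term.
\<close>

lemma R_hess_transform:
  assumes cd: "c \<in> A" "d \<in> A" "p \<in> fst c" "p \<in> fst d"
  defines "J \<equiv> fderiv (transition c d) (snd c p)"
  shows "hess (R d p) 0 (J u) (J w) = hess (transition c d) (snd c p) u w + J (hess (R c p) 0 u w)"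
proof -
  obtain S where S: "open S" "0 \<in> S" "smooth_on (R c p) S"
    "\<And>u. u \<in> S \<Longrightarrow> r (p, tangent_of A c p u) \<in> fst c"
    by (rule R_smooth[OF cd(1,3)]) (rule that; assumption)
  obtain S' where S': "open S'" "0 \<in> S'" "smooth_on (R d p) S'"
    by (rule R_smooth[OF cd(2,4)])
  have J: "bounded_linear J" unfolding J_def by (rule has_derivative_bounded_linear[OF jac_deriv[OF cd]])
  define Q where "Q = snd c ` (fst c \<inter> fst d)"
  have Q: "open Q" unfolding Q_def by (rule overlap_open[OF cd(1,2)])
  define T where "T = (S \<inter> R c p -` Q) \<inter> J -` S'"
  have T: "open T" unfolding T_def
    by (intro open_Int continuous_open_preimage[OF smooth_on_continuous_on[OF S(3)] S(1) Q]
        open_vimage[OF S'(1)] linear_continuous_on[OF J])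
  have T0: "0 \<in> T"
    using S(2) S'(2) cd by (simp add: T_def R_0 linear_simps[OF J] Q_def)
  have eq: "R d p (J u) = transition c d (R c p u)" if "u \<in> T" for u
  proof -
    have "tangent_of A d p (J u) = tangent_of A c p u"
      by (rule tangent_eqI[OF tangent_of_in[OF cd(2,4)] tangent_of_in[OF cd(1,3)] cd(2,4)])
         (simp add: tangent_of_self cd tangent_of_comp J_def)
    then show ?thesis using S(4)[of u] that cd(1)
      by (simp add: T_def retraction_coord_def transition_apply)
  qed
  have "hess (R d p) 0 (J u) (J w) = hess (\<lambda>u. R d p (J u)) 0 u w"
    using hess_compose[OF T T0 S'(1,3) smooth_on_linear[OF T J], of u w]
      linear_0[OF smooth_on_linear_fderiv[OF S'(3,2)]]
    by (simp add: T_def hess_linear[OF J] linear_simps[OF J])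
  also have "\<dots> = hess (\<lambda>u. transition c d (R c p u)) 0 u w"
    by (rule hess_cong[OF T T0 eq])
  also have "\<dots> = hess (transition c d) (R c p 0) (fderiv (R c p) 0 u) (fderiv (R c p) 0 w)
      + fderiv (transition c d) (R c p 0) (hess (R c p) 0 u w)"
    by (rule hess_compose[OF T T0 Q transition_smooth[OF cd(1,2), folded Q_def] smooth_on_subset[OF S(3)]])
       (auto simp: T_def)
  also have "\<dots> = hess (transition c d) (snd c p) u w + J (hess (R c p) 0 u w)"
    using fderiv_eq[OF R_has_derivative[OF cd(1,3)]] by (simp add: R_0 cd J_def)
  finally show ?thesis .
qed

lemma vf_deriv:
  assumes "Y \<in> vector_fields A" "c \<in> A" "p \<in> fst c"
  shows "((\<lambda>x. Y (chart_inv c x) c) has_derivative fderiv (\<lambda>x. Y (chart_inv c x) c) (snd c p)) (at (snd c p))"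
  by (rule smooth_on_has_derivative[OF vf_smooth[OF assms(1,2)]]) (use assms in auto)

text \<open>
  Differentiating \<open>Y\<^sub>d \<circ> \<phi> = d\<phi> Y\<^sub>c\<close> produces the same inhomogeneous term
  \<open>d\<^sup>2\<phi>(X, Y)\<close> as \<open>R_hess_transform\<close>; the two cancel.
\<close>

lemma retraction_connection_tangent:
  assumes X: "X \<in> vector_fields A" and Y: "Y \<in> vector_fields A"
  shows "retraction_connection A r X Y p \<in> tangent_space A p"
proof (rule tangent_spaceI)
  show "retraction_connection A r X Y p c = 0" if "c \<notin> A \<or> p \<notin> fst c" for c
    using that by (auto simp: retraction_connection_def)
  fix c d assume cd: "c \<in> A" "d \<in> A" "p \<in> fst c" "p \<in> fst d"
  let ?J = "fderiv (transition c d) (snd c p)"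
  note lin = jac_linear[OF cd]
  have D1: "((\<lambda>x. Y (chart_inv d (transition c d x)) d) has_derivative
      (\<lambda>u. fderiv (\<lambda>x. Y (chart_inv d x) d) (snd d p) (?J u))) (at (snd c p))"
    by (rule has_derivative_compose[OF jac_deriv[OF cd]])
       (use vf_deriv[OF Y cd(2,4)] cd in \<open>simp add: transition_apply\<close>)
  have "((\<lambda>x. fderiv (transition c d) x (Y (chart_inv c x) c)) has_derivative
      (\<lambda>u. hess (transition c d) (snd c p) u (Y (chart_inv c (snd c p)) c) +
        ?J (fderiv (\<lambda>x. Y (chart_inv c x) c) (snd c p) u))) (at (snd c p))"
    by (rule has_derivative_fderiv_at[OF overlap_open[OF cd(1,2)] _ overlap_open[OF cd(1,2)]
          transition_smooth[OF cd(1,2)] _ has_derivative_ident vf_deriv[OF Y cd(1,3)]])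
       (use cd in auto)
  then have D2: "((\<lambda>x. Y (chart_inv d (transition c d x)) d) has_derivative
      (\<lambda>u. hess (transition c d) (snd c p) u (Y (chart_inv c (snd c p)) c) +
        ?J (fderiv (\<lambda>x. Y (chart_inv c x) c) (snd c p) u))) (at (snd c p))"
  proof (rule has_derivative_transform_within_open[OF _ overlap_open[OF cd(1,2)]])
    fix x assume "x \<in> snd c ` (fst c \<inter> fst d)"
    then obtain q where q: "x = snd c q" "q \<in> fst c" "q \<in> fst d" by auto
    show "fderiv (transition c d) x (Y (chart_inv c x) c) = Y (chart_inv d (transition c d x)) d"
      using tangent_jac[OF vf_tangent[OF Y] cd(1,2) q(2,3)] q cd by (simp add: transition_apply)
  qed (use cd in auto)
  have D: "fderiv (\<lambda>x. Y (chart_inv d x) d) (snd d p) (?J u) =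
      hess (transition c d) (snd c p) u (Y p c) + ?J (fderiv (\<lambda>x. Y (chart_inv c x) c) (snd c p) u)" for u
    using fun_cong[OF has_derivative_unique[OF D1 D2], of u] cd by simp
  have XY: "X p d = ?J (X p c)" "Y p d = ?J (Y p c)"
    using tangent_jac[OF vf_tangent[OF X] cd] tangent_jac[OF vf_tangent[OF Y] cd] by auto
  show "retraction_connection A r X Y p d = ?J (retraction_connection A r X Y p c)"
    unfolding retraction_connection_def XY D R_hess_transform[OF cd]
    using cd by (simp add: linear_diff[OF lin])
qed

lemma retraction_connection_vf:
  assumes X: "X \<in> vector_fields A" and Y: "Y \<in> vector_fields A"
  shows "retraction_connection A r X Y \<in> vector_fields A"
proof (rule vfI[OF retraction_connection_tangent[OF X Y]])
  fix p
  obtain c where c: "c \<in> A" "p \<in> fst c" by (rule chart_at)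
  obtain W where W: "open W" "(snd c p, 0) \<in> W" "W \<subseteq> (snd c ` fst c) \<times> UNIV"
    "smooth_on (Rjoint c) W" by (rule Rjoint_smooth[OF c])
  define V where "V = (\<lambda>x. (x, 0)) -` W"
  have V: "open V" unfolding V_def by (rule open_vimage[OF W(1)]) (intro continuous_intros)
  have Vc: "V \<subseteq> snd c ` fst c" using W(3) by (auto simp: V_def)
  note Xs = smooth_on_subset[OF vf_smooth[OF X c(1)] Vc] and Ys = smooth_on_subset[OF vf_smooth[OF Y c(1)] Vc]
  have "smooth_on (\<lambda>x. fderiv (\<lambda>x. Y (chart_inv c x) c) x (X (chart_inv c x) c)) V"
    by (rule smooth_on_fderiv_at[OF V V Ys smooth_on_id[OF V] Xs])
  moreover have "smooth_on (\<lambda>x. hess (Rjoint c) (x, 0) (0, X (chart_inv c x) c) (0, Y (chart_inv c x) c)) V"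
    by (rule smooth_on_hess[OF V W(1,4)])
       (auto simp: V_def[symmetric] intro!: smooth_on_Pair smooth_on_const smooth_on_id V Xs Ys, simp add: V_def)
  ultimately have "smooth_on (\<lambda>x. fderiv (\<lambda>x. Y (chart_inv c x) c) x (X (chart_inv c x) c) -
      hess (Rjoint c) (x, 0) (0, X (chart_inv c x) c) (0, Y (chart_inv c x) c)) V"
    by (rule smooth_on_diff[OF V])
  then have "smooth_on (\<lambda>x. retraction_connection A r X Y (chart_inv c x) c) V"
  proof (rule smooth_on_cong[OF V])
    fix x assume x: "x \<in> V"
    then obtain q where q: "q \<in> fst c" "x = snd c q" using Vc by auto
    have "hess (\<lambda>u. Rjoint c (x, u)) 0 (X q c) (Y q c) = hess (Rjoint c) (x, 0) (0, X q c) (0, Y q c)"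
      by (rule hess_partial[OF W(1,4)]) (use x in \<open>simp add: V_def\<close>)
    then show "fderiv (\<lambda>x. Y (chart_inv c x) c) x (X (chart_inv c x) c) -
        hess (Rjoint c) (x, 0) (0, X (chart_inv c x) c) (0, Y (chart_inv c x) c) =
        retraction_connection A r X Y (chart_inv c x) c"
      using q c by (simp add: retraction_connection_def Rjoint_def)
  qed
  then show "\<exists>c W. c \<in> A \<and> p \<in> fst c \<and> open W \<and> snd c p \<in> W \<and> W \<subseteq> snd c ` fst c \<and>
      smooth_on (\<lambda>x. retraction_connection A r X Y (chart_inv c x) c) W"
    using c V Vc W(2) by (intro exI[of _ c] exI[of _ V]) (simp add: V_def)
qed

lemma hess_R_linear:
  assumes "c \<in> A" "p \<in> fst c"
  shows "linear (\<lambda>u. hess (R c p) 0 u w)" "linear (hess (R c p) 0 u)"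
proof -
  obtain S where S: "open S" "0 \<in> S" "smooth_on (R c p) S" by (rule R_smooth[OF assms])
  show "linear (\<lambda>u. hess (R c p) 0 u w)" "linear (hess (R c p) 0 u)"
    by (rule hess_linear_left[OF S(3,2)], rule hess_linear_right[OF S(1,3,2)])
qed

lemma retraction_connection_affine: "affine_connection A (retraction_connection A r)"
  unfolding affine_connection_def
proof (intro conjI ballI)
  show "retraction_connection A r X Y \<in> vector_fields A" if "X \<in> vector_fields A" "Y \<in> vector_fields A" for X Y
    by (rule retraction_connection_vf[OF that])
next
  fix X Y Z f g
  assume Z: "Z \<in> vector_fields A"
  show "retraction_connection A r (\<lambda>p. tadd (tscale (f p) (X p)) (tscale (g p) (Y p))) Z =
      (\<lambda>p. tadd (tscale (f p) (retraction_connection A r X Z p)) (tscale (g p) (retraction_connection A r Y Z p)))"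
  proof (intro ext)
    fix p c
    show "retraction_connection A r (\<lambda>p. tadd (tscale (f p) (X p)) (tscale (g p) (Y p))) Z p c =
      tadd (tscale (f p) (retraction_connection A r X Z p)) (tscale (g p) (retraction_connection A r Y Z p)) c"
    proof (cases "c \<in> A \<and> p \<in> fst c")
      case True
      then have c: "c \<in> A" "p \<in> fst c" by auto
      note D = has_derivative_linear[OF vf_deriv[OF Z c]] and H = hess_R_linear(1)[OF c]
      show ?thesis
        using c by (simp add: retraction_connection_def tadd_apply tscale_apply linear_add[OF D] linear_cmul[OF D]
            linear_add[OF H] linear_cmul[OF H] scaleR_diff_right)
    qed (auto simp: retraction_connection_def tadd_apply tscale_apply)
  qed
next
  fix X Y Z
  assume Y: "Y \<in> vector_fields A" and Z: "Z \<in> vector_fields A"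
  show "retraction_connection A r X (\<lambda>p. tadd (Y p) (Z p)) = (\<lambda>p. tadd (retraction_connection A r X Y p) (retraction_connection A r X Z p))"
  proof (intro ext)
    fix p c
    show "retraction_connection A r X (\<lambda>p. tadd (Y p) (Z p)) p c = tadd (retraction_connection A r X Y p) (retraction_connection A r X Z p) c"
    proof (cases "c \<in> A \<and> p \<in> fst c")
      case True
      then have c: "c \<in> A" "p \<in> fst c" by auto
      note D = fderiv_eq[OF has_derivative_add[OF vf_deriv[OF Y c] vf_deriv[OF Z c]]]
        and H = hess_R_linear(2)[OF c]
      show ?thesis
        using c by (simp add: retraction_connection_def tadd_apply D linear_add[OF H])
    qed (auto simp: retraction_connection_def tadd_apply)
  qed
next
  fix X Y f
  assume X: "X \<in> vector_fields A" and Y: "Y \<in> vector_fields A" and f: "f \<in> smooth_functions A"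
  show "retraction_connection A r X (\<lambda>p. tscale (f p) (Y p)) =
      (\<lambda>p. tadd (tscale (f p) (retraction_connection A r X Y p)) (tscale (vf_apply A X f p) (Y p)))"
  proof (intro ext)
    fix p c
    show "retraction_connection A r X (\<lambda>p. tscale (f p) (Y p)) p c =
      tadd (tscale (f p) (retraction_connection A r X Y p)) (tscale (vf_apply A X f p) (Y p)) c"
    proof (cases "c \<in> A \<and> p \<in> fst c")
      case True
      then have c: "c \<in> A" "p \<in> fst c" by auto
      have "((\<lambda>x. f (chart_inv c x)) has_derivative fderiv (\<lambda>x. f (chart_inv c x)) (snd c p)) (at (snd c p))"
        by (rule smooth_on_has_derivative[OF sf_smooth[OF f c(1)]]) (use c in auto)
      note D = fderiv_eq[OF has_derivative_scaleR[OF this vf_deriv[OF Y c]]] and H = hess_R_linear(2)[OF c]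
      show ?thesis
        using c by (simp add: retraction_connection_def tadd_apply tscale_apply D linear_cmul[OF H]
            vf_apply_coord[OF f X c] scaleR_diff_right)
    next
      case False
      then show ?thesis using tangent_off[OF vf_tangent[OF Y], of c p]
        by (auto simp: retraction_connection_def tadd_apply tscale_apply)
    qed
  qed
qed

lemma retraction_connection_christoffel:
  assumes c: "c \<in> A" "p \<in> fst c"
  shows "christoffel A (retraction_connection A r) c p u w = - hess (R c p) 0 u w"
proof -
  interpret affine_mfd A "retraction_connection A r"
    by unfold_locales (rule retraction_connection_affine)
  obtain N where N: "open N" "p \<in> N" "N \<subseteq> fst c"
    and ex: "\<And>u. \<exists>U\<in>vector_fields A. \<forall>q\<in>N. U q c = u"
    using coordinate_fields[OF c] by metis
  obtain U where U: "U \<in> vector_fields A" "\<And>q. q \<in> N \<Longrightarrow> U q c = u" using ex by metis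
  obtain W where W: "W \<in> vector_fields A" "\<And>q. q \<in> N \<Longrightarrow> W q c = w" using ex by metis
  have "fderiv (\<lambda>x. W (chart_inv c x) c) (snd c p) = fderiv (\<lambda>x. w) (snd c p)"
    by (rule fderiv_cong[OF open_chart_image[OF c(1) N(1)]]) (use c N W in auto)
  then have "fderiv (\<lambda>x. W (chart_inv c x) c) (snd c p) u = 0"
    by (simp add: fderiv_eq[OF has_derivative_const])
  then show ?thesis
    using c N U W by (simp add: christoffel_on[OF c(1) N(1,3,2) U W] retraction_connection_def)
qed

text \<open>
  The geodesic equation holds at time 0 by the choice of the connection. The flow equation and time
  reversal carry it to all other times.
\<close>

lemma flow_geodesic:
  assumes flow: "induces_flow A r" and x: "x \<in> tangent_bundle A"
  shows "geodesic_on A (retraction_connection A r) UNIV (retraction_curve r x)"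
proof -
  interpret affine_mfd A "retraction_connection A r"
    by unfold_locales (rule retraction_connection_affine)
  let ?cov = "\<lambda>\<gamma>. covariant_derivative_along A (retraction_connection A r) \<gamma> (velocity A \<gamma>)"
  have zero: "?cov (retraction_curve r x) 0 = tzero" if xt: "x \<in> tangent_bundle A" for x
    unfolding covariant_derivative_zero_iff
  proof (intro ballI impI)
    fix c assume c: "c \<in> A" "retraction_curve r x 0 \<in> fst c"
    obtain p v where pv: "x = (p, v)" "v \<in> tangent_space A p" using xt by (auto simp: tangent_bundle_def)
    have p: "p \<in> fst c" using c(2) by (simp add: pv retraction_curve_0)
    have "velocity A (retraction_curve r x) 0 = v"
      using retraction_curve_initial[OF xt] by (simp add: lifted_velocity_def pv(1))
    then show "vector_derivative (\<lambda>\<tau>. velocity A (retraction_curve r x) \<tau> c) (at 0) =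
        - \<Gamma> c (retraction_curve r x 0) (velocity A (retraction_curve r x) 0 c)
            (velocity A (retraction_curve r x) 0 c)"
      using retraction_curve_acceleration[OF pv(2) c(1) p] retraction_connection_christoffel[OF c(1) p]
      by (simp add: pv(1) retraction_curve_0)
  qed
  have pos: "?cov (retraction_curve r x) t = tzero" if x: "x \<in> tangent_bundle A" and t: "t > 0" for x t
    unfolding covariant_derivative_zero_iff
  proof (intro ballI impI)
    let ?\<gamma> = "retraction_curve r x"
    define y where "y = lifted_velocity A ?\<gamma> t"
    let ?\<delta> = "retraction_curve r y"
    fix c assume c: "c \<in> A" "?\<gamma> t \<in> fst c"
    note sm = retraction_curve_smooth[OF x]
    have y: "y \<in> tangent_bundle A"
      using velocity_tangent[OF open_UNIV sm] by (simp add: y_def lifted_velocity_def tangent_bundle_def)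
    have eq: "lifted_velocity A ?\<gamma> (t + s) = lifted_velocity A ?\<delta> s" if "s \<ge> 0" for s
    proof (cases "s = 0")
      case True
      then show ?thesis using retraction_curve_initial[OF y] by (simp add: y_def)
    next
      case False
      then show ?thesis using flow x t that by (simp add: induces_flow_def y_def)
    qed
    have eq0: "?\<delta> 0 = ?\<gamma> t" "velocity A ?\<delta> 0 = velocity A ?\<gamma> t"
      using eq[of 0] by (simp_all add: lifted_velocity_def)
    \<comment> \<open>The two velocity curves agree for \<open>s \<ge> 0\<close> only. Since both are differentiable at 0, comparing one-sided derivatives suffices.\<close>
    have "((\<lambda>s. t + s) has_vector_derivative 1) (at 0)"
      by (auto intro!: derivative_eq_intros simp: has_vector_derivative_def)
    then have "((\<lambda>\<tau>. velocity A ?\<gamma> \<tau> c) \<circ> (\<lambda>s. t + s) has_vector_derivative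
        1 *\<^sub>R vector_derivative (\<lambda>\<tau>. velocity A ?\<gamma> \<tau> c) (at t)) (at 0)"
      by (rule vector_diff_chain_at) (use velocity_differentiable[OF open_UNIV sm UNIV_I c] in simp)
    then have "((\<lambda>s. velocity A ?\<gamma> (t + s) c) has_vector_derivative
        vector_derivative (\<lambda>\<tau>. velocity A ?\<gamma> \<tau> c) (at t)) (at 0 within cbox 0 1)"
      unfolding o_def scaleR_one by (rule has_vector_derivative_at_within)
    then have "((\<lambda>s. velocity A ?\<delta> s c) has_vector_derivative
        vector_derivative (\<lambda>\<tau>. velocity A ?\<gamma> \<tau> c) (at t)) (at 0 within cbox 0 1)"
      by (rule has_vector_derivative_transform[rotated 2])
         (use eq in \<open>auto simp: lifted_velocity_def\<close>)
    moreover have "((\<lambda>s. velocity A ?\<delta> s c) has_vector_derivative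
        vector_derivative (\<lambda>\<tau>. velocity A ?\<delta> \<tau> c) (at 0)) (at 0 within cbox 0 1)"
      by (rule has_vector_derivative_at_within[OF velocity_differentiable[OF open_UNIV retraction_curve_smooth[OF y] UNIV_I c(1)]])
         (use c eq0 in simp)
    ultimately have "vector_derivative (\<lambda>\<tau>. velocity A ?\<gamma> \<tau> c) (at t) =
        vector_derivative (\<lambda>\<tau>. velocity A ?\<delta> \<tau> c) (at 0)"
      by (rule vector_derivative_unique_within_closed_interval[rotated 2]) auto
    then show "vector_derivative (\<lambda>\<tau>. velocity A ?\<gamma> \<tau> c) (at t) =
        - \<Gamma> c (?\<gamma> t) (velocity A ?\<gamma> t c) (velocity A ?\<gamma> t c)"
      using zero[OF y] c eq0 unfolding covariant_derivative_zero_iff by simp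
  qed
  have neg: "?cov (retraction_curve r x) t = tzero" if t: "t < 0" for t
  proof -
    obtain p v where pv: "x = (p, v)" "v \<in> tangent_space A p" using x by (auto simp: tangent_bundle_def)
    define y where "y = (p, tscale (-1) v)"
    have y: "y \<in> tangent_bundle A" using tangent_space_tscale[OF pv(2)] by (simp add: y_def tangent_bundle_def)
    have "(\<lambda>t. retraction_curve r y ((-1) * t + 0)) = retraction_curve r x"
      by (simp add: fun_eq_iff retraction_curve_def y_def pv(1) tscale_def)
    moreover have "?cov (\<lambda>t. retraction_curve r y ((-1) * t + 0)) t = tzero"
      by (rule covariant_derivative_affine[OF open_UNIV retraction_curve_smooth[OF y] UNIV_I pos[OF y]])
         (use t in simp)
    ultimately show ?thesis by simp
  qed
  have "?cov (retraction_curve r x) t = tzero" for t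
    using zero[OF x] pos[OF x, of t] neg[of t] by (cases t "0::real" rule: linorder_cases) auto
  then show ?thesis
    using retraction_curve_smooth[OF x] by (simp add: geodesic_on_def)
qed

end

section \<open>Geodesic retraction curves, the exponential map and the flow\<close>

locale affine_retraction_mfd = affine_mfd A nabla + retraction_mfd A r
  for A :: "('m::{t2_space,second_countable_topology}, 'e::{real_inner,heine_borel}) chart set" and nabla r
begin

lemma geodesics_imp_exp:
  assumes "\<And>x. x \<in> tangent_bundle A \<Longrightarrow> geodesic_on A nabla UNIV (retraction_curve r x)"
  shows "exp_domain A nabla = tangent_bundle A" "x \<in> tangent_bundle A \<Longrightarrow> r x = exp_map A nabla x"
proof -
  have *: "exp_geodesic A nabla x (retraction_curve r x)" if "x \<in> tangent_bundle A" for x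
    unfolding exp_geodesic_def using assms[OF that] retraction_curve_initial[OF that] by blast
  then show "exp_domain A nabla = tangent_bundle A" by (auto simp: exp_domain_def)
  assume "x \<in> tangent_bundle A"
  from exp_map_eq[OF *[OF this]] show "r x = exp_map A nabla x"
    by (simp add: retraction_curve_def)
qed

text \<open>
  The shifted curve and the retraction curve of the velocity at time \<open>t\<close> are geodesics with
  the same initial velocity.
\<close>

lemma geodesics_imp_flow:
  assumes "\<And>x. x \<in> tangent_bundle A \<Longrightarrow> geodesic_on A nabla UNIV (retraction_curve r x)"
  shows "induces_flow A r"
  unfolding induces_flow_def
proof (intro ballI allI impI)
  fix x and t s :: real assume x: "x \<in> tangent_bundle A"
  let ?\<gamma> = "retraction_curve r x"
  define y where "y = lifted_velocity A ?\<gamma> t"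
  note sm = retraction_curve_smooth[OF x]
  have y: "y \<in> tangent_bundle A"
    using velocity_tangent[OF open_UNIV sm] by (simp add: y_def lifted_velocity_def tangent_bundle_def)
  have lv: "lifted_velocity A (\<lambda>s. ?\<gamma> (1 * s + t)) s = lifted_velocity A ?\<gamma> (t + s)" for s
    using velocity_affine[OF open_UNIV sm UNIV_I, of 1 t s] by (simp add: lifted_velocity_def add.commute)
  have "geodesic_on A nabla UNIV (\<lambda>s. ?\<gamma> (1 * s + t))"
    using geodesic_affine[OF assms[OF x], of 1 t] by simp
  from geodesic_unique[OF this assms[OF y], of 0 s]
  have "lifted_velocity A ?\<gamma> (t + s) = lifted_velocity A (retraction_curve r y) s"
    unfolding lv retraction_curve_initial[OF y] by (simp add: y_def)
  then show "lifted_velocity A ?\<gamma> (t + s) =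
      lifted_velocity A (retraction_curve r (lifted_velocity A ?\<gamma> t)) s" by (simp add: y_def)
qed

text \<open>
  A geodesic \<open>\<gamma>\<close> that computes \<open>exp (p, T v)\<close> also computes
  \<open>exp (p, \<tau> T v) = \<gamma>(\<tau>)\<close> for every \<open>\<tau>\<close> in its interval, because
  \<open>s \<mapsto> \<gamma>(\<tau> s)\<close> is a geodesic with the rescaled initial velocity. So the
  retraction curve is \<open>t \<mapsto> \<gamma>(t / T)\<close> on an interval.
\<close>

lemma exp_imp_geodesics:
  assumes dom: "exp_domain A nabla = tangent_bundle A"
    and exp: "\<And>x. x \<in> tangent_bundle A \<Longrightarrow> r x = exp_map A nabla x"
    and x: "x \<in> tangent_bundle A"
  shows "geodesic_on A nabla UNIV (retraction_curve r x)"
proof (rule geodesic_local)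
  fix t\<^sub>0 :: real
  obtain p v where pv: "x = (p, v)" "v \<in> tangent_space A p" using x by (auto simp: tangent_bundle_def)
  \<comment> \<open>The interval of a geodesic that computes the exponential map is only known to contain 0 and 1, so \<open>T\<close> is chosen with \<open>t\<^sub>0 / T\<close> equal to 0 or 1.\<close>
  define T where "T = (if t\<^sub>0 = 0 then 1 else t\<^sub>0)"
  have T: "T \<noteq> 0" by (simp add: T_def)
  have tb: "(p, tscale a v) \<in> tangent_bundle A" for a
    using tangent_space_tscale[OF pv(2)] by (simp add: tangent_bundle_def)
  then have "(p, tscale T v) \<in> exp_domain A nabla" by (simp add: dom)
  then obtain \<gamma> I where I: "{0, 1} \<subseteq> I" and \<gamma>: "geodesic_on A nabla I \<gamma>"
    and init: "lifted_velocity A \<gamma> 0 = (p, tscale T v)"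
    unfolding exp_domain_def exp_geodesic_def by blast
  note g = geodesic_onD[OF \<gamma>]
  have val: "r (p, tscale (\<tau> * T) v) = \<gamma> \<tau>" if "\<tau> \<in> I" for \<tau>
  proof -
    have "lifted_velocity A (\<lambda>s. \<gamma> (\<tau> * s + 0)) 0 = (p, tscale (\<tau> * T) v)"
      using velocity_affine[OF g(1,3), of \<tau> 0 0] init I by (simp add: lifted_velocity_def tscale_def)
    moreover have "geodesic_on A nabla {s. \<tau> * s + 0 \<in> I} (\<lambda>s. \<gamma> (\<tau> * s + 0))"
      by (rule geodesic_affine[OF \<gamma>])
    moreover have "{0, 1} \<subseteq> {s. \<tau> * s + 0 \<in> I}" using I that by auto
    ultimately have "exp_geodesic A nabla (p, tscale (\<tau> * T) v) (\<lambda>s. \<gamma> (\<tau> * s + 0))"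
      unfolding exp_geodesic_def by blast
    from exp_map_eq[OF this] show ?thesis by (simp add: exp tb)
  qed
  let ?J = "{t. inverse T * t + 0 \<in> I}"
  have "geodesic_on A nabla ?J (\<lambda>t. \<gamma> (inverse T * t + 0))" by (rule geodesic_affine[OF \<gamma>])
  moreover have "t\<^sub>0 \<in> ?J" using I by (auto simp: T_def)
  moreover have "retraction_curve r x t = \<gamma> (inverse T * t + 0)" if "t \<in> ?J" for t
  proof -
    have "(inverse T * t + 0) * T = t" using T by simp
    moreover have "r (p, tscale ((inverse T * t + 0) * T) v) = \<gamma> (inverse T * t + 0)"
      by (rule val) (use that in simp)
    ultimately show ?thesis by (simp only: retraction_curve_def pv(1) fst_conv snd_conv)
  qed
  ultimately show "\<exists>J \<gamma>'. t\<^sub>0 \<in> J \<and> geodesic_on A nabla J \<gamma>' \<and> (\<forall>\<tau>\<in>J. retraction_curve r x \<tau> = \<gamma>' \<tau>)"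
    by (intro exI[of _ ?J] exI[of _ "\<lambda>t. \<gamma> (inverse T * t + 0)"] conjI ballI)
qed

end

theorem mainTheorem5:
  fixes A :: "('m::{t2_space,second_countable_topology}, 'e::{real_inner,heine_borel}) chart set"
    and r :: "'m \<times> ('m, 'e) tvec \<Rightarrow> 'm"
  assumes "smooth_manifold A"
    and "tangent_retraction A r"
  shows "(\<exists>nabla. affine_connection A nabla \<and>
            exp_domain A nabla = tangent_bundle A \<and>
            (\<forall>x\<in>tangent_bundle A. r x = exp_map A nabla x))
         \<longleftrightarrow> induces_flow A r"
proof
  interpret retraction_mfd A r using assms by unfold_locales
  {
    assume "\<exists>nabla. affine_connection A nabla \<and>
            exp_domain A nabla = tangent_bundle A \<and>
            (\<forall>x\<in>tangent_bundle A. r x = exp_map A nabla x)"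
    then obtain nabla where nabla: "affine_connection A nabla" "exp_domain A nabla = tangent_bundle A"
      "\<And>x. x \<in> tangent_bundle A \<Longrightarrow> r x = exp_map A nabla x" by blast
    interpret affine_retraction_mfd A nabla r using nabla(1) by unfold_locales
    show "induces_flow A r"
      by (rule geodesics_imp_flow[OF exp_imp_geodesics[OF nabla(2,3)]])
  next
    assume flow: "induces_flow A r"
    interpret affine_retraction_mfd A "retraction_connection A r" r
      using retraction_connection_affine by unfold_locales
    show "\<exists>nabla. affine_connection A nabla \<and>
            exp_domain A nabla = tangent_bundle A \<and>
            (\<forall>x\<in>tangent_bundle A. r x = exp_map A nabla x)"
      using retraction_connection_affine geodesics_imp_exp[OF flow_geodesic[OF flow]] by blast
  }
qed

end
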